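(* Let $X=\{(X_1(t),\dots,X_d(t)): t\in \mathbb{R}^n\}$ be a Gaussian random field in $\mathbb{R}^d$ such that $X_1,\dots,X_d$ are independent, centered, real-valued Gaussian random fields with almost surely continuous sample paths. Let $f\colon \mathbb{R}^n\to \mathbb{R}^d$ be a Borel map, and let $A\subset \mathbb{R}^n$ be an analytic set on which $X$ is regular. If $Z=X+f$ or $Z=(X+f)^*$, then, almost surely, $$\dim_P Z(A)=\dim_{P,Z} A.$$
   Context: $\dim_P$ denotes packing dimension. For $h\colon\mathbb{R}^n\to\mathbb{R}^d$, $h^*\colon \mathbb{R}^n\to\mathbb{R}^{n+d}$ is $h^*(t)=(t,h(t))$, so $h^*(A)$ is the graph of $h|_A$. $\mathcal{P}_c(A)$ is the set of Borel probability measures with compact support contained in $A$; for a measure $\mu$ and a map $h$, $\mu_h=\mu\circ h^{-1}$. $B(x,r)$ is the closed Euclidean ball. (One may take every sample path of $X$ continuous, so $Z$ is jointly measurable.) For a jointly measurable random map $Z\colon\mathbb{R}^n\to\mathbb{R}^m$ and $\mu\in\mathcal{P}_c(\mathbb{R}^n)$, define $$\dim_{P,Z}\mu=\sup\Big\{\gamma:\ \liminf_{r\to0+} r^{-\gamma}\,\mathbb{E}\big(\mu_Z(B(Z(t),r))\big)=0 \text{ for } \mu\text{-a.e. } t\Big\},$$ and for $A\subset\mathbb{R}^n$, $\dim_{P,Z}A=\sup\{\dim_{P,Z}\mu:\mu\in\mathcal{P}_c(A)\}$. The canonical pseudometric of $X_i$ is $\rho_i(t,s)=\sqrt{\mathbb{E}(X_i(t)-X_i(s))^2}$.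 $X$ is called regular on $A$ if $A=\bigcup_{k=1}^\infty A_k$ for some sets $A_k$ such that for all $k,N\in\mathbb{N}^+$ there is $c\in\mathbb{R}^+$ with $\rho_i(t,s)\le c\log^{-N}(1/|t-s|)$ for all $t,s\in A_k$ and all $1\le i\le d$. *)

theory Defs
  imports "HOL-Analysis.Analysis" "HOL-Probability.Probability"
begin

text \<open>delta-packing premeasure: supremum of sum of (2 r_i)^s over (finite, hence also
  countable) families of pairwise disjoint closed balls B(x_i,r_i), x_i in E, 0 < r_i <= delta.\<close>
definition packing_premeasure_delta :: "real \<Rightarrow> real \<Rightarrow> 'a::metric_space set \<Rightarrow> ennreal" where
  "packing_premeasure_delta s \<delta> E =
     (SUP F \<in> {F. finite F \<and> F \<subseteq> E \<times> {0<..\<delta>} \<and>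
                 (\<forall>p\<in>F. \<forall>q\<in>F. p \<noteq> q \<longrightarrow> cball (fst p) (snd p) \<inter> cball (fst q) (snd q) = {})}.
        \<Sum>p\<in>F. ennreal ((2 * snd p) powr s))"

definition packing_premeasure :: "real \<Rightarrow> 'a::metric_space set \<Rightarrow> ennreal" where
  "packing_premeasure s E = (INF \<delta> \<in> {0<..}. packing_premeasure_delta s \<delta> E)"

definition packing_measure :: "real \<Rightarrow> 'a::metric_space set \<Rightarrow> ennreal" where
  "packing_measure s E =
     (INF C \<in> {C :: nat \<Rightarrow> 'a set. E \<subseteq> (\<Union>i. C i)}. (\<Sum>i. packing_premeasure s (C i)))"

definition packing_dim :: "'a::metric_space set \<Rightarrow> ereal" where
  "packing_dim E = Sup {ereal s | s. packing_measure s E = \<infinity>}"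

definition analytic_set :: "'a::topological_space set \<Rightarrow> bool" where
  "analytic_set A \<longleftrightarrow> A = {} \<or>
     (\<exists>g :: (nat \<Rightarrow> nat) \<Rightarrow> 'a. continuous_on UNIV g \<and> A = range g)"

definition centered_gaussian_rv :: "'w measure \<Rightarrow> ('w \<Rightarrow> real) \<Rightarrow> bool" where
  "centered_gaussian_rv M Y \<longleftrightarrow> Y \<in> borel_measurable M \<and>
     ((AE \<omega> in M. Y \<omega> = 0) \<or> (\<exists>\<sigma>>0. distributed M lborel Y (normal_density 0 \<sigma>)))"

definition centered_gaussian_field :: "'w measure \<Rightarrow> ('w \<Rightarrow> 't \<Rightarrow> real) \<Rightarrow> bool" where
  "centered_gaussian_field M Y \<longleftrightarrow>
     (\<forall>S c. finite S \<longrightarrow> centered_gaussian_rv M (\<lambda>\<omega>. \<Sum>t\<in>S. c t * Y \<omega> t))"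

definition canon_metric :: "'w measure \<Rightarrow> ('w \<Rightarrow> 't \<Rightarrow> real^'d) \<Rightarrow> 'd \<Rightarrow> 't \<Rightarrow> 't \<Rightarrow> real" where
  "canon_metric M X i t s = sqrt (integral\<^sup>L M (\<lambda>\<omega>. (X \<omega> t $ i - X \<omega> s $ i)\<^sup>2))"

definition regular_on :: "'w measure \<Rightarrow> ('w \<Rightarrow> 'a::real_normed_vector \<Rightarrow> real^'d) \<Rightarrow> 'a set \<Rightarrow> bool" where
  "regular_on M X A \<longleftrightarrow>
     (\<exists>Ak :: nat \<Rightarrow> 'a set. A = (\<Union>k. Ak k) \<and>
        (\<forall>k (N::nat). \<exists>c>0. \<forall>t\<in>Ak k. \<forall>s\<in>Ak k. \<forall>i.
            0 < norm (t - s) \<and> norm (t - s) < 1 \<longrightarrow>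
            canon_metric M X i t s \<le> c / (ln (1 / norm (t - s))) ^ N))"

definition Pc :: "'a::euclidean_space set \<Rightarrow> 'a measure set" where
  "Pc A = {\<mu>. sets \<mu> = sets borel \<and> prob_space \<mu> \<and>
              (\<exists>K. compact K \<and> K \<subseteq> A \<and> emeasure \<mu> (space \<mu> - K) = 0)}"

definition exp_ball_mass :: "'w measure \<Rightarrow> ('w \<Rightarrow> 'a \<Rightarrow> 'b::metric_space) \<Rightarrow> 'a measure \<Rightarrow> 'a \<Rightarrow> real \<Rightarrow> ennreal" where
  "exp_ball_mass M Z \<mu> t r =
     (\<integral>\<^sup>+ \<omega>. emeasure \<mu> (Z \<omega> -` cball (Z \<omega> t) r \<inter> space \<mu>) \<partial>M)"

definition dimPZ_measure :: "'w measure \<Rightarrow> ('w \<Rightarrow> 'a \<Rightarrow> 'b::metric_space) \<Rightarrow> 'a measure \<Rightarrow> ereal" where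
  "dimPZ_measure M Z \<mu> =
     Sup {ereal \<gamma> | \<gamma>. AE t in \<mu>.
            Liminf (at_right 0) (\<lambda>r. ennreal (r powr (- \<gamma>)) * exp_ball_mass M Z \<mu> t r) = 0}"

definition dimPZ :: "'w measure \<Rightarrow> ('w \<Rightarrow> 'a::euclidean_space \<Rightarrow> 'b::metric_space) \<Rightarrow> 'a set \<Rightarrow> ereal" where
  "dimPZ M Z A = Sup (dimPZ_measure M Z ` Pc A)"

end

theory Submission
  imports Defs
begin

text \<open>
  Lower bound: if \<open>\<mu>\<close> lives on a compact subset of \<open>A\<close>, Fatou's lemma and Fubini's theorem turn the condition
  on the expected ball masses into the almost sure lower density condition for \<open>\<mu> \<circ> Z\<^sup>-\<^sup>1\<close>, and the
  \<open>5r\<close>-covering lemma gives infinite packing measure.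

  Upper bound: fix a sample point \<open>\<omega>\<close> outside a null set. If \<open>Z(A)\<close> has packing dimension above \<open>\<gamma>\<close>, a tree
  construction on a Suslin parametrization of \<open>A\<close> gives a measure \<open>\<mu>\<close> on a compact subset of \<open>A\<close> whose image
  \<open>\<nu>\<close> under \<open>Z(\<omega>)\<close> satisfies \<open>\<nu>(B(y, r)) \<le> r\<^sup>\<gamma>\<close> at arbitrarily small scales around every point. Regularity and
  chaining give \<open>\<bar>X\<^sub>i(t) - X\<^sub>i(s)\<bar> \<le> r\<^bsup>-\<epsilon>\<^esup> \<rho>\<^sub>i(t, s) + C r\<close> for this path, hence, by independence of the coordinates,
  \<open>P(\<bar>Z(t) - Z(s)\<bar> \<le> r)\<close> is at most \<open>r\<^bsup>-\<epsilon>\<^esup>\<close> times the product over the coordinates of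
  \<open>min 1 (r / \<bar>y\<^sub>i - z\<^sub>i\<bar>)\<close>, where \<open>y\<close> and \<open>z\<close> are the values of the fixed path at \<open>t\<close> and \<open>s\<close>. For
  \<open>\<nu>\<close>-almost every \<open>y\<close> the \<open>\<nu>\<close>-integral of this kernel is at most \<open>r\<^bsup>-\<epsilon>\<^esup>\<close> times the mass of the dyadic cube
  of side \<open>r\<close> at \<open>y\<close>, so the expected ball masses of \<open>\<mu>\<close> are as small as the ball masses of \<open>\<nu>\<close>.
\<close>

section \<open>Suslin sets\<close>

text \<open>The measure on \<open>A\<close> in the upper bound is built from the sample point
  \<omega>, so no null set may depend on the measure. The almost sure estimates therefore concern
  countably many bounded closed sets and all pairs of their points at once. The drift is merely
  Borel, so the paths of \<open>Z\<close> need not be continuous. The Suslin parametrization is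
  taken through the graph of \<open>f\<close>, which makes \<open>f\<close> continuous in the
  parameter, and one parametrization serves all \<omega>. Regularity is only logarithmic:
  oscillations of size 2^-n are controlled by nets of mesh about 2^-(2^(n\<epsilon>)). Their
  cardinality is exponential in 2^(n\<epsilon>) and is beaten by the Gaussian tail at
  2^(n\<epsilon>) standard deviations. This is the origin of the factor 2^(n\<epsilon>) in the
  probability bounds; the logarithmic sums of the kernel cost a second one, and a strict gap between
  two exponents pays for both. The graph costs nothing extra: a small increment of the graph forces
  |t - s| \<le> r, and there the additional position factors of the kernel are at least 1.\<close>

definition suslin :: "'a::topological_space set \<Rightarrow> bool" where
  "suslin S \<longleftrightarrow> (\<exists>F (g :: (nat \<Rightarrow> nat) \<Rightarrow> 'a). closed F \<and> continuous_on F g \<and> S = g ` F)"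

lemma analytic_imp_suslin: "analytic_set A \<Longrightarrow> suslin A"
  unfolding analytic_set_def suslin_def
proof (elim disjE exE conjE)
  assume "A = {}"
  then show "\<exists>F (g :: (nat \<Rightarrow> nat) \<Rightarrow> 'a). closed F \<and> continuous_on F g \<and> A = g ` F"
    by (intro exI[of _ "{}"]) auto
next
  fix g :: "(nat \<Rightarrow> nat) \<Rightarrow> 'a" assume "continuous_on UNIV g" "A = range g"
  then show "\<exists>F (g :: (nat \<Rightarrow> nat) \<Rightarrow> 'a). closed F \<and> continuous_on F g \<and> A = g ` F"
    by (intro exI[of _ UNIV] exI[of _ g]) auto
qed

lemma continuous_on_reindex: "continuous_on UNIV (\<lambda>(x::nat \<Rightarrow> nat) k. x (f k))"
  by (intro continuous_on_coordinatewise_then_product)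
     (auto intro: continuous_on_product_coordinates)

lemma closed_reindex:
  assumes "closed F"
  shows "closed {x::nat \<Rightarrow> nat. (\<lambda>k. x (f k)) \<in> F}"
  using closed_vimage[OF assms continuous_on_reindex] by (simp add: vimage_def)

lemma clopen_coordinate:
  "open {x::'i \<Rightarrow> nat. x i = m}" "closed {x::'i \<Rightarrow> nat. x i = m}" "closed {x::'i \<Rightarrow> nat. x i \<noteq> m}"
proof -
  have *: "continuous_on UNIV (\<lambda>x::'i \<Rightarrow> nat. x i)" by (rule continuous_on_product_coordinates)
  have "open ((\<lambda>x::'i \<Rightarrow> nat. x i) -` S)" for S
    by (intro open_vimage * discrete_topology_class.open_discrete)
  note o = this
  from o[of "{m}"] show "open {x::'i \<Rightarrow> nat. x i = m}" by (simp add: vimage_def)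
  from o[of "{m}"] show "closed {x::'i \<Rightarrow> nat. x i \<noteq> m}" by (simp add: vimage_def closed_def Compl_eq)
  from o[of "- {m}"] show "closed {x::'i \<Rightarrow> nat. x i = m}" by (simp add: vimage_def closed_def Compl_eq)
qed

text \<open>Coordinate 0 names the set and the shifted sequence is its parameter. A closed domain,
  instead of the whole Baire space, allows such conditions to be imposed by cutting out a closed
  set, and it admits the empty set.\<close>

lemma suslin_UN:
  fixes S :: "nat \<Rightarrow> 'a::metric_space set"
  assumes "\<And>i::nat. suslin (S i)"
  shows "suslin (\<Union>i. S i)"
proof -
  from assms obtain F and g :: "nat \<Rightarrow> (nat \<Rightarrow> nat) \<Rightarrow> 'a"
    where cl: "\<And>i. closed (F i)" and co: "\<And>i. continuous_on (F i) (g i)" and S: "\<And>i. S i = g i ` F i"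
    unfolding suslin_def by metis
  define sh :: "(nat \<Rightarrow> nat) \<Rightarrow> nat \<Rightarrow> nat" where "sh x = (\<lambda>k. x (Suc k))" for x
  define F' where "F' = {x. sh x \<in> F (x 0)}"
  define g' where "g' x = g (x 0) (sh x)" for x
  have F'_eq: "F' = (\<Inter>i. {x. x 0 \<noteq> i} \<union> {x. sh x \<in> F i})"
    unfolding F'_def by auto
  have "closed F'"
    unfolding F'_eq sh_def by (intro closed_INT ballI closed_Un clopen_coordinate closed_reindex cl)
  moreover have "continuous_on F' g'"
    unfolding continuous_on_def
  proof
    fix x assume x: "x \<in> F'"
    define i where "i = x 0"
    define T where "T = {y :: nat \<Rightarrow> nat. y 0 = i}"
    have sub: "sh ` (F' \<inter> T) \<subseteq> F i" unfolding F'_def T_def by auto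
    have "continuous_on (F' \<inter> T) (\<lambda>y. g i (sh y))"
      by (rule continuous_on_compose2[OF co _ sub])
         (use continuous_on_reindex[of Suc] in \<open>auto simp: sh_def intro: continuous_on_subset\<close>)
    then have "continuous_on (F' \<inter> T) g'"
      by (rule continuous_on_eq) (auto simp: g'_def T_def)
    then have "(g' \<longlongrightarrow> g' x) (at x within (F' \<inter> T))"
      using x by (auto simp: continuous_on_def T_def i_def)
    \<comment> \<open>Fixing coordinate 0 is an open condition, so near \<open>x\<close> only the
      single map \<open>g i\<close> is involved.\<close>
    moreover have "at x within F' = at x within (F' \<inter> T)"
      by (rule at_within_nhd[of x T]) (auto simp: T_def i_def clopen_coordinate)
    ultimately show "(g' \<longlongrightarrow> g' x) (at x within F')" by simp
  qed
  moreover have "(\<Union>i. S i) = g' ` F'"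
  proof safe
    fix y i assume "y \<in> S i"
    then obtain x where x: "x \<in> F i" "y = g i x" using S by auto
    define x' where "x' n = (case n of 0 \<Rightarrow> i | Suc k \<Rightarrow> x k)" for n
    have "sh x' = x" "x' 0 = i" by (auto simp: sh_def x'_def)
    then show "y \<in> g' ` F'" using x unfolding F'_def g'_def by (intro image_eqI[of _ _ x']) auto
  next
    fix x assume "x \<in> F'" then show "g' x \<in> (\<Union>i. S i)" unfolding F'_def g'_def S by auto
  qed
  ultimately show ?thesis unfolding suslin_def by blast
qed

text \<open>A fibre product: one sequence codes a parameter for every set through
  \<open>prod_encode\<close>, and the closed condition that all images agree with the first keeps
  exactly the common points.\<close>

lemma suslin_INT:
  fixes S :: "nat \<Rightarrow> 'a::metric_space set"
  assumes "\<And>i::nat. suslin (S i)"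
  shows "suslin (\<Inter>i. S i)"
proof -
  from assms obtain F and g :: "nat \<Rightarrow> (nat \<Rightarrow> nat) \<Rightarrow> 'a"
    where cl: "\<And>i. closed (F i)" and co: "\<And>i. continuous_on (F i) (g i)" and S: "\<And>i. S i = g i ` F i"
    unfolding suslin_def by metis
  define col :: "nat \<Rightarrow> (nat \<Rightarrow> nat) \<Rightarrow> nat \<Rightarrow> nat" where "col i x = (\<lambda>k. x (prod_encode (i, k)))" for i x
  define E where "E = (\<Inter>i. {x. col i x \<in> F i})"
  have clE: "closed E" unfolding E_def col_def by (intro closed_INT ballI closed_reindex cl)
  have coE: "continuous_on E (\<lambda>x. g i (col i x))" for i
    by (rule continuous_on_compose2[OF co])
       (use continuous_on_reindex[of "\<lambda>k. prod_encode (i,k)"] in \<open>auto simp: E_def col_def intro: continuous_on_subset\<close>)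
  define F' where "F' = (\<Inter>i. {x\<in>E. dist (g i (col i x)) (g 0 (col 0 x)) = 0})"
  have "closed F'"
    unfolding F'_def
    by (intro closed_INT ballI continuous_closed_preimage_constant continuous_intros coE clE)
  moreover have "continuous_on F' (\<lambda>x. g 0 (col 0 x))"
    by (rule continuous_on_subset[OF coE]) (auto simp: F'_def)
  moreover have "(\<Inter>i. S i) = (\<lambda>x. g 0 (col 0 x)) ` F'"
  proof (intro set_eqI iffI)
    fix y assume "y \<in> (\<Inter>i. S i)"
    then have "\<forall>i. \<exists>x. x \<in> F i \<and> y = g i x" using S by auto
    then obtain x where x: "\<And>i. x i \<in> F i" "\<And>i. y = g i (x i)" by metis
    define z where "z n = (case prod_decode n of (i, k) \<Rightarrow> x i k)" for n
    have z: "col i z = x i" for i by (auto simp: col_def z_def)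
    then have "z \<in> F'" using x unfolding F'_def E_def by auto
    then show "y \<in> (\<lambda>x. g 0 (col 0 x)) ` F'" using x(2)[of 0] z by (intro image_eqI[of _ _ z]) auto
  next
    fix y assume "y \<in> (\<lambda>x. g 0 (col 0 x)) ` F'"
    then obtain x where x: "x \<in> F'" "y = g 0 (col 0 x)" by auto
    show "y \<in> (\<Inter>i. S i)"
    proof
      fix i
      have "col i x \<in> F i" using x unfolding F'_def E_def by auto
      moreover have "g i (col i x) = g 0 (col 0 x)" using x unfolding F'_def by simp
      ultimately have "col i x \<in> F i" "y = g i (col i x)" using x by auto
      then show "y \<in> S i" unfolding S by auto
    qed
  qed
  ultimately show ?thesis unfolding suslin_def by blast
qed

text \<open>A sequence codes points \<open>d (x k)\<close> of a countable dense set. The closed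
  condition that step \<open>k\<close> is at most 2^-k makes them converge uniformly in
  \<open>x\<close>, so the limit map is continuous. It is onto, and \<open>S\<close> is the image of
  its preimage.\<close>

lemma closed_suslin:
  fixes S :: "'a::{complete_space,second_countable_topology} set"
  assumes "closed S"
  shows "suslin S"
proof -
  obtain D :: "'a set" where D: "countable D" "\<And>X. open X \<Longrightarrow> X \<noteq> {} \<Longrightarrow> \<exists>d\<in>D. d \<in> X"
    using countable_dense_exists by blast
  have "D \<noteq> {}" using D(2)[of UNIV] by auto
  define d where "d = from_nat_into D"
  have d: "\<exists>k. dist (d k) y < e" if e: "e > 0" for y e
  proof -
    obtain u where "u \<in> D" "u \<in> ball y e" using D(2)[of "ball y e"] e by auto
    then show ?thesis using from_nat_into_surj[OF D(1), of u] by (auto simp: d_def dist_commute)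
  qed
  define F where "F = (\<Inter>k. {x :: nat \<Rightarrow> nat. dist (d (x k)) (d (x (Suc k))) \<le> (1/2)^k})"
  have cont: "continuous_on UNIV (\<lambda>x :: nat \<Rightarrow> nat. d (x k))" for k
    by (rule continuous_on_compose2[of UNIV d]) (auto intro: continuous_on_product_coordinates)
  have clF: "closed F"
    unfolding F_def
    by (intro closed_INT ballI closed_Collect_le continuous_intros cont)
  have step: "dist (d (x m)) (d (x (m + k))) \<le> 2 * (1/2)^m - 2 * (1/2)^(m+k)" if "x \<in> F" for x m k
  proof (induction k)
    case (Suc k)
    have "dist (d (x (m+k))) (d (x (Suc (m+k)))) \<le> (1/2)^(m+k)" using that unfolding F_def by auto
    with Suc dist_triangle[of "d (x m)" "d (x (m + Suc k))" "d (x (m+k))"] show ?case by simp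
  qed simp
  have step': "dist (d (x m)) (d (x n)) \<le> 2 * (1/2)^m" if "x \<in> F" "m \<le> n" for x m n
  proof -
    have "m + (n - m) = n" using that(2) by simp
    with step[OF that(1), of m "n - m"] have "dist (d (x m)) (d (x n)) \<le> 2 * (1/2)^m - 2 * (1/2)^n" by (simp only:)
    moreover have "0 \<le> (1/2::real)^n" by simp
    ultimately show ?thesis by linarith
  qed
  define g where "g x = lim (\<lambda>k. d (x k))" for x :: "nat \<Rightarrow> nat"
  have lim: "(\<lambda>k. d (x k)) \<longlonglongrightarrow> g x" if x: "x \<in> F" for x
  proof -
    have "Cauchy (\<lambda>k. d (x k))"
    proof (rule metric_CauchyI)
      fix e :: real assume "e > 0"
      obtain N where N: "(1/2)^N < e / 4"
        using real_arch_pow_inv[of "e/4" "1/2"] \<open>e > 0\<close> by auto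
      show "\<exists>M. \<forall>m\<ge>M. \<forall>n\<ge>M. dist (d (x m)) (d (x n)) < e"
      proof (intro exI[of _ N] allI impI)
        fix m n assume "m \<ge> N" "n \<ge> N"
        then show "dist (d (x m)) (d (x n)) < e"
          using step'[OF x, of N m] step'[OF x, of N n] N
            dist_triangle3[of "d (x m)" "d (x n)" "d (x N)"] by simp
      qed
    qed
    then show ?thesis unfolding g_def using convergent_LIMSEQ_iff Cauchy_convergent by blast
  qed
  have gd: "dist (g x) (d (x m)) \<le> 2 * (1/2)^m" if "x \<in> F" for x m
  proof -
    have "(\<lambda>k. dist (d (x k)) (d (x m))) \<longlonglongrightarrow> dist (g x) (d (x m))"
      by (intro tendsto_intros lim that)
    then show ?thesis
      by (rule LIMSEQ_le_const2) (use step'[OF that, of m] in \<open>auto simp: dist_commute intro!: exI[of _ m]\<close>)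
  qed
  have "continuous_on F g"
  proof (rule uniform_limit_theorem[of _ "\<lambda>k x. d (x k)" sequentially])
    show "\<forall>\<^sub>F n in sequentially. continuous_on F (\<lambda>x. d (x n))"
      by (intro always_eventually allI continuous_on_subset[OF cont]) auto
    show "uniform_limit F (\<lambda>k x. d (x k)) g sequentially"
    proof (rule uniform_limitI)
      fix e :: real assume "e > 0"
      then have "\<forall>\<^sub>F n in sequentially. (1/2)^n < e / 2"
        using order_tendstoD(2)[OF LIMSEQ_power_zero[of "1/2::real"], of "e/2"] by simp
      then show "\<forall>\<^sub>F n in sequentially. \<forall>x\<in>F. dist (d (x n)) (g x) < e"
      proof eventually_elim
        case (elim n)
        show ?case
        proof
          fix x assume "x \<in> F"
          from gd[OF this, of n] elim show "dist (d (x n)) (g x) < e" by (simp add: dist_commute)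
        qed
      qed
    qed
  qed simp
  moreover have "\<exists>x\<in>F. g x = y" for y
  proof -
    \<comment> \<open>The quarter leaves room: each step is below 1/4 + 1/8 of 2^-k, so the code
      lies in \<open>F\<close>.\<close>
    have "\<forall>k. \<exists>m. dist (d m) y < (1/2)^k / 4" by (intro allI d) simp
    then obtain x where x: "\<And>k. dist (d (x k)) y < (1/2)^k / 4" by metis
    have "x \<in> F" unfolding F_def
    proof safe
      fix k
      show "dist (d (x k)) (d (x (Suc k))) \<le> (1/2)^k"
        using x[of k] x[of "Suc k", unfolded power_Suc] dist_triangle2[of "d (x k)" "d (x (Suc k))" y]
          zero_le_power[of "1/2::real" k] by linarith
    qed
    have "(\<lambda>k. dist (d (x k)) y) \<longlonglongrightarrow> 0"
    proof (rule tendsto_sandwich[OF _ _ tendsto_const])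
      show "\<forall>\<^sub>F k in sequentially. 0 \<le> dist (d (x k)) y" by simp
      show "\<forall>\<^sub>F k in sequentially. dist (d (x k)) y \<le> (1/2)^k / 4"
        using x by (intro always_eventually allI less_imp_le)
      show "(\<lambda>k. (1/2::real)^k / 4) \<longlonglongrightarrow> 0"
        by (intro tendsto_divide_zero LIMSEQ_power_zero) simp
    qed
    then have "(\<lambda>k. d (x k)) \<longlonglongrightarrow> y" by (rule tendsto_dist_iff[THEN iffD2])
    then show ?thesis using lim[OF \<open>x \<in> F\<close>] LIMSEQ_unique \<open>x \<in> F\<close> by blast
  qed
  ultimately have surj: "\<And>y. \<exists>x\<in>F. g x = y" and cont_g: "continuous_on F g" by blast+
  have "S = g ` (F \<inter> g -` S)"
  proof (intro set_eqI iffI)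
    fix y assume "y \<in> S"
    moreover obtain x where "x \<in> F" "g x = y" using surj by blast
    ultimately show "y \<in> g ` (F \<inter> g -` S)" by (intro image_eqI[of _ _ x]) auto
  qed auto
  moreover have "continuous_on (F \<inter> g -` S) g"
    by (rule continuous_on_subset[OF cont_g]) auto
  moreover have "closed (F \<inter> g -` S)"
    using continuous_closed_preimage[OF cont_g clF assms] .
  ultimately show ?thesis unfolding suslin_def by blast
qed

lemma suslin_Int:
  fixes S :: "'a::metric_space set"
  assumes "suslin S" "suslin T"
  shows "suslin (S \<inter> T)"
proof -
  have "S \<inter> T = (\<Inter>i::nat. if i = 0 then S else T)" by (auto split: if_splits)
  then show ?thesis using suslin_INT[of "\<lambda>i. if i = 0 then S else T"] assms by simp
qed

text \<open>Suslin sets are not stable under complements, so the induction over the \<sigma>-algebra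
  carries a set together with its complement. In the base case an open set is a countable union of
  closed sets.\<close>

lemma borel_suslin:
  fixes S :: "'a::{complete_space,second_countable_topology} set"
  assumes "S \<in> sets borel"
  shows "suslin S"
proof -
  have "S \<in> sigma_sets UNIV (Collect closed)"
    using assms by (simp add: borel_eq_closed)
  then have "suslin S \<and> suslin (- S)"
  proof (induction rule: sigma_sets.induct)
    case (Basic a)
    then have a: "closed a" by simp
    have "suslin (- a)"
    proof (cases "a = {}")
      case False
      have "- a = (\<Union>n::nat. {x. 1 / real (Suc n) \<le> infdist x a})"
      proof (intro set_eqI iffI)
        fix x assume "x \<in> - a"
        then have "infdist x a > 0" using in_closed_iff_infdist_zero[OF a False, of x] infdist_nonneg[of x a] by auto
        then show "x \<in> (\<Union>n::nat. {x. 1 / real (Suc n) \<le> infdist x a})"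
          using nat_approx_posE[of "infdist x a"] by (metis (mono_tags, lifting) UN_I UNIV_I less_imp_le mem_Collect_eq)
      next
        fix x assume "x \<in> (\<Union>n::nat. {x. 1 / real (Suc n) \<le> infdist x a})"
        then obtain n where "1 / real (Suc n) \<le> infdist x a" by auto
        moreover have "0 < 1 / real (Suc n)" by simp
        ultimately have "infdist x a > 0" by linarith
        then show "x \<in> - a" by auto
      qed
      moreover have "suslin (\<Union>n::nat. {x. 1 / real (Suc n) \<le> infdist x a})"
        by (intro suslin_UN closed_suslin closed_Collect_le continuous_intros)
      ultimately show ?thesis by simp
    qed (simp add: closed_suslin)
    then show ?case using a closed_suslin by auto
  next
    case Empty
    then show ?case by (simp add: closed_suslin)
  next
    case (Compl a)
    then show ?case by (simp add: Compl_eq_Diff_UNIV double_diff)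
  next
    case (Union a)
    then show ?case by (auto intro: suslin_UN suslin_INT)
  qed
  then show ?thesis by simp
qed

text \<open>The graph of a Borel map is Borel, hence Suslin. Even coordinates parametrize
  \<open>B\<close>, odd ones the graph; where the two first components agree, \<open>f\<close> of
  the parametrized point is the second component of the graph point and so depends continuously on
  the parameter.\<close>

lemma suslin_parametrization:
  fixes f :: "'a::{complete_space,second_countable_topology} \<Rightarrow> 'b::{complete_space,second_countable_topology}"
  assumes B: "suslin B" and f: "f \<in> borel_measurable borel"
  obtains F :: "(nat \<Rightarrow> nat) set" and a where
    "closed F" "continuous_on F a" "a ` F = B" "continuous_on F (\<lambda>x. f (a x))"
proof -
  obtain F1 and a1 :: "(nat \<Rightarrow> nat) \<Rightarrow> 'a" where 1: "closed F1" "continuous_on F1 a1" "B = a1 ` F1"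
    using B unfolding suslin_def by blast
  have "(\<lambda>p::'a\<times>'b. dist (f (fst p)) (snd p)) \<in> borel_measurable borel"
  proof (rule borel_measurable_dist)
    show "(\<lambda>p::'a\<times>'b. f (fst p)) \<in> borel_measurable borel"
      by (rule measurable_compose[OF _ f]) (intro borel_measurable_continuous_onI continuous_intros)
  qed (intro borel_measurable_continuous_onI continuous_intros)
  then have "(\<lambda>p. dist (f (fst p)) (snd p)) -` {0} \<inter> space borel \<in> sets borel"
    by (rule measurable_sets) simp
  then have "{p. f (fst p) = snd p} \<in> sets borel" by (simp add: vimage_def)
  then have "suslin {p. f (fst p) = snd p}" by (rule borel_suslin)
  then obtain F2 and g :: "(nat \<Rightarrow> nat) \<Rightarrow> 'a \<times> 'b" where
    2: "closed F2" "continuous_on F2 g" "{p. f (fst p) = snd p} = g ` F2"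
    unfolding suslin_def by blast
  define p1 :: "(nat \<Rightarrow> nat) \<Rightarrow> nat \<Rightarrow> nat" where "p1 x = (\<lambda>k. x (2 * k))" for x
  define p2 :: "(nat \<Rightarrow> nat) \<Rightarrow> nat \<Rightarrow> nat" where "p2 x = (\<lambda>k. x (2 * k + 1))" for x
  define E where "E = {x. p1 x \<in> F1} \<inter> {x. p2 x \<in> F2}"
  have clE: "closed E" unfolding E_def p1_def p2_def by (intro closed_Int closed_reindex 1 2)
  have c1: "continuous_on E (\<lambda>x. a1 (p1 x))"
    by (rule continuous_on_compose2[OF 1(2)])
       (use continuous_on_reindex[of "\<lambda>k. 2 * k"] in \<open>auto simp: E_def p1_def intro: continuous_on_subset\<close>)
  have c2: "continuous_on E (\<lambda>x. g (p2 x))"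
    by (rule continuous_on_compose2[OF 2(2)])
       (use continuous_on_reindex[of "\<lambda>k. 2 * k + 1"] in \<open>auto simp: E_def p2_def intro: continuous_on_subset\<close>)
  define F where "F = {x\<in>E. dist (a1 (p1 x)) (fst (g (p2 x))) = 0}"
  have "closed F" unfolding F_def
    by (intro continuous_closed_preimage_constant continuous_intros c1 c2 clE)
  moreover have "continuous_on F (\<lambda>x. a1 (p1 x))"
    by (rule continuous_on_subset[OF c1]) (auto simp: F_def)
  moreover have "(\<lambda>x. a1 (p1 x)) ` F = B"
  proof (intro set_eqI iffI)
    fix y assume "y \<in> B"
    then obtain x1 where x1: "x1 \<in> F1" "y = a1 x1" using 1 by auto
    have "(y, f y) \<in> g ` F2" using 2(3) by auto
    then obtain x2 where x2: "x2 \<in> F2" "g x2 = (y, f y)" by auto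
    define x where "x n = (if even n then x1 (n div 2) else x2 (n div 2))" for n
    have "p1 x = x1" "p2 x = x2" by (auto simp: p1_def p2_def x_def)
    then show "y \<in> (\<lambda>x. a1 (p1 x)) ` F" using x1 x2 by (auto simp: F_def E_def intro!: image_eqI[of _ _ x])
  next
    fix y assume "y \<in> (\<lambda>x. a1 (p1 x)) ` F"
    then obtain x where "x \<in> F" "y = a1 (p1 x)" by auto
    then show "y \<in> B" unfolding 1(3) F_def E_def by blast
  qed
  moreover have "continuous_on F (\<lambda>x. f (a1 (p1 x)))"
  proof (rule continuous_on_eq)
    show "continuous_on F (\<lambda>x. snd (g (p2 x)))"
      by (intro continuous_intros continuous_on_subset[OF c2]) (auto simp: F_def)
    fix x assume "x \<in> F"
    then have "g (p2 x) \<in> {p. f (fst p) = snd p}" "a1 (p1 x) = fst (g (p2 x))"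
      using 2(3) by (auto simp: F_def E_def)
    then show "snd (g (p2 x)) = f (a1 (p1 x))" by auto
  qed
  ultimately show thesis using that by blast
qed

section \<open>Packing measures and box counting\<close>

text \<open>Separated-set counting behind the upper box dimension, with constant 1. The separation
  2^-(n+1) is what disjoint balls with radii in (2^-(n+1), 2^-n] guarantee for their
  centres.\<close>

definition box_bounded :: "real \<Rightarrow> 'a::metric_space set \<Rightarrow> bool" where
  "box_bounded \<gamma> C \<longleftrightarrow> (\<exists>n0. \<forall>n\<ge>n0. \<forall>S. finite S \<longrightarrow> S \<subseteq> C \<longrightarrow>
     (\<forall>x\<in>S. \<forall>y\<in>S. x \<noteq> y \<longrightarrow> dist x y > (1/2)^(n+1)) \<longrightarrow> real (card S) \<le> 2 powr (real n * \<gamma>))"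

text \<open>The \<sigma>-ideal generated by the \<open>box_bounded\<close> sets, following the
  description of packing dimension as modified upper box dimension. It replaces packing measure
  where countably many pieces have to be discarded.\<close>

definition small :: "real \<Rightarrow> 'a::metric_space set \<Rightarrow> bool" where
  "small \<gamma> E \<longleftrightarrow> (\<exists>C :: nat \<Rightarrow> 'a set. E \<subseteq> (\<Union>i. C i) \<and> (\<forall>i. box_bounded \<gamma> (C i)))"

lemma small_mono: "small \<gamma> E \<Longrightarrow> D \<subseteq> E \<Longrightarrow> small \<gamma> D"
  unfolding small_def by (meson order_trans)

lemma box_bounded_imp_small: "box_bounded \<gamma> E \<Longrightarrow> small \<gamma> E"
  unfolding small_def by (intro exI[of _ "\<lambda>_. E"]) auto

lemma small_empty: "small \<gamma> {}"
  by (rule box_bounded_imp_small) (auto simp: box_bounded_def)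

lemma small_UN:
  assumes "\<And>i::nat. small \<gamma> (E i)"
  shows "small \<gamma> (\<Union>i. E i)"
proof -
  from assms obtain C :: "nat \<Rightarrow> nat \<Rightarrow> 'a set"
    where C: "\<And>i. E i \<subseteq> (\<Union>j. C i j)" "\<And>i j. box_bounded \<gamma> (C i j)"
    unfolding small_def by metis
  have "(\<Union>i. E i) \<subseteq> (\<Union>k. case prod_decode k of (i, j) \<Rightarrow> C i j)"
  proof
    fix x assume "x \<in> (\<Union>i. E i)"
    then obtain i j where "x \<in> C i j" using C(1) by blast
    then show "x \<in> (\<Union>k. case prod_decode k of (i, j) \<Rightarrow> C i j)"
      by (intro UN_I[of "prod_encode (i, j)"]) auto
  qed
  then show ?thesis unfolding small_def
    by (intro exI[of _ "\<lambda>k. case prod_decode k of (i, j) \<Rightarrow> C i j"]) (auto simp: C(2) split: prod.splits)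
qed

lemma small_Un:
  assumes "small \<gamma> D" "small \<gamma> E"
  shows "small \<gamma> (D \<union> E)"
proof -
  have "small \<gamma> (\<Union>i::nat. if i = 0 then D else E)" using assms by (intro small_UN) auto
  then show ?thesis by (rule small_mono) (auto split: if_splits)
qed

section \<open>Packing premeasure from box counts\<close>

lemma dyadic_scale:
  fixes r :: real
  assumes "0 < r" "r \<le> 1"
  obtains n where "(1/2)^(Suc n) < r" "r \<le> (1/2)^n"
proof -
  obtain m where "(1/2)^m < r" using real_arch_pow_inv[of r "1/2"] assms by auto
  moreover have "(1/2)^m \<ge> (1/2::real)^(Suc m)" by simp
  ultimately have ex: "\<exists>m. (1/2)^(Suc m) < r" by (meson le_less_trans)
  define n where "n = (LEAST m. (1/2)^(Suc m) < r)"
  have "(1/2)^(Suc n) < r" unfolding n_def by (rule LeastI_ex[OF ex])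
  moreover have "r \<le> (1/2)^n"
  proof (cases n)
    case (Suc k)
    then have "\<not> (1/2)^(Suc k) < r" unfolding n_def using not_less_Least lessI by metis
    then show ?thesis using Suc by simp
  qed (use assms in simp)
  ultimately show thesis using that by blast
qed

lemma geometric_tail_finite_sum:
  fixes q :: real
  assumes "0 < q" "q < 1" "finite N" "\<And>n. n \<in> N \<Longrightarrow> k \<le> n"
  shows "(\<Sum>n\<in>N. q^n) \<le> q^k / (1 - q)"
proof -
  have eq: "(1 - q) * (\<Sum>n\<in>{k..<k+l}. q^n) = q^k - q^(k+l)" for l
  proof (induction l)
    case (Suc l)
    have "(1 - q) * (\<Sum>n\<in>{k..<k+Suc l}. q^n) = (1 - q) * (\<Sum>n\<in>{k..<k+l}. q^n) + (1 - q) * q^(k+l)"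
      by (simp add: distrib_left)
    also have "\<dots> = q^k - q^(k + Suc l)" unfolding Suc by (simp add: algebra_simps)
    finally show ?case .
  qed simp
  obtain l where "N \<subseteq> {k..<k+l}"
  proof -
    have "N \<subseteq> {k..<k + Suc (Max N)}"
    proof
      fix n assume "n \<in> N"
      then show "n \<in> {k..<k + Suc (Max N)}" using assms(4)[of n] Max_ge[OF assms(3), of n] by simp
    qed
    then show thesis using that by blast
  qed
  then have "(\<Sum>n\<in>N. q^n) \<le> (\<Sum>n\<in>{k..<k+l}. q^n)"
    using assms by (intro sum_mono2) auto
  moreover have "(1 - q) * (\<Sum>n\<in>{k..<k+l}. q^n) \<le> q^k" using eq[of l] assms by simp
  then have "(\<Sum>n\<in>{k..<k+l}. q^n) \<le> q^k / (1 - q)" using assms by (simp add: pos_le_divide_eq mult.commute)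
  ultimately show ?thesis by simp
qed

text \<open>Sort the balls of a packing by dyadic radius. At most 2^(n\<gamma>) of them have radius
  about 2^-n, each contributing at most (2 * 2^-n)^s, so with ratio q = 2^(\<gamma>-s) < 1 the whole
  packing is bounded by a geometric tail.\<close>

lemma box_bounded_packing_premeasure:
  assumes bb: "box_bounded \<gamma> C" and \<gamma>: "0 \<le> \<gamma>" "\<gamma> < s"
  shows "packing_premeasure s C = 0"
proof -
  from bb[unfolded box_bounded_def] obtain n0 where n0: "\<forall>n\<ge>n0. \<forall>S. finite S \<longrightarrow> S \<subseteq> C \<longrightarrow>
     (\<forall>x\<in>S. \<forall>y\<in>S. x \<noteq> y \<longrightarrow> dist x y > (1/2)^(n+1)) \<longrightarrow> real (card S) \<le> 2 powr (real n * \<gamma>)"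
    by (rule exE)
  define q where "q = 2 powr (\<gamma> - s)"
  have q: "0 < q" "q < 1" using \<gamma> powr_less_mono[of "\<gamma> - s" 0 2] by (auto simp: q_def)
  define c where "c = 2 powr s / (1 - q)"
  have c: "c \<ge> 0" using q by (auto simp: c_def)
  have bound: "packing_premeasure_delta s ((1/2)^k) C \<le> ennreal (c * q^k)" if k: "k \<ge> n0" for k
    unfolding packing_premeasure_delta_def
  proof (rule SUP_least)
    fix P assume "P \<in> {F. finite F \<and> F \<subseteq> C \<times> {0<..(1/2)^k} \<and>
      (\<forall>p\<in>F. \<forall>q\<in>F. p \<noteq> q \<longrightarrow> cball (fst p) (snd p) \<inter> cball (fst q) (snd q) = {})}"
    then have P: "finite P" "\<And>p. p \<in> P \<Longrightarrow> fst p \<in> C" "\<And>p. p \<in> P \<Longrightarrow> 0 < snd p"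
        "\<And>p. p \<in> P \<Longrightarrow> snd p \<le> (1/2)^k"
      and disj: "\<And>p q. p \<in> P \<Longrightarrow> q \<in> P \<Longrightarrow> p \<noteq> q \<Longrightarrow> cball (fst p) (snd p) \<inter> cball (fst q) (snd q) = {}"
      by auto
    have "\<exists>n. (1/2)^(Suc n) < snd p \<and> snd p \<le> (1/2)^n" if "p \<in> P" for p
    proof -
      have "snd p \<le> 1" using P(4)[OF that] power_le_one[of "1/2::real" k] by linarith
      then show ?thesis using dyadic_scale[of "snd p"] P(3)[OF that] by metis
    qed
    then obtain lev where lev: "\<And>p. p \<in> P \<Longrightarrow> (1/2)^(Suc (lev p)) < snd p" "\<And>p. p \<in> P \<Longrightarrow> snd p \<le> (1/2)^(lev p)"
      by metis
    have levk: "k \<le> lev p" if "p \<in> P" for p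
    proof (rule ccontr)
      assume "\<not> k \<le> lev p"
      then have "(1/2::real)^k \<le> (1/2)^(Suc (lev p))" by (intro power_decreasing) auto
      then show False using lev(1)[OF that] P(4)[OF that] by linarith
    qed
    have grp: "(\<Sum>p\<in>{p\<in>P. lev p = n}. (2 * snd p) powr s) \<le> 2 powr s * q^n" if n: "n \<in> lev ` P" for n
    proof -
      let ?G = "{p\<in>P. lev p = n}"
      \<comment> \<open>Otherwise the centre of the second ball would lie in both balls.\<close>
      have far: "dist (fst p) (fst p') > (1/2)^(n+1)" if "p \<in> ?G" "p' \<in> ?G" "p \<noteq> p'" for p p'
      proof (rule ccontr)
        assume "\<not> dist (fst p) (fst p') > (1/2)^(n+1)"
        then have "fst p' \<in> cball (fst p) (snd p) \<inter> cball (fst p') (snd p')"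
          using lev(1)[of p] P(3)[of p'] that by auto
        then show False using disj[of p p'] that by auto
      qed
      have inj: "inj_on fst ?G"
      proof (rule inj_onI, rule ccontr)
        fix p p' assume "p \<in> ?G" "p' \<in> ?G" "fst p = fst p'" "p \<noteq> p'"
        then show False using far[of p p'] zero_le_power[of "1/2::real" "n+1"] by simp
      qed
      have "real (card (fst ` ?G)) \<le> 2 powr (real n * \<gamma>)"
      proof (rule n0[rule_format])
        show "n0 \<le> n" using n levk k by (blast intro: order_trans)
        show "finite (fst ` ?G)" "fst ` ?G \<subseteq> C" using P by auto
        fix x y assume "x \<in> fst ` ?G" "y \<in> fst ` ?G" "x \<noteq> y"
        then show "dist x y > (1/2)^(n+1)" using far by blast
      qed
      then have card: "real (card ?G) \<le> 2 powr (real n * \<gamma>)" using card_image[OF inj] by simp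
      have "(\<Sum>p\<in>?G. (2 * snd p) powr s) \<le> (\<Sum>p\<in>?G. (2 * (1/2)^n) powr s)"
        using lev(2) P(3) \<gamma> by (intro sum_mono powr_mono2) (auto simp: less_imp_le)
      also have "\<dots> = real (card ?G) * (2 * (1/2)^n) powr s" by simp
      also have "\<dots> \<le> 2 powr (real n * \<gamma>) * (2 * (1/2)^n) powr s"
        by (rule mult_right_mono[OF card]) simp
      also have "\<dots> = 2 powr s * q^n"
      proof -
        have "(2 * (1/2::real)^n) = 2 powr (1 - real n)"
          by (simp add: powr_diff powr_realpow power_one_over)
        moreover have "q^n = 2 powr (real n * (\<gamma> - s))"
          by (simp add: q_def powr_powr mult.commute flip: powr_realpow)
        ultimately show ?thesis by (simp add: powr_powr flip: powr_add) (simp add: algebra_simps)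
      qed
      finally show ?thesis .
    qed
    have "(\<Sum>p\<in>P. (2 * snd p) powr s) = (\<Sum>n\<in>lev ` P. \<Sum>p\<in>{p\<in>P. lev p = n}. (2 * snd p) powr s)"
      by (rule sum.image_gen[OF P(1)])
    also have "\<dots> \<le> (\<Sum>n\<in>lev ` P. 2 powr s * q^n)" by (rule sum_mono[OF grp])
    also have "\<dots> = 2 powr s * (\<Sum>n\<in>lev ` P. q^n)" by (simp add: sum_distrib_left)
    also have "\<dots> \<le> 2 powr s * (q^k / (1 - q))"
      using levk P(1) q by (intro mult_left_mono geometric_tail_finite_sum) auto
    finally have "(\<Sum>p\<in>P. (2 * snd p) powr s) \<le> c * q^k" by (simp add: c_def)
    then show "(\<Sum>p\<in>P. ennreal ((2 * snd p) powr s)) \<le> ennreal (c * q^k)"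
      by (simp add: sum_ennreal ennreal_leI)
  qed
  have "packing_premeasure s C \<le> ennreal (c * q^k)" if "k \<ge> n0" for k
    unfolding packing_premeasure_def
    by (rule INF_lower2[of "(1/2)^k"]) (simp_all add: bound that)
  moreover have "(\<lambda>k. ennreal (c * q^k)) \<longlonglongrightarrow> ennreal (c * 0)"
    using q by (intro tendsto_ennrealI tendsto_intros LIMSEQ_power_zero) auto
  ultimately have "packing_premeasure s C \<le> ennreal (c * 0)"
    by (intro LIMSEQ_le_const) auto
  then show ?thesis by simp
qed

lemma packing_measure_infinite_not_small:
  assumes "packing_measure s E = \<infinity>" "0 \<le> \<gamma>" "\<gamma> < s"
  shows "\<not> small \<gamma> E"
proof
  assume "small \<gamma> E"
  then obtain C where C: "E \<subseteq> (\<Union>i::nat. C i)" "\<And>i. box_bounded \<gamma> (C i)" unfolding small_def by auto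
  have "packing_measure s E \<le> (\<Sum>i. packing_premeasure s (C i))"
    unfolding packing_measure_def using C(1) by (intro INF_lower) auto
  also have "\<dots> = 0" using box_bounded_packing_premeasure[OF C(2) assms(2,3)] by simp
  finally show False using assms(1) by simp
qed

lemma not_small_many_points:
  assumes "\<not> small \<gamma> E"
  obtains n S where "n \<ge> k" "finite S" "S \<subseteq> E"
    "\<And>x y. x \<in> S \<Longrightarrow> y \<in> S \<Longrightarrow> x \<noteq> y \<Longrightarrow> dist x y > (1/2)^(n+1)" "2 powr (real n * \<gamma>) < real (card S)"
proof -
  have "\<not> box_bounded \<gamma> E" using assms box_bounded_imp_small by blast
  then obtain n S where "n \<ge> k" "finite S" "S \<subseteq> E"
    "\<forall>x\<in>S. \<forall>y\<in>S. x \<noteq> y \<longrightarrow> dist x y > (1/2)^(n+1)" "\<not> real (card S) \<le> 2 powr (real n * \<gamma>)"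
    unfolding box_bounded_def not_ex not_all not_imp by (elim allE[of _ k]) blast
  then show thesis by (intro that[of n S]) auto
qed

section \<open>Tree measures on Suslin sets\<close>

definition cyl :: "(nat \<Rightarrow> nat) \<Rightarrow> nat \<Rightarrow> (nat \<Rightarrow> nat) set" where
  "cyl x n = {y. \<forall>i<n. y i = x i}"

lemma cyl_self: "x \<in> cyl x n"
  by (simp add: cyl_def)

lemma cyl_antimono: "m \<le> n \<Longrightarrow> cyl x n \<subseteq> cyl x m"
  by (auto simp: cyl_def)

lemma open_contains_cyl:
  assumes "open U" "x \<in> U"
  obtains n where "cyl x n \<subseteq> U"
proof -
  have "openin (product_topology (\<lambda>i. euclidean) UNIV) U"
    using assms(1) by (simp add: euclidean_product_topology)
  from product_topology_open_contains_basis[OF this assms(2)] obtain X where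
    X: "x \<in> (\<Pi>\<^sub>E i\<in>UNIV. X i)" "finite {i. X i \<noteq> UNIV}" "(\<Pi>\<^sub>E i\<in>UNIV. X i) \<subseteq> U" by auto
  obtain n where n: "\<And>i. X i \<noteq> UNIV \<Longrightarrow> i < n"
    using X(2) by (auto simp: finite_nat_set_iff_bounded)
  have "cyl x n \<subseteq> (\<Pi>\<^sub>E i\<in>UNIV. X i)"
  proof
    fix y assume y: "y \<in> cyl x n"
    have "y i \<in> X i" for i
    proof (cases "X i = UNIV")
      case False
      then have "y i = x i" using n y by (auto simp: cyl_def)
      then show ?thesis using X(1) by auto
    qed auto
    then show "y \<in> (\<Pi>\<^sub>E i\<in>UNIV. X i)" by auto
  qed
  then show thesis using that X(3) by blast
qed

lemma continuous_on_cyl: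
  fixes h :: "(nat \<Rightarrow> nat) \<Rightarrow> 'b::metric_space"
  assumes "continuous_on F h" "x \<in> F" "e > 0"
  obtains n where "h ` (F \<inter> cyl x n) \<subseteq> cball (h x) e"
proof -
  from assms(1)[unfolded continuous_on_open_invariant, rule_format, OF open_ball[of "h x" e]]
  obtain U where U: "open U" "U \<inter> F = h -` ball (h x) e \<inter> F" by blast
  have "x \<in> U" using U assms by auto
  then obtain n where "cyl x n \<subseteq> U" using open_contains_cyl U(1) by blast
  then have "h ` (F \<inter> cyl x n) \<subseteq> cball (h x) e"
  proof (intro image_subsetI)
    fix y assume "cyl x n \<subseteq> U" "y \<in> F \<inter> cyl x n"
    then have "y \<in> h -` ball (h x) e \<inter> F" using U(2) by blast
    then show "h y \<in> cball (h x) e" by simp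
  qed
  then show thesis by (rule that)
qed

text \<open>The points having some cylinder with small image are covered by countably many such
  cylinders, since there are countably many finite words, and a countable union of small images is
  small. With \<open>U\<close> a cylinder this shows that the remaining kernel is nowhere
  small.\<close>

lemma small_image_kernel:
  fixes h :: "(nat \<Rightarrow> nat) \<Rightarrow> 'b::metric_space"
  assumes "small \<gamma> (h ` ({x\<in>F. \<forall>n. \<not> small \<gamma> (h ` (F \<inter> cyl x n))} \<inter> U))"
  shows "small \<gamma> (h ` (F \<inter> U))"
proof -
  define L where "L \<sigma> = {y :: nat \<Rightarrow> nat. \<forall>i<length \<sigma>. y i = \<sigma> ! i}" for \<sigma>
  define D where "D m = (let \<sigma> = from_nat m in if small \<gamma> (h ` (F \<inter> L \<sigma>)) then h ` (F \<inter> L \<sigma>) else {})" for m :: nat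
  have "small \<gamma> (\<Union>m. D m)" by (intro small_UN) (simp add: D_def Let_def small_empty)
  with assms have "small \<gamma> (h ` ({x\<in>F. \<forall>n. \<not> small \<gamma> (h ` (F \<inter> cyl x n))} \<inter> U) \<union> (\<Union>m. D m))"
    by (rule small_Un)
  then show ?thesis
  proof (rule small_mono, intro image_subsetI)
    fix y assume y: "y \<in> F \<inter> U"
    show "h y \<in> h ` ({x\<in>F. \<forall>n. \<not> small \<gamma> (h ` (F \<inter> cyl x n))} \<inter> U) \<union> (\<Union>m. D m)"
    proof (cases "\<forall>n. \<not> small \<gamma> (h ` (F \<inter> cyl y n))")
      case False
      then obtain n where n: "small \<gamma> (h ` (F \<inter> cyl y n))" by auto
      define \<sigma> where "\<sigma> = map y [0..<n]"
      have "L \<sigma> = cyl y n" by (auto simp: L_def cyl_def \<sigma>_def)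
      then have "D (to_nat \<sigma>) = h ` (F \<inter> cyl y n)" using n by (simp add: D_def)
      then show ?thesis using y cyl_self by blast
    qed (use y in blast)
  qed
qed

text \<open>One branching below the point \<open>x\<close>, known up to length \<open>n\<close>: a
  scale \<open>j\<close> at least \<open>k\<close>, \<open>N\<close> children \<open>Y\<close> in
  the kernel \<open>F'\<close>, and a length \<open>n'\<close> to which they are then known. The
  radius 2^-(j+4) is matched to the separation 2^-(j+1): the images of the cylinders of two children
  stay more than 2^-(j+3) apart. A single branching already has at least 2^(j\<gamma>)
  children.\<close>

definition tree_step where
  "tree_step F F' h \<gamma> x n k j N Y n' \<longleftrightarrow> k \<le> j \<and> n < n' \<and> 1 \<le> N \<and> 2 powr (real j * \<gamma>) \<le> real N \<and>
     (\<forall>i. Y i \<in> F' \<inter> cyl x n) \<and>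
     (\<forall>i<N. \<forall>i'<N. i \<noteq> i' \<longrightarrow> dist (h (Y i)) (h (Y i')) > (1/2)^(j+1)) \<and>
     (\<forall>i. h ` (F \<inter> cyl (Y i) n') \<subseteq> cball (h (Y i)) ((1/2)^(j+4)))"

text \<open>The kernel below \<open>x\<close> has an image that is not small, so it contains large
  separated sets at some scale beyond \<open>k\<close>. Continuity of \<open>h\<close> gives each
  child a length, and finiteness gives a common one.\<close>

lemma tree_step_exists:
  fixes h :: "(nat \<Rightarrow> nat) \<Rightarrow> 'b::metric_space"
  assumes h: "continuous_on F h" and F': "F' = {x\<in>F. \<forall>n. \<not> small \<gamma> (h ` (F \<inter> cyl x n))}"
    and x: "x \<in> F'"
  shows "\<exists>j N Y n'. tree_step F F' h \<gamma> x n k j N Y n'"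
proof -
  have "\<not> small \<gamma> (h ` (F' \<inter> cyl x n))"
  proof
    assume "small \<gamma> (h ` (F' \<inter> cyl x n))"
    then have "small \<gamma> (h ` (F \<inter> cyl x n))" unfolding F' by (rule small_image_kernel)
    then show False using x F' by auto
  qed
  then obtain j S where S: "j \<ge> k" "finite S" "S \<subseteq> h ` (F' \<inter> cyl x n)"
    "\<And>x y. x \<in> S \<Longrightarrow> y \<in> S \<Longrightarrow> x \<noteq> y \<Longrightarrow> dist x y > (1/2)^(j+1)" "2 powr (real j * \<gamma>) < real (card S)"
    by (rule not_small_many_points[of _ _ k]) (rule that)
  define N where "N = card S"
  have N: "1 \<le> N"
  proof -
    have "0 < real N" using S(5) powr_ge_zero[of 2 "real j * \<gamma>"] unfolding N_def by linarith
    then show ?thesis by simp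
  qed
  obtain e where e: "bij_betw e {0..<N} S" using ex_bij_betw_nat_finite[OF S(2)] N_def by blast
  have eS: "e i \<in> S" if "i < N" for i using e that by (auto simp: bij_betw_def)
  then have "\<forall>i. \<exists>y. i < N \<longrightarrow> y \<in> F' \<inter> cyl x n \<and> h y = e i" using S(3) by (metis imageE subsetD)
  then obtain Y0 where Y0: "\<And>i. i < N \<Longrightarrow> Y0 i \<in> F' \<inter> cyl x n" "\<And>i. i < N \<Longrightarrow> h (Y0 i) = e i" by metis
  \<comment> \<open>Indices from \<open>N\<close> on repeat child 0, so the requirements on all
    \<open>Y i\<close> hold without a side condition.\<close>
  define Y where "Y i = (if i < N then Y0 i else Y0 0)" for i
  have Y: "Y i \<in> F' \<inter> cyl x n" for i using Y0(1) N unfolding Y_def by auto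
  have "\<exists>m. h ` (F \<inter> cyl (Y i) m) \<subseteq> cball (h (Y i)) ((1/2)^(j+4))" for i
  proof -
    have "Y i \<in> F" using Y[of i] F' by auto
    then obtain m where "h ` (F \<inter> cyl (Y i) m) \<subseteq> cball (h (Y i)) ((1/2)^(j+4))"
      by (rule continuous_on_cyl[OF h, of "Y i" "(1/2)^(j+4)"]) simp_all
    then show ?thesis by blast
  qed
  then obtain m where m: "\<And>i. h ` (F \<inter> cyl (Y i) (m i)) \<subseteq> cball (h (Y i)) ((1/2)^(j+4))" by metis
  define n' where "n' = Suc n + (\<Sum>i<N. m i)"
  have mn: "m i \<le> n'" if "i < N" for i
    using member_le_sum[of i "{..<N}" m] that unfolding n'_def by auto
  have "h ` (F \<inter> cyl (Y i) n') \<subseteq> cball (h (Y i)) ((1/2)^(j+4))" for i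
  proof -
    define i' where "i' = (if i < N then i else 0)"
    have "i' < N" "Y i = Y i'" using N by (auto simp: i'_def Y_def)
    then have "h ` (F \<inter> cyl (Y i) n') \<subseteq> h ` (F \<inter> cyl (Y i') (m i'))"
      using cyl_antimono[OF mn] by (metis Int_mono image_mono order_refl)
    also have "\<dots> \<subseteq> cball (h (Y i)) ((1/2)^(j+4))" using m \<open>Y i = Y i'\<close> by metis
    finally show ?thesis .
  qed
  moreover have "dist (h (Y i)) (h (Y i')) > (1/2)^(j+1)" if "i < N" "i' < N" "i \<noteq> i'" for i i'
  proof -
    have "e i \<noteq> e i'" using e that by (auto simp: bij_betw_def inj_on_def)
    then show ?thesis using S(4)[OF eS eS] that Y0(2) by (simp add: Y_def)
  qed
  moreover have "n < n'" by (simp add: n'_def)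
  ultimately have "tree_step F F' h \<gamma> x n k j N Y n'"
    unfolding tree_step_def using S(1,5) N Y N_def by auto
  then show ?thesis by blast
qed

lemma closed_sequence_box: "closed {c :: 'i \<Rightarrow> nat. \<forall>\<tau>. c \<tau> < N \<tau>}"
proof -
  have "{c :: 'i \<Rightarrow> nat. \<forall>\<tau>. c \<tau> < N \<tau>} = (\<Inter>\<tau>. \<Inter>m\<in>{N \<tau>..}. {c. c \<tau> \<noteq> m})"
    by (auto simp: not_le[symmetric])
  also have "closed \<dots>" by (intro closed_INT ballI clopen_coordinate)
  finally show ?thesis .
qed

lemma compact_sequence_box: "compact {c :: 'i \<Rightarrow> nat. \<forall>\<tau>. c \<tau> < N \<tau>}"
proof -
  have eq: "{c :: 'i \<Rightarrow> nat. \<forall>\<tau>. c \<tau> < N \<tau>} = PiE UNIV (\<lambda>\<tau>. {..<N \<tau>})" by (auto simp: PiE_def Pi_def)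
  have "compactin (product_topology (\<lambda>\<tau>. euclidean) UNIV) (PiE UNIV (\<lambda>\<tau>::'i. {..<N \<tau>}))"
    unfolding compactin_PiE by (simp add: finite_imp_compact)
  then show ?thesis unfolding eq by (simp add: euclidean_product_topology)
qed

lemma continuous_on_locally_constant_coordinates:
  fixes z :: "'c::topological_space \<Rightarrow> 'i \<Rightarrow> nat"
  assumes "\<And>i m. open {c. z c i = m}"
  shows "continuous_on UNIV z"
proof (rule continuous_on_coordinatewise_then_product)
  fix i
  have "open ((\<lambda>c. z c i) -` B)" for B
  proof -
    have "(\<lambda>c. z c i) -` B = (\<Union>m\<in>B. {c. z c i = m})" by auto
    then show ?thesis using assms by auto
  qed
  then show "continuous_on UNIV (\<lambda>c. z c i)" by (simp add: continuous_on_open_vimage)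
qed

text \<open>A point of the probability space assigns to every finite word the child chosen there;
  independent uniform choices form the product measure \<open>P\<close>, and \<open>z\<close> maps a
  choice to the limit of the branch that it follows. Closeness to the image of \<open>z c0\<close>
  forces the same choice as \<open>c0\<close> at the node reached after \<open>k\<close> steps, an
  event about a single coordinate. Since that node alone has at least 2^(n\<gamma>) children, no
  product over the levels is needed.\<close>

lemma tree_measure:
  fixes h :: "(nat \<Rightarrow> nat) \<Rightarrow> 'b::metric_space"
  assumes F: "closed F" and h: "continuous_on F h" and ns: "\<not> small \<gamma> (h ` F)"
  obtains P :: "(nat list \<Rightarrow> nat) measure" and KK z where
    "prob_space P" "sets P = sets borel" "compact KK" "closed KK" "continuous_on UNIV z" "z ` KK \<subseteq> F"
    "AE c in P. c \<in> KK"
    "\<And>c0 k. c0 \<in> KK \<Longrightarrow> \<exists>n\<ge>k. emeasure P {c\<in>KK. dist (h (z c)) (h (z c0)) \<le> (1/2)^(n+3)} \<le> ennreal (2 powr - (real n * \<gamma>))"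
proof -
  define F' where "F' = {x\<in>F. \<forall>n. \<not> small \<gamma> (h ` (F \<inter> cyl x n))}"
  have "F' \<noteq> {}"
  proof
    assume "F' = {}"
    then have "small \<gamma> (h ` (F' \<inter> UNIV))" by (simp add: small_empty)
    then have "small \<gamma> (h ` (F \<inter> UNIV))" unfolding F'_def by (rule small_image_kernel)
    then show False using ns by simp
  qed
  then obtain x0 where x0: "x0 \<in> F'" by auto
  have "\<forall>s. \<exists>r. fst s \<in> F' \<longrightarrow> tree_step F F' h \<gamma> (fst s) (fst (snd s)) (snd (snd s)) (fst r) (fst (snd r)) (fst (snd (snd r))) (snd (snd (snd r)))"
  proof (intro allI)
    fix s :: "(nat \<Rightarrow> nat) \<times> nat \<times> nat"
    show "\<exists>r. fst s \<in> F' \<longrightarrow> tree_step F F' h \<gamma> (fst s) (fst (snd s)) (snd (snd s)) (fst r) (fst (snd r)) (fst (snd (snd r))) (snd (snd (snd r)))"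
    proof (cases "fst s \<in> F'")
      case True
      then obtain j N Y n' where "tree_step F F' h \<gamma> (fst s) (fst (snd s)) (snd (snd s)) j N Y n'"
        using tree_step_exists[OF h F'_def] by blast
      then show ?thesis by (intro exI[of _ "(j, N, Y, n')"]) simp
    qed simp
  qed
  from choice[OF this] obtain st where st: "\<And>s. fst s \<in> F' \<Longrightarrow>
    tree_step F F' h \<gamma> (fst s) (fst (snd s)) (snd (snd s)) (fst (st s)) (fst (snd (st s))) (fst (snd (snd (st s)))) (snd (snd (snd (st s))))"
    by blast
  \<comment> \<open>A state is (point, known length, least admissible scale); \<open>Suc\<close>
    makes the scales strictly increase along a branch.\<close>
  define child where "child i s = (fst (snd (snd (st s))) i, snd (snd (snd (st s))), Suc (fst (st s)))" for i s
  \<comment> \<open>Words grow at the head: the first entry is the most recent choice.\<close>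
  define node where "node \<tau> = foldr child \<tau> (x0, 0, 0)" for \<tau>
  define X where "X \<tau> = fst (node \<tau>)" for \<tau>
  define len where "len \<tau> = fst (snd (node \<tau>))" for \<tau>
  define J where "J \<tau> = fst (st (node \<tau>))" for \<tau>
  define N where "N \<tau> = fst (snd (st (node \<tau>)))" for \<tau>
  have node_Cons: "node (i # \<tau>) = child i (node \<tau>)" for i \<tau> by (simp add: node_def)
  have XF': "X \<tau> \<in> F'" for \<tau>
  proof (induction \<tau>)
    case Nil then show ?case using x0 by (simp add: X_def node_def)
  next
    case (Cons i \<tau>)
    from st[of "node \<tau>"] Cons show ?case unfolding X_def node_Cons child_def tree_step_def by auto
  qed
  have ts: "tree_step F F' h \<gamma> (X \<tau>) (len \<tau>) (snd (snd (node \<tau>))) (J \<tau>) (N \<tau>) (\<lambda>i. X (i # \<tau>)) (len (i # \<tau>))" for \<tau> i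
    using st[of "node \<tau>"] XF'[of \<tau>] unfolding X_def len_def J_def N_def node_Cons child_def by simp
  have Xcyl: "X (i # \<tau>) \<in> cyl (X \<tau>) (len \<tau>)" for i \<tau> using ts[of \<tau> i] unfolding tree_step_def by auto
  have len_Cons: "len \<tau> < len (i # \<tau>)" for i \<tau> using ts[of \<tau> i] unfolding tree_step_def by auto
  have N1: "1 \<le> N \<tau>" "2 powr (real (J \<tau>) * \<gamma>) \<le> real (N \<tau>)" for \<tau> using ts[of \<tau>] unfolding tree_step_def by auto
  have sep: "dist (h (X (i # \<tau>))) (h (X (i' # \<tau>))) > (1/2)^(J \<tau> + 1)" if "i < N \<tau>" "i' < N \<tau>" "i \<noteq> i'" for i i' \<tau>
    using ts[of \<tau>] that unfolding tree_step_def by blast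
  have near: "h ` (F \<inter> cyl (X (i # \<tau>)) (len (i # \<tau>))) \<subseteq> cball (h (X (i # \<tau>))) ((1/2)^(J \<tau> + 4))" for i \<tau>
    using ts[of \<tau> i] unfolding tree_step_def by blast
  have J_Cons: "J \<tau> < J (i # \<tau>)" for i \<tau>
  proof -
    have "snd (snd (node (i # \<tau>))) = Suc (J \<tau>)" by (simp add: node_Cons child_def J_def)
    then show ?thesis using ts[of "i # \<tau>" 0] unfolding tree_step_def by simp
  qed
  define path where "path c k = ((\<lambda>p. c p # p) ^^ k) []" for c :: "nat list \<Rightarrow> nat" and k
  have path_0: "path c 0 = []" and path_Suc: "path c (Suc k) = c (path c k) # path c k" for c k
    by (simp_all add: path_def)
  have len_mono: "len (path c k) \<le> len (path c (k + m))" for c k m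
    by (induction m) (auto simp: path_Suc intro: order_trans less_imp_le[OF len_Cons])
  have len_ge: "k \<le> len (path c k)" for c k
  proof (induction k)
    case (Suc k) then show ?case using len_Cons[of "path c k" "c (path c k)"] by (simp add: path_Suc)
  qed simp
  have J_mono: "J (path c k) \<le> J (path c (k + m))" for c k m
    by (induction m) (auto simp: path_Suc intro: order_trans less_imp_le[OF J_Cons])
  have J_ge: "k \<le> J (path c k)" for c k
  proof (induction k)
    case (Suc k) then show ?case using J_Cons[of "path c k" "c (path c k)"] by (simp add: path_Suc)
  qed simp
  have stable: "X (path c (k + m)) \<in> cyl (X (path c k)) (len (path c k))" for c k m
  proof (induction m)
    case (Suc m)
    have "X (path c (k + Suc m)) \<in> cyl (X (path c (k + m))) (len (path c (k + m)))"
      using Xcyl by (simp add: path_Suc)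
    then show ?case using Suc len_mono[of c k m] by (auto simp: cyl_def)
  qed (simp add: cyl_self)
  \<comment> \<open>At level \<open>Suc m\<close> more than \<open>m\<close> coordinates are fixed,
    so coordinate \<open>m\<close> no longer changes.\<close>
  define z where "z c m = X (path c (Suc m)) m" for c m
  have zcyl: "z c \<in> cyl (X (path c k)) (len (path c k))" for c k
    unfolding cyl_def
  proof (intro CollectI allI impI)
    fix i assume i: "i < len (path c k)"
    show "z c i = X (path c k) i"
    proof (cases "k \<le> Suc i")
      case True
      then show ?thesis using stable[of c k "Suc i - k"] i by (simp add: z_def cyl_def)
    next
      case False
      have "i < len (path c (Suc i))" using len_ge[of "Suc i" c] by simp
      then show ?thesis using stable[of c "Suc i" "k - Suc i"] False by (simp add: z_def cyl_def)
    qed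
  qed
  \<comment> \<open>The nodes lie in \<open>F\<close> and agree with \<open>z c\<close> on ever
    longer initial segments, so closedness of \<open>F\<close> covers the limit.\<close>
  have zF: "z c \<in> F" for c
  proof (rule ccontr)
    assume "z c \<notin> F"
    then obtain n where n: "cyl (z c) n \<subseteq> - F" using open_contains_cyl[of "- F" "z c"] F by auto
    have "X (path c n) \<in> cyl (z c) n" using zcyl[of c n] len_ge[of n c] by (simp add: cyl_def)
    then show False using n XF'[of "path c n"] F'_def by auto
  qed
  define KK where "KK = {c. \<forall>\<tau>. c \<tau> < N \<tau>}"
  \<comment> \<open>At the first node where two choices part, the images are more than 2^-(J+3)
    apart for the scale J of that node, which is at most the scale at level \<open>k\<close>. Hence
    they cannot part up to level \<open>k\<close>.\<close>
  have same: "c (path c0 k) = c0 (path c0 k)"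
    if c: "c \<in> KK" "c0 \<in> KK" and d: "dist (h (z c)) (h (z c0)) \<le> (1/2)^(J (path c0 k) + 3)" for c c0 k
  proof -
    have stp: "c (path c0 m) = c0 (path c0 m)" if m: "m \<le> k" and eq: "path c m = path c0 m" for m
    proof (rule ccontr)
      assume ne: "c (path c0 m) \<noteq> c0 (path c0 m)"
      define p where "p = path c0 m"
      have p: "path c (Suc m) = c p # p" "path c0 (Suc m) = c0 p # p" using eq by (simp_all add: path_Suc p_def)
      have "dist (h (X (c p # p))) (h (X (c0 p # p))) > (1/2)^(J p + 1)"
        using c ne by (intro sep) (auto simp: KK_def p_def)
      moreover have "h (z c) \<in> cball (h (X (c p # p))) ((1/2)^(J p + 4))"
        using near[of "c p" p] zcyl[of c "Suc m"] zF[of c] unfolding p by blast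
      moreover have "h (z c0) \<in> cball (h (X (c0 p # p))) ((1/2)^(J p + 4))"
        using near[of "c0 p" p] zcyl[of c0 "Suc m"] zF[of c0] unfolding p by blast
      ultimately have "dist (h (z c)) (h (z c0)) > (1/2)^(J p + 1) - 2 * (1/2)^(J p + 4)"
        using dist_triangle[of "h (X (c p # p))" "h (X (c0 p # p))" "h (z c)"]
          dist_triangle[of "h (z c)" "h (X (c0 p # p))" "h (z c0)"]
        by (simp add: dist_commute)
      moreover have "(1/2::real)^(J (path c0 k) + 3) \<le> (1/2)^(J p + 3)"
        using J_mono[of c0 m "k - m"] m by (intro power_decreasing) (auto simp: p_def)
      moreover have "(1/2::real)^(J p + 3) \<le> (1/2)^(J p + 1) - 2 * (1/2)^(J p + 4)"
        by (simp add: power_add power3_eq_cube power4_eq_xxxx)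
      ultimately show False using d by linarith
    qed
    have "m \<le> Suc k \<Longrightarrow> path c m = path c0 m" for m
      by (induction m) (auto simp: path_0 path_Suc stp)
    then show ?thesis using stp[of k] by simp
  qed
  have open_path: "open {c. path c k = p}" for k p
  proof (induction k arbitrary: p)
    case 0 then show ?case by (cases "p = []") (auto simp: path_0)
  next
    case (Suc k)
    show ?case
    proof (cases p)
      case Nil then show ?thesis by (simp add: path_Suc)
    next
      case (Cons i q)
      have "{c. path c (Suc k) = p} = {c. path c k = q} \<inter> {c. c q = i}" by (auto simp: Cons path_Suc)
      then show ?thesis using Suc clopen_coordinate(1)[of q i] by auto
    qed
  qed
  have zcont: "continuous_on UNIV z"
  proof (rule continuous_on_locally_constant_coordinates)
    fix i m
    have "{c. z c i = m} = (\<Union>p\<in>{p. X p i = m}. {c. path c (Suc i) = p})" by (auto simp: z_def)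
    then show "open {c. z c i = m}" using open_path by auto
  qed
  define P where "P = Pi\<^sub>M UNIV (\<lambda>\<tau>. measure_pmf (pmf_of_set {..<N \<tau>}))"
  have ne: "{..<N \<tau>} \<noteq> {}" for \<tau> using N1[of \<tau>] by (auto simp: lessThan_empty_iff)
  interpret P: prob_space P unfolding P_def by (rule prob_space_PiM) (simp add: prob_space_measure_pmf)
  have setsP: "sets P = sets borel"
  proof -
    have "sets P = sets (Pi\<^sub>M UNIV (\<lambda>\<tau>::nat list. borel :: nat measure))"
      unfolding P_def by (rule sets_PiM_cong) (simp_all add: sets_borel_eq_count_space)
    then show ?thesis by (simp add: sets_PiM_equal_borel)
  qed
  have AEP: "AE c in P. c \<in> KK"
  proof -
    have "AE c in P. c \<tau> < N \<tau>" for \<tau>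
      unfolding P_def
      by (rule AE_PiM_component[where P="\<lambda>x. x < N \<tau>"])
         (auto simp: prob_space_measure_pmf AE_measure_pmf_iff set_pmf_of_set ne)
    then show ?thesis by (simp add: KK_def AE_all_countable)
  qed
  have mass: "emeasure P {c. c \<tau> = i} \<le> ennreal (2 powr - (real (J \<tau>) * \<gamma>))" for \<tau> i
  proof -
    have "emeasure P {c. c \<tau> = i} = emeasure (distr P (measure_pmf (pmf_of_set {..<N \<tau>})) (\<lambda>c. c \<tau>)) {i}"
      by (subst emeasure_distr) (auto simp: P_def space_PiM vimage_def)
    also have "\<dots> = emeasure (measure_pmf (pmf_of_set {..<N \<tau>})) {i}"
      unfolding P_def by (subst distr_PiM_component) (auto simp: prob_space_measure_pmf)
    also have "\<dots> \<le> ennreal (1 / real (N \<tau>))"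
      by (auto simp: emeasure_pmf_single ne indicator_def)
    also have "\<dots> \<le> ennreal (2 powr - (real (J \<tau>) * \<gamma>))"
    proof (rule ennreal_leI)
      have "1 / real (N \<tau>) \<le> 1 / 2 powr (real (J \<tau>) * \<gamma>)"
        using N1[of \<tau>] by (intro divide_left_mono) auto
      then show "1 / real (N \<tau>) \<le> 2 powr - (real (J \<tau>) * \<gamma>)" by (simp add: powr_minus_divide)
    qed
    finally show ?thesis .
  qed
  show thesis
  proof (rule that[of P KK z])
    show "prob_space P" by (rule P.prob_space_axioms)
    show "sets P = sets borel" by (rule setsP)
    show "compact KK" "closed KK" unfolding KK_def by (rule compact_sequence_box closed_sequence_box)+
    show "continuous_on UNIV z" by (rule zcont)
    show "z ` KK \<subseteq> F" using zF by auto
    show "AE c in P. c \<in> KK" by (rule AEP)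
    fix c0 k assume c0: "c0 \<in> KK"
    show "\<exists>n\<ge>k. emeasure P {c\<in>KK. dist (h (z c)) (h (z c0)) \<le> (1/2)^(n+3)} \<le> ennreal (2 powr - (real n * \<gamma>))"
    proof (intro exI[of _ "J (path c0 k)"] conjI J_ge)
      have "emeasure P {c\<in>KK. dist (h (z c)) (h (z c0)) \<le> (1/2)^(J (path c0 k)+3)}
          \<le> emeasure P {c. c (path c0 k) = c0 (path c0 k)}"
        by (rule emeasure_mono) (use same c0 clopen_coordinate(1) in \<open>auto simp: setsP\<close>)
      also note mass
      finally show "emeasure P {c\<in>KK. dist (h (z c)) (h (z c0)) \<le> (1/2)^(J (path c0 k)+3)}
        \<le> ennreal (2 powr - (real (J (path c0 k)) * \<gamma>))" .
    qed
  qed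
qed

text \<open>The push-forward of the tree measure under the parametrization. \<open>Z\<close> itself
  is only Borel, so compactness of \<open>K\<close> and of its image comes from continuity of
  \<open>a\<close> and of \<open>Z\<close> composed with \<open>a\<close> on the parameter
  side.\<close>

lemma packing_frostman:
  fixes Z :: "'a::euclidean_space \<Rightarrow> 'b::euclidean_space" and a :: "(nat \<Rightarrow> nat) \<Rightarrow> 'a"
  assumes F: "closed F" and a: "continuous_on F a" and Za: "continuous_on F (\<lambda>x. Z (a x))"
    and ns: "\<not> small \<gamma> (Z ` a ` F)" and Z: "Z \<in> borel_measurable borel"
  obtains \<mu> K where "prob_space \<mu>" "sets \<mu> = sets borel" "compact K" "K \<subseteq> a ` F"
    "emeasure \<mu> (space \<mu> - K) = 0" "bounded (Z ` K)"
    "\<And>t k. t \<in> K \<Longrightarrow> \<exists>n\<ge>k. emeasure \<mu> {s. dist (Z s) (Z t) \<le> (1/2)^(n+3)} \<le> ennreal (2 powr - (real n * \<gamma>))"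
proof -
  have "\<not> small \<gamma> ((\<lambda>x. Z (a x)) ` F)" using ns by (simp add: image_image)
  then obtain P :: "(nat list \<Rightarrow> nat) measure" and L z where
    P: "prob_space P" "sets P = sets borel" "compact L" "closed L" "continuous_on UNIV z" "z ` L \<subseteq> F"
    "AE c in P. c \<in> L" and mass:
    "\<And>c0 k. c0 \<in> L \<Longrightarrow> \<exists>n\<ge>k. emeasure P {c\<in>L. dist (Z (a (z c))) (Z (a (z c0))) \<le> (1/2)^(n+3)} \<le> ennreal (2 powr - (real n * \<gamma>))"
    by (rule tree_measure[OF F Za]) (rule that)
  interpret P: prob_space P by fact
  have zL: "continuous_on L z" using P(5) continuous_on_subset by blast
  have azL: "continuous_on L (\<lambda>c. a (z c))" by (rule continuous_on_compose2[OF a zL P(6)])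
  have hzL: "continuous_on L (\<lambda>c. Z (a (z c)))" by (rule continuous_on_compose2[OF Za zL P(6)])
  \<comment> \<open>The default 0 off \<open>L\<close> makes \<open>g\<close> Borel on the whole
    space; that part has measure 0 under \<open>P\<close>.\<close>
  define g where "g c = (if c \<in> L then a (z c) else 0)" for c
  have g: "g \<in> measurable P borel"
  proof -
    have "g \<in> borel_measurable borel"
      unfolding g_def by (rule borel_measurable_continuous_on_if) (auto simp: P(4) azL)
    then show ?thesis using P(2) measurable_cong_sets by blast
  qed
  define \<mu> where "\<mu> = distr P borel g"
  define K where "K = (\<lambda>c. a (z c)) ` L"
  have K: "compact K" unfolding K_def by (rule compact_continuous_image[OF azL P(3)])
  have Zset: "{s. dist (Z s) y \<le> r} \<in> sets borel" for y r
  proof -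
    have "{s \<in> space borel. dist (Z s) y \<le> r} \<in> sets borel" using Z by measurable
    then show ?thesis by simp
  qed
  show thesis
  proof (rule that[of \<mu> K])
    show "prob_space \<mu>" unfolding \<mu>_def by (rule P.prob_space_distr[OF g])
    show "sets \<mu> = sets borel" by (simp add: \<mu>_def)
    show "compact K" by fact
    show "K \<subseteq> a ` F" using P(6) by (auto simp: K_def)
    show "emeasure \<mu> (space \<mu> - K) = 0"
    proof -
      have "emeasure \<mu> (space \<mu> - K) = emeasure P (g -` (- K) \<inter> space P)"
        unfolding \<mu>_def using K by (subst emeasure_distr[OF g]) (auto simp: Compl_eq_Diff_UNIV compact_imp_closed)
      also have "\<dots> \<le> emeasure P {}"
      proof (rule emeasure_mono_AE)
        show "AE c in P. c \<in> g -` (- K) \<inter> space P \<longrightarrow> c \<in> {}"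
          using P(7) by eventually_elim (auto simp: g_def K_def)
      qed simp
      finally show ?thesis by simp
    qed
    have "compact (Z ` K)"
      unfolding K_def image_image by (rule compact_continuous_image[OF hzL P(3)])
    then show "bounded (Z ` K)" by (rule compact_imp_bounded)
    fix t k assume "t \<in> K"
    then obtain c0 where c0: "c0 \<in> L" "t = a (z c0)" by (auto simp: K_def)
    from mass[OF c0(1), of k] obtain n where n: "n \<ge> k"
      "emeasure P {c\<in>L. dist (Z (a (z c))) (Z (a (z c0))) \<le> (1/2)^(n+3)} \<le> ennreal (2 powr - (real n * \<gamma>))" by auto
    have "closed {c\<in>L. dist (Z (a (z c))) (Z t) \<le> (1/2)^(n+3)}"
      using continuous_closed_preimage[OF continuous_on_dist[OF hzL continuous_on_const] P(4) closed_atMost[of "(1/2)^(n+3)"], of "Z t"]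
      by (simp add: vimage_def Int_def)
    then have meas: "{c\<in>L. dist (Z (a (z c))) (Z t) \<le> (1/2)^(n+3)} \<in> sets P"
      by (simp add: P(2))
    have "emeasure \<mu> {s. dist (Z s) (Z t) \<le> (1/2)^(n+3)} = emeasure P (g -` {s. dist (Z s) (Z t) \<le> (1/2)^(n+3)} \<inter> space P)"
      unfolding \<mu>_def by (subst emeasure_distr[OF g Zset]) simp
    also have "\<dots> \<le> emeasure P {c\<in>L. dist (Z (a (z c))) (Z t) \<le> (1/2)^(n+3)}"
    proof (rule emeasure_mono_AE[OF _ meas])
      show "AE c in P. c \<in> g -` {s. dist (Z s) (Z t) \<le> (1/2)^(n+3)} \<inter> space P \<longrightarrow>
        c \<in> {c\<in>L. dist (Z (a (z c))) (Z t) \<le> (1/2)^(n+3)}"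
        using P(7) by eventually_elim (auto simp: g_def)
    qed
    also have "\<dots> \<le> ennreal (2 powr - (real n * \<gamma>))" using n(2) c0(2) by simp
    finally show "\<exists>n\<ge>k. emeasure \<mu> {s. dist (Z s) (Z t) \<le> (1/2)^(n+3)} \<le> ennreal (2 powr - (real n * \<gamma>))"
      using n(1) by blast
  qed
qed

section \<open>Dyadic cells and the product kernel\<close>

text \<open>Restricting to \<open>Basis\<close> makes equality of cells an equality of functions and
  puts the cells of a cube into a finite \<open>PiE\<close>.\<close>

definition cell :: "nat \<Rightarrow> 'b::euclidean_space \<Rightarrow> 'b \<Rightarrow> int" where
  "cell n y = (\<lambda>b\<in>Basis. \<lfloor>2^n * (y \<bullet> b)\<rfloor>)"

text \<open>A version of the product of min 1 (r / |y_i - z_i|) at r = 2^-n that depends only on the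
  cells of the two points, which turns integrals into finite sums. The 3 absorbs the
  rounding.\<close>

definition cell_kernel :: "('b::euclidean_space \<Rightarrow> int) \<Rightarrow> ('b \<Rightarrow> int) \<Rightarrow> real" where
  "cell_kernel i j = (\<Prod>b\<in>Basis. 3 / (1 + real_of_int \<bar>i b - j b\<bar>))"

abbreviation kern :: "nat \<Rightarrow> 'b::euclidean_space \<Rightarrow> 'b \<Rightarrow> real" where
  "kern n y z \<equiv> cell_kernel (cell n y) (cell n z)"

definition cell_box :: "nat \<Rightarrow> ('b::euclidean_space \<Rightarrow> int) set" where
  "cell_box m = PiE Basis (\<lambda>_. {- (2^m)..2^m})"

lemma cell_kernel_nonneg: "0 \<le> cell_kernel i j"
  unfolding cell_kernel_def by (intro prod_nonneg) simp

lemma kern_eq: "kern n y z = (\<Prod>b\<in>Basis. 3 / (1 + real_of_int \<bar>\<lfloor>2^n * (y \<bullet> b)\<rfloor> - \<lfloor>2^n * (z \<bullet> b)\<rfloor>\<bar>))"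
  by (simp add: cell_kernel_def cell_def)

lemma finite_cell_box: "finite (cell_box m)"
  unfolding cell_box_def by (intro finite_PiE) auto

lemma cell_in_cell_box:
  assumes "\<And>b. b \<in> Basis \<Longrightarrow> \<bar>y \<bullet> b\<bar> \<le> 2^a"
  shows "cell n y \<in> cell_box (a + n)"
proof -
  have "\<lfloor>2^n * (y \<bullet> b)\<rfloor> \<in> {- (2^(a+n))..2^(a+n)}" if "b \<in> Basis" for b
  proof -
    have "\<bar>2^n * (y \<bullet> b)\<bar> \<le> 2^n * 2^a"
      using assms[OF that] by (simp add: abs_mult)
    also have "\<dots> = real_of_int (2^(a+n))" by (simp add: power_add)
    finally have "\<bar>2^n * (y \<bullet> b)\<bar> \<le> real_of_int (2^(a+n))" .
    then have "- real_of_int (2^(a+n)) \<le> 2^n * (y \<bullet> b)" "2^n * (y \<bullet> b) \<le> real_of_int (2^(a+n))"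
      by linarith+
    then show ?thesis by (simp add: le_floor_iff floor_le_iff)
  qed
  then show ?thesis unfolding cell_def cell_box_def by auto
qed

lemma cell_eq_dist:
  fixes y z :: "'b::euclidean_space"
  assumes "cell n y = cell n z"
  shows "dist y z \<le> real DIM('b) * (1/2)^n"
proof -
  have "\<bar>(y - z) \<bullet> b\<bar> \<le> (1/2)^n" if "b \<in> Basis" for b
  proof -
    have "\<lfloor>2^n * (y \<bullet> b)\<rfloor> = \<lfloor>2^n * (z \<bullet> b)\<rfloor>" using fun_cong[OF assms, of b] that by (simp add: cell_def)
    then have "\<bar>2^n * (y \<bullet> b) - 2^n * (z \<bullet> b)\<bar> \<le> 1" by linarith
    then have "2^n * \<bar>(y - z) \<bullet> b\<bar> \<le> 1" by (simp add: inner_diff_left abs_mult flip: right_diff_distrib)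
    then show ?thesis by (simp add: power_one_over field_simps)
  qed
  then have "(\<Sum>b\<in>Basis. \<bar>(y - z) \<bullet> b\<bar>) \<le> (\<Sum>b\<in>(Basis::'b set). (1/2)^n)" by (rule sum_mono)
  then show ?thesis using norm_le_l1[of "y - z"] by (simp add: dist_norm)
qed

lemma cell_vimage_measurable:
  fixes i :: "'b::euclidean_space \<Rightarrow> int"
  shows "{y. cell n y = i} \<in> sets borel"
proof (cases "i \<in> extensional Basis")
  case True
  then have "{y. cell n y = i} = {y\<in>space borel. \<forall>b\<in>Basis. \<lfloor>2^n * (y \<bullet> b)\<rfloor> = i b}"
    by (auto simp: cell_def fun_eq_iff restrict_def extensional_def)
  also have "\<dots> \<in> sets borel" by measurable
  finally show ?thesis .
next
  case False
  then have "{y. cell n y = i} = {}" by (auto simp: cell_def)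
  then show ?thesis by simp
qed

text \<open>Rounding changes the distance, in units of 2^-n, by at most 1, so \<open>p\<close> times
  the denominator is at most 2p + 1 \<le> 3. This is how a small-ball probability enters the
  kernel.\<close>

lemma kern_factor:
  fixes u v p :: real
  assumes "0 \<le> p" "p \<le> 1" "p * \<bar>u - v\<bar> \<le> (1/2)^n"
  shows "p \<le> 3 / (1 + real_of_int \<bar>\<lfloor>2^n * u\<rfloor> - \<lfloor>2^n * v\<rfloor>\<bar>)"
proof -
  have "real_of_int \<bar>\<lfloor>2^n * u\<rfloor> - \<lfloor>2^n * v\<rfloor>\<bar> \<le> \<bar>2^n * u - 2^n * v\<bar> + 1" by linarith
  also have "\<bar>2^n * u - 2^n * v\<bar> = 2^n * \<bar>u - v\<bar>" by (simp add: abs_mult flip: right_diff_distrib)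
  finally have *: "real_of_int \<bar>\<lfloor>2^n * u\<rfloor> - \<lfloor>2^n * v\<rfloor>\<bar> \<le> 2^n * \<bar>u - v\<bar> + 1" .
  have "p * (1 + real_of_int \<bar>\<lfloor>2^n * u\<rfloor> - \<lfloor>2^n * v\<rfloor>\<bar>) \<le> p * (2 + 2^n * \<bar>u - v\<bar>)"
    using * assms(1) by (intro mult_left_mono) auto
  also have "\<dots> = 2 * p + 2^n * (p * \<bar>u - v\<bar>)" by (simp add: algebra_simps)
  also have "\<dots> \<le> 2 * 1 + 2^n * (1/2)^n"
    using assms by (intro add_mono mult_left_mono) auto
  also have "\<dots> = 3" by (simp add: power_one_over)
  finally show ?thesis by (subst pos_le_divide_eq) auto
qed

section \<open>Column sums of the kernel and summability\<close>

lemma sum_inverse_dyadic: "(\<Sum>j<2^p. 1 / (1 + real j)) \<le> real p + 1"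
proof (induction p)
  case (Suc p)
  have "(\<Sum>j<2^Suc p. 1 / (1 + real j)) = (\<Sum>j<2^p. 1 / (1 + real j)) + (\<Sum>j\<in>{2^p..<2^Suc p}. 1 / (1 + real j))"
    by (subst sum.union_disjoint[symmetric]) (auto intro!: sum.cong)
  also have "(\<Sum>j\<in>{2^p..<2^Suc p}. 1 / (1 + real j)) \<le> (\<Sum>j\<in>{2^p..<2^Suc p::nat}. 1 / 2^p)"
  proof (intro sum_mono divide_left_mono)
    fix j :: nat assume "j \<in> {2^p..<2^Suc p}"
    then have "real (2^p) \<le> real j" by (intro of_nat_mono) auto
    then have "2^p \<le> real j" by (simp only: of_nat_power of_nat_numeral)
    then show "2^p \<le> 1 + real j" by linarith
  qed auto
  also have "\<dots> = 1" by simp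
  finally show ?case using Suc by simp
qed simp

text \<open>Split at \<open>m'\<close>: each side is dominated by a harmonic sum of 2^(q+2) terms,
  because differences in the box are at most 2 * 2^q.\<close>

lemma sum_kernel_factor:
  assumes "m' \<in> {- (2^q)..2^q}"
  shows "(\<Sum>m\<in>{- (2^q)..2^q}. 3 / (1 + real_of_int \<bar>m - m'\<bar>)) \<le> 6 * (real q + 3)"
proof -
  have "(\<Sum>m\<in>{- (2^q)..2^q}. 3 / (1 + real_of_int \<bar>m - m'\<bar>))
      \<le> (\<Sum>m\<in>{m'..2^q}. 3 / (1 + real_of_int \<bar>m - m'\<bar>)) + (\<Sum>m\<in>{- (2^q)..m'}. 3 / (1 + real_of_int \<bar>m - m'\<bar>))"
  proof -
    have "(\<Sum>m\<in>{- (2^q)..2^q}. 3 / (1 + real_of_int \<bar>m - m'\<bar>)) =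
       (\<Sum>m\<in>{m'..2^q} \<union> {- (2^q)..m'}. 3 / (1 + real_of_int \<bar>m - m'\<bar>))"
      using assms by (intro sum.cong) auto
    also have "\<dots> \<le> (\<Sum>m\<in>{m'..2^q}. 3 / (1 + real_of_int \<bar>m - m'\<bar>)) + (\<Sum>m\<in>{- (2^q)..m'}. 3 / (1 + real_of_int \<bar>m - m'\<bar>))"
      by (subst sum_Un) (auto intro!: sum_nonneg)
    finally show ?thesis .
  qed
  also have "(\<Sum>m\<in>{m'..2^q}. 3 / (1 + real_of_int \<bar>m - m'\<bar>)) \<le> (\<Sum>j<2^(q+2). 3 / (1 + real j))"
  proof -
    have "(\<Sum>m\<in>{m'..2^q}. 3 / (1 + real_of_int \<bar>m - m'\<bar>)) = (\<Sum>j\<in>(\<lambda>m. nat (m - m')) ` {m'..2^q}. 3 / (1 + real j))"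
      by (subst sum.reindex) (auto simp: inj_on_def intro!: sum.cong)
    also have "\<dots> \<le> (\<Sum>j<2^(q+2). 3 / (1 + real j))"
    proof (intro sum_mono2)
      show "(\<lambda>m. nat (m - m')) ` {m'..2^q} \<subseteq> {..<2^(q+2)}"
      proof (intro image_subsetI)
        fix m assume m: "m \<in> {m'..2^q}"
        have "(2::int) ^ (q + 2) = 4 * 2 ^ q" "(0::int) < 2 ^ q" by simp_all
        moreover have "m - m' \<le> 2 * 2 ^ q" "0 \<le> m - m'" using m assms by auto
        ultimately have "m - m' < 2 ^ (q + 2)" "0 \<le> m - m'" by linarith+
        then show "nat (m - m') \<in> {..<2^(q+2)}" by (simp add: nat_less_iff)
      qed
    qed auto
    finally show ?thesis .
  qed
  also have "(\<Sum>m\<in>{- (2^q)..m'}. 3 / (1 + real_of_int \<bar>m - m'\<bar>)) \<le> (\<Sum>j<2^(q+2). 3 / (1 + real j))"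
  proof -
    have "(\<Sum>m\<in>{- (2^q)..m'}. 3 / (1 + real_of_int \<bar>m - m'\<bar>)) = (\<Sum>j\<in>(\<lambda>m. nat (m' - m)) ` {- (2^q)..m'}. 3 / (1 + real j))"
      by (subst sum.reindex) (auto simp: inj_on_def intro!: sum.cong)
    also have "\<dots> \<le> (\<Sum>j<2^(q+2). 3 / (1 + real j))"
    proof (intro sum_mono2)
      show "(\<lambda>m. nat (m' - m)) ` {- (2^q)..m'} \<subseteq> {..<2^(q+2)}"
      proof (intro image_subsetI)
        fix m assume m: "m \<in> {- (2^q)..m'}"
        have "(2::int) ^ (q + 2) = 4 * 2 ^ q" "(0::int) < 2 ^ q" by simp_all
        moreover have "m' - m \<le> 2 * 2 ^ q" "0 \<le> m' - m" using m assms by auto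
        ultimately have "m' - m < 2 ^ (q + 2)" "0 \<le> m' - m" by linarith+
        then show "nat (m' - m) \<in> {..<2^(q+2)}" by (simp add: nat_less_iff)
      qed
    qed auto
    finally show ?thesis .
  qed
  also have "(\<Sum>j<2^(q+2). 3 / (1 + real j)) = 3 * (\<Sum>j<2^(q+2). 1 / (1 + real j))"
    by (simp add: sum_distrib_left)
  also have "\<dots> \<le> 3 * (real (q + 2) + 1)"
    by (intro mult_left_mono sum_inverse_dyadic) simp
  finally show ?thesis by simp
qed

lemma sum_cell_kernel:
  fixes j :: "'b::euclidean_space \<Rightarrow> int"
  assumes "j \<in> cell_box q"
  shows "(\<Sum>i\<in>cell_box q. cell_kernel i j) \<le> (6 * (real q + 3)) ^ DIM('b)"
proof -
  have "(\<Sum>i\<in>cell_box q. cell_kernel i j) = (\<Prod>b\<in>Basis. \<Sum>m\<in>{- (2^q)..2^q}. 3 / (1 + real_of_int \<bar>m - j b\<bar>))"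
    unfolding cell_box_def cell_kernel_def by (subst prod_sum_PiE) auto
  also have "\<dots> \<le> (\<Prod>b\<in>(Basis::'b set). 6 * (real q + 3))"
    using assms by (intro prod_mono conjI sum_nonneg sum_kernel_factor) (auto simp: cell_box_def)
  finally show ?thesis by simp
qed

lemma power_le_fact_exp:
  fixes x :: real
  assumes "0 \<le> x"
  shows "x ^ d \<le> fact d * exp x"
proof -
  have "sum (\<lambda>n. x ^ n /\<^sub>R fact n) {d} \<le> (\<Sum>n. x ^ n /\<^sub>R fact n)"
    using assms by (intro sum_le_suminf summable_exp_generic) auto
  then have "x ^ d / fact d \<le> exp x" by (simp add: exp_def divide_inverse mult.commute)
  then show ?thesis by (simp add: pos_divide_le_eq mult.commute)
qed

text \<open>Half of the exponential decay absorbs the polynomial: \<eta> is chosen so that exp (6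
  \<eta> (a + n)) = 2^((a + n) \<epsilon> / 2). The other half remains as the geometric ratio
  \<open>q\<close>.\<close>

lemma summable_polynomial_times_exponential:
  fixes \<epsilon> a :: real
  assumes "\<epsilon> > 0" "a \<ge> 0"
  shows "summable (\<lambda>n. 2 powr - (real n * \<epsilon>) * (6 * (a + real n)) ^ d)"
proof (rule summable_comparison_test')
  define \<eta> where "\<eta> = \<epsilon> * ln 2 / 12"
  have \<eta>: "\<eta> > 0" using assms by (simp add: \<eta>_def)
  define C where "C = fact d / \<eta> ^ d * 2 powr (a * \<epsilon> / 2)"
  define q where "q = 2 powr - (\<epsilon> / 2)"
  have q: "0 < q" "q < 1" using powr_less_mono[of "- (\<epsilon>/2)" 0 2] assms by (auto simp: q_def)
  show "summable (\<lambda>n. C * q ^ n)" using q by (intro summable_mult summable_geometric) auto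
  fix n :: nat assume "0 \<le> n"
  define y where "y = \<eta> * (6 * (a + real n))"
  have "(6 * (a + real n)) ^ d = y ^ d / \<eta> ^ d" using \<eta> by (simp add: y_def power_mult_distrib)
  also have "\<dots> \<le> fact d * exp y / \<eta> ^ d"
    using \<eta> assms by (intro divide_right_mono power_le_fact_exp) (auto simp: y_def)
  also have "exp y = 2 powr (a * \<epsilon> / 2) * 2 powr (real n * (\<epsilon> / 2))"
    by (simp add: powr_def y_def \<eta>_def algebra_simps flip: exp_add)
  finally have 1: "(6 * (a + real n)) ^ d \<le> C * 2 powr (real n * (\<epsilon> / 2))" by (simp add: C_def)
  have "2 powr - (real n * \<epsilon>) * (6 * (a + real n)) ^ d \<le> 2 powr - (real n * \<epsilon>) * (C * 2 powr (real n * (\<epsilon> / 2)))"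
    using 1 by (intro mult_left_mono) auto
  also have "\<dots> = C * (2 powr - (real n * \<epsilon>) * 2 powr (real n * (\<epsilon> / 2)))" by simp
  also have "2 powr - (real n * \<epsilon>) * 2 powr (real n * (\<epsilon> / 2)) = q ^ n"
    by (simp add: q_def powr_powr flip: powr_realpow powr_add)
  finally show "norm (2 powr - (real n * \<epsilon>) * (6 * (a + real n)) ^ d) \<le> C * q ^ n"
    using assms by (simp add: abs_mult)
qed

text \<open>The weighted mass \<open>\<integral> kern n y z d\<nu>(z)\<close> exceeds \<open>2\<^bsup>n\<epsilon>\<^esup>\<close> times the mass of the cell of \<open>y\<close> only on
  cells whose total mass is at most \<open>2\<^bsup>-n\<epsilon>\<^esup>\<close> times a power of \<open>n\<close>, because the kernel has column
  sums of that order; then the Borel-Cantelli lemma applies.\<close>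

lemma AE_kernel_le_cell_mass:
  fixes \<nu> :: "'b::euclidean_space measure"
  assumes "prob_space \<nu>" and sets: "sets \<nu> = sets borel"
    and bd: "AE y in \<nu>. \<forall>b\<in>Basis. \<bar>y \<bullet> b\<bar> \<le> 2^a" and \<epsilon>: "\<epsilon> > 0"
  shows "AE y in \<nu>. \<forall>\<^sub>F n in sequentially. (\<integral>\<^sup>+z. ennreal (kern n y z) \<partial>\<nu>)
           \<le> ennreal (2 powr (real n * \<epsilon>)) * emeasure \<nu> {z. cell n z = cell n y}"
proof -
  interpret prob_space \<nu> by fact
  define I :: "nat \<Rightarrow> ('b \<Rightarrow> int) set" where "I n = cell_box (a + n)" for n
  define w where "w n i = measure \<nu> {z. cell n z = i}" for n i
  have fin: "finite (I n)" for n unfolding I_def by (rule finite_cell_box)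
  have ms[measurable]: "{z. cell n z = i} \<in> sets \<nu>" for n i by (simp add: sets cell_vimage_measurable)
  have AEI: "AE z in \<nu>. cell n z \<in> I n" for n
    using bd by eventually_elim (auto simp: I_def intro!: cell_in_cell_box)
  have w0: "w n i \<ge> 0" for n i by (simp add: w_def)
  have em: "emeasure \<nu> {z. cell n z = i} = ennreal (w n i)" for n i
    by (simp add: w_def emeasure_eq_measure)
  have meas_UN: "measure \<nu> {z. cell n z \<in> J} = (\<Sum>i\<in>J. w n i)" if "finite J" for n J
  proof -
    have "{z. cell n z \<in> J} = (\<Union>i\<in>J. {z. cell n z = i})" by auto
    then show ?thesis unfolding w_def
      using that by (simp only:) (subst finite_measure_finite_Union, auto simp: disjoint_family_on_def)
  qed
  have wsum: "(\<Sum>i\<in>I n. w n i) \<le> 1" for n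
    using meas_UN[OF fin, of n] prob_le_1 by metis
  \<comment> \<open>The kernel is constant on cells, so its integral is a sum over the finitely many
    cells that carry \<nu>.\<close>
  have kint: "(\<integral>\<^sup>+z. ennreal (kern n y z) \<partial>\<nu>) = ennreal (\<Sum>j\<in>I n. cell_kernel (cell n y) j * w n j)" for n y
  proof -
    have "(\<integral>\<^sup>+z. ennreal (kern n y z) \<partial>\<nu>) =
        (\<integral>\<^sup>+z. (\<Sum>j\<in>I n. ennreal (cell_kernel (cell n y) j) * indicator {z. cell n z = j} z) \<partial>\<nu>)"
      using AEI[of n]
    proof (intro nn_integral_cong_AE, eventually_elim)
      case (elim z)
      have "(\<Sum>j\<in>I n. ennreal (cell_kernel (cell n y) j) * indicator {z. cell n z = j} z)
        = (\<Sum>j\<in>I n. if j = cell n z then ennreal (cell_kernel (cell n y) j) else 0)"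
        by (intro sum.cong) (auto simp: indicator_def)
      also have "\<dots> = ennreal (kern n y z)" using elim fin by simp
      finally show ?case by simp
    qed
    also have "\<dots> = (\<Sum>j\<in>I n. ennreal (cell_kernel (cell n y) j) * emeasure \<nu> {z. cell n z = j})"
      by (subst nn_integral_sum) (auto intro!: sum.cong nn_integral_cmult_indicator)
    also have "\<dots> = ennreal (\<Sum>j\<in>I n. cell_kernel (cell n y) j * w n j)"
      by (simp add: em w0 cell_kernel_nonneg ennreal_mult sum_ennreal[symmetric])
    finally show ?thesis .
  qed
  define bad where "bad n = {i\<in>I n. 2 powr (real n * \<epsilon>) * w n i < (\<Sum>j\<in>I n. cell_kernel i j * w n j)}" for n
  have fb: "finite (bad n)" for n using fin[of n] by (simp add: bad_def)
  have mbad: "{z. cell n z \<in> bad n} \<in> sets \<nu>" for n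
  proof -
    have "{z. cell n z \<in> bad n} = (\<Union>i\<in>bad n. {z. cell n z = i})" by auto
    then show ?thesis using fb by auto
  qed
  \<comment> \<open>Summing the defining inequality of \<open>bad\<close> and exchanging the two
    sums leaves column sums of the kernel against a total mass of at most 1.\<close>
  have bad_le: "measure \<nu> {z. cell n z \<in> bad n} \<le> 2 powr - (real n * \<epsilon>) * (6 * (real (a + 3) + real n)) ^ DIM('b)" for n
  proof -
    have "2 powr (real n * \<epsilon>) * (\<Sum>i\<in>bad n. w n i) = (\<Sum>i\<in>bad n. 2 powr (real n * \<epsilon>) * w n i)"
      by (simp add: sum_distrib_left)
    also have "\<dots> \<le> (\<Sum>i\<in>bad n. \<Sum>j\<in>I n. cell_kernel i j * w n j)"
      by (intro sum_mono) (auto simp: bad_def)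
    also have "\<dots> \<le> (\<Sum>i\<in>I n. \<Sum>j\<in>I n. cell_kernel i j * w n j)"
      using fin by (intro sum_mono2 sum_nonneg mult_nonneg_nonneg cell_kernel_nonneg w0) (auto simp: bad_def)
    also have "\<dots> = (\<Sum>j\<in>I n. (\<Sum>i\<in>I n. cell_kernel i j) * w n j)"
      by (subst sum.swap) (simp add: sum_distrib_right)
    also have "\<dots> \<le> (\<Sum>j\<in>I n. (6 * (real (a + n) + 3)) ^ DIM('b) * w n j)"
      unfolding I_def by (intro sum_mono mult_right_mono sum_cell_kernel w0)
    also have "\<dots> = (6 * (real (a + n) + 3)) ^ DIM('b) * (\<Sum>j\<in>I n. w n j)" by (simp add: sum_distrib_left)
    also have "\<dots> \<le> (6 * (real (a + n) + 3)) ^ DIM('b)"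
      using wsum by (intro mult_left_le) auto
    finally have "2 powr (real n * \<epsilon>) * (\<Sum>i\<in>bad n. w n i) \<le> (6 * (real (a + 3) + real n)) ^ DIM('b)"
      by (simp add: algebra_simps)
    then have "(\<Sum>i\<in>bad n. w n i) \<le> (6 * (real (a + 3) + real n)) ^ DIM('b) / 2 powr (real n * \<epsilon>)"
      by (subst pos_le_divide_eq) (auto simp: mult.commute)
    then show ?thesis unfolding meas_UN[OF fb] by (simp add: powr_minus_divide)
  qed
  have "summable (\<lambda>n. measure \<nu> {z. cell n z \<in> bad n})"
    by (rule summable_comparison_test'[OF summable_polynomial_times_exponential[OF \<epsilon>, of "real (a + 3)" "DIM('b)"]])
       (use bad_le in auto)
  then have "AE y in \<nu>. \<forall>\<^sub>F n in sequentially. y \<in> space \<nu> - {z. cell n z \<in> bad n}"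
    using mbad by (intro borel_cantelli_AE1) (auto simp: emeasure_eq_measure)
  moreover have "AE y in \<nu>. \<forall>n. cell n y \<in> I n" using AEI by (simp add: AE_all_countable)
  ultimately show ?thesis
  proof eventually_elim
    case (elim y)
    from elim(1) show ?case
    proof eventually_elim
      case (elim n)
      then have "cell n y \<notin> bad n" by auto
      then have "(\<Sum>j\<in>I n. cell_kernel (cell n y) j * w n j) \<le> 2 powr (real n * \<epsilon>) * w n (cell n y)"
        using \<open>\<forall>n. cell n y \<in> I n\<close> by (auto simp: bad_def not_less)
      then show ?case unfolding kint em by (simp add: ennreal_mult[symmetric] w0 ennreal_leI)
    qed
  qed
qed

section \<open>The lower bound\<close>

lemma Liminf_zeroD:
  fixes X :: "'i \<Rightarrow> ennreal"
  assumes "Liminf F X = 0" "c > 0"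
  shows "\<exists>\<^sub>F x in F. X x < c"
proof (rule ccontr)
  assume "\<not> (\<exists>\<^sub>F x in F. X x < c)"
  then have "\<forall>\<^sub>F x in F. c \<le> X x" by (simp add: not_frequently not_less)
  then have "c \<le> Liminf F X" by (rule Liminf_bounded)
  then show False using assms by simp
qed

lemma liminf_zeroI:
  fixes X :: "nat \<Rightarrow> ennreal"
  assumes "\<And>c k. c > 0 \<Longrightarrow> \<exists>n\<ge>k. X n \<le> ennreal c"
  shows "liminf X = 0"
proof (rule ccontr)
  assume "liminf X \<noteq> 0"
  then have "0 < liminf X" by (simp add: zero_less_iff_neq_zero)
  then obtain c where c: "0 < c" "ennreal c < liminf X"
    by (metis dense ennreal_cases ennreal_less_zero_iff less_top_ennreal not_less_iff_gr_or_eq order_less_imp_triv top.not_eq_extremum)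
  from less_LiminfD[OF c(2)] obtain k where "\<And>n. n \<ge> k \<Longrightarrow> ennreal c < X n"
    by (auto simp: eventually_sequentially)
  moreover obtain n where "n \<ge> k" "X n \<le> ennreal c" using assms[OF c(1)] by blast
  ultimately show False by (meson not_less)
qed

text \<open>The dyadic radii tend to 0 from the right, so the lower limit over all radii is at most
  the one along them.\<close>

lemma Liminf_at_right_zeroI:
  fixes X :: "real \<Rightarrow> ennreal"
  assumes "\<And>c k. c > 0 \<Longrightarrow> \<exists>n\<ge>k. X ((1/2)^n) \<le> ennreal c"
  shows "Liminf (at_right 0) X = 0"
proof -
  have "filterlim (\<lambda>n. (1/2::real)^n) (at_right 0) sequentially"
    by (auto simp: filterlim_at intro!: LIMSEQ_power_zero)
  then have "Liminf (at_right 0) X \<le> liminf (\<lambda>n. X ((1/2)^n))"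
    unfolding Liminf_def filterlim_def
    by (intro SUP_least) (auto simp: le_filter_def eventually_filtermap intro!: SUP_upper2 INF_greatest INF_lower)
  also have "\<dots> = 0" by (rule liminf_zeroI[OF assms])
  finally show ?thesis by simp
qed

section \<open>Criteria for infinite packing measure\<close>

lemma packing_measure_mono: "E \<subseteq> F \<Longrightarrow> packing_measure s E \<le> packing_measure s F"
  unfolding packing_measure_def by (intro INF_superset_mono) auto

lemma packing_measure_eq_top:
  assumes "\<And>C :: nat \<Rightarrow> 'a::metric_space set. E \<subseteq> (\<Union>i. C i) \<Longrightarrow> \<exists>i. packing_premeasure s (C i) = \<infinity>"
  shows "packing_measure s E = \<infinity>"
  unfolding packing_measure_def
proof (rule INF_eqI)
  fix C :: "nat \<Rightarrow> 'a set" assume "C \<in> {C. E \<subseteq> (\<Union>i. C i)}"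
  then obtain i where i: "packing_premeasure s (C i) = \<infinity>" using assms by auto
  have "(\<Sum>j\<in>{i}. packing_premeasure s (C j)) \<le> (\<Sum>j. packing_premeasure s (C j))"
    by (intro sum_le_suminf) auto
  then show "\<infinity> \<le> (\<Sum>j. packing_premeasure s (C j))" using i by simp
next
  fix y :: ennreal
  assume *: "\<And>C :: nat \<Rightarrow> 'a set. C \<in> {C. E \<subseteq> (\<Union>i. C i)} \<Longrightarrow> y \<le> (\<Sum>j. packing_premeasure s (C j))"
  show "y \<le> \<infinity>" by simp
qed

lemma packing_premeasure_eq_top:
  assumes "\<And>\<delta>. \<delta> > 0 \<Longrightarrow> packing_premeasure_delta s \<delta> E = \<infinity>"
  shows "packing_premeasure s E = \<infinity>"
  unfolding packing_premeasure_def using assms by (intro INF_eqI) auto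

text \<open>For a negative exponent a single tiny ball has arbitrarily large weight. This settles
  the negative values of \<gamma> that the supremum in \<open>dimPZ_measure\<close> admits.\<close>

lemma packing_measure_negative_exponent:
  assumes "E \<noteq> {}" "s < 0"
  shows "packing_measure s E = \<infinity>"
proof (rule packing_measure_eq_top)
  fix C :: "nat \<Rightarrow> 'a set" assume C: "E \<subseteq> (\<Union>i. C i)"
  then obtain x i where x: "x \<in> C i" using assms(1) by blast
  have "packing_premeasure s (C i) = \<infinity>"
  proof (rule packing_premeasure_eq_top)
    fix \<delta> :: real assume \<delta>: "\<delta> > 0"
    have "ennreal (real n) \<le> packing_premeasure_delta s \<delta> (C i)" for n
    proof -
      define B where "B = real n + 1"
      define r where "r = min \<delta> (B powr (1 / s) / 2)"
      have B: "B > 0" by (simp add: B_def)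
      have r: "0 < r" "r \<le> \<delta>" "2 * r \<le> B powr (1 / s)" using \<delta> B by (auto simp: r_def)
      have "B = (B powr (1 / s)) powr s" using B assms(2) by (simp add: powr_powr)
      also have "\<dots> \<le> (2 * r) powr s" using r assms(2) by (intro powr_mono2') auto
      finally have "ennreal (real n) \<le> ennreal ((2 * r) powr s)" by (intro ennreal_leI) (simp add: B_def)
      also have "\<dots> = (\<Sum>p\<in>{(x, r)}. ennreal ((2 * snd p) powr s))" by simp
      also have "\<dots> \<le> packing_premeasure_delta s \<delta> (C i)"
        unfolding packing_premeasure_delta_def by (rule SUP_upper) (use x r in auto)
      finally show ?thesis .
    qed
    then have "(SUP n. ennreal (real n)) \<le> packing_premeasure_delta s \<delta> (C i)" by (intro SUP_least) auto
    then show "packing_premeasure_delta s \<delta> (C i) = \<infinity>"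
      by (simp add: ennreal_SUP_of_nat_eq_top[unfolded ennreal_of_nat_eq_real_of_nat] top_unique)
  qed
  then show "\<exists>i. packing_premeasure s (C i) = \<infinity>" by blast
qed

text \<open>A mass distribution argument for packings. The sets of a cover are arbitrary, so outer
  measure is used: some preimage \<open>D i\<close> has positive outer measure \<open>m\<close>. For
  any \<open>c\<close>, balls at scales where the density condition holds have a disjoint subfamily
  whose enlargements cover the image of \<open>D i\<close>; this bounds \<open>m\<close> by a
  multiple of \<open>c\<close> times the premeasure, and \<open>c\<close> may be arbitrarily
  small.\<close>

lemma packing_measure_infinite_of_density:
  fixes Z :: "'a \<Rightarrow> 'b::euclidean_space"
  assumes T: "T \<in> sets \<mu>" "emeasure \<mu> T > 0" and \<gamma>: "\<gamma> \<ge> 0"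
    and meas: "\<And>y r. {s\<in>space \<mu>. dist (Z s) y \<le> r} \<in> sets \<mu>"
    and dens: "\<And>t c k. t \<in> T \<Longrightarrow> c > 0 \<Longrightarrow>
      \<exists>n\<ge>k. emeasure \<mu> {s\<in>space \<mu>. dist (Z s) (Z t) \<le> (1/2)^n} \<le> ennreal (c * 2 powr - (real n * \<gamma>))"
  shows "packing_measure \<gamma> (Z ` T) = \<infinity>"
proof (rule packing_measure_eq_top)
  fix C :: "nat \<Rightarrow> 'b set" assume C: "Z ` T \<subseteq> (\<Union>i. C i)"
  define D where "D i = T \<inter> Z -` C i" for i
  have DT: "D i \<subseteq> T" for i by (auto simp: D_def)
  have Tsp: "T \<subseteq> space \<mu>" using T(1) by (rule sets.sets_into_space)
  \<comment> \<open>If all preimages had outer measure 0, their measurable hulls would cover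
    \<open>T\<close> by countably many null sets.\<close>
  have "\<exists>i. outer_measure_of \<mu> (D i) > 0"
  proof (rule ccontr)
    assume "\<not> (\<exists>i. outer_measure_of \<mu> (D i) > 0)"
    then have "\<And>i. outer_measure_of \<mu> (D i) = 0" by (simp add: zero_less_iff_neq_zero)
    then have "\<forall>i. \<exists>E\<in>sets \<mu>. D i \<subseteq> E \<and> emeasure \<mu> E = 0"
      using outer_measure_of_attain[OF order_trans[OF DT Tsp]] by metis
    then obtain E where E: "\<And>i. E i \<in> sets \<mu>" "\<And>i. D i \<subseteq> E i" "\<And>i. emeasure \<mu> (E i) = 0" by metis
    have "T \<subseteq> (\<Union>i. E i)" using C E(2) unfolding D_def by blast
    then have "emeasure \<mu> T \<le> emeasure \<mu> (\<Union>i. E i)" using E(1) by (intro emeasure_mono) auto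
    also have "\<dots> = 0" using E by (intro emeasure_UN_eq_0) auto
    finally show False using T(2) by simp
  qed
  then obtain i where i: "outer_measure_of \<mu> (D i) > 0" by blast
  define m where "m = outer_measure_of \<mu> (D i)"
  have "packing_premeasure \<gamma> (C i) = \<infinity>"
  proof (rule packing_premeasure_eq_top)
    fix \<delta> :: real assume \<delta>: "\<delta> > 0"
    let ?W = "packing_premeasure_delta \<gamma> \<delta> (C i)"
    have bound: "m \<le> ennreal (c * (5/2) powr \<gamma>) * ?W" if c: "c > 0" for c
    proof -
      obtain k where k: "(1/2)^k < \<delta>" using real_arch_pow_inv[of \<delta> "1/2"] \<delta> by auto
      have "\<forall>t\<in>D i. \<exists>n. n \<ge> k \<and>
          emeasure \<mu> {s\<in>space \<mu>. dist (Z s) (Z t) \<le> (1/2)^n} \<le> ennreal (c * 2 powr - (real n * \<gamma>))"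
      proof
        fix t assume "t \<in> D i"
        then have "t \<in> T" using DT by blast
        from dens[OF this c, of k] show "\<exists>n. n \<ge> k \<and>
          emeasure \<mu> {s\<in>space \<mu>. dist (Z s) (Z t) \<le> (1/2)^n} \<le> ennreal (c * 2 powr - (real n * \<gamma>))" .
      qed
      from bchoice[OF this] obtain n where n: "\<And>t. t \<in> D i \<Longrightarrow> n t \<ge> k" "\<And>t. t \<in> D i \<Longrightarrow>
          emeasure \<mu> {s\<in>space \<mu>. dist (Z s) (Z t) \<le> (1/2)^(n t)} \<le> ennreal (c * 2 powr - (real (n t) * \<gamma>))"
        by blast
      \<comment> \<open>A fifth of the scale, so that the enlarged balls of the covering lemma are
        those whose preimages \<open>Q t\<close> have controlled mass.\<close>
      define r where "r t = (1/2::real)^(n t) / 5" for t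
      have r0: "0 < r t" for t by (simp add: r_def)
      have r1: "r t \<le> \<delta>" if "t \<in> D i" for t
      proof -
        have "(1/2::real)^(n t) \<le> (1/2)^k" using n(1)[OF that] by (intro power_decreasing) auto
        then show ?thesis using k zero_less_power[of "1/2::real" "n t"] unfolding r_def by linarith
      qed
      define Q where "Q t = {s\<in>space \<mu>. dist (Z s) (Z t) \<le> (1/2)^(n t)}" for t
      have Qs: "Q t \<in> sets \<mu>" for t unfolding Q_def by (rule meas)
      have Qm: "emeasure \<mu> (Q t) \<le> ennreal (c * (5/2) powr \<gamma>) * ennreal ((2 * r t) powr \<gamma>)" if "t \<in> D i" for t
      proof -
        have "2 powr - (real (n t) * \<gamma>) = ((1/2)^(n t)) powr \<gamma>"
          by (simp add: powr_powr powr_minus_divide power_one_over powr_divide flip: powr_realpow)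
        also have "(1/2::real)^(n t) = (5/2) * (2 * r t)" by (simp add: r_def)
        also have "\<dots> powr \<gamma> = (5/2) powr \<gamma> * (2 * r t) powr \<gamma>" using r0[of t] by (subst powr_mult) auto
        finally show ?thesis using n(2)[OF that] c unfolding Q_def
          by (simp add: ennreal_mult[symmetric] mult.assoc)
      qed
      have "\<And>t. t \<in> D i \<Longrightarrow> 0 < r t \<and> r t \<le> \<delta>" using r0 r1 by blast
      from Vitali_covering_lemma_cballs_balls[of "D i" r \<delta> Z, OF this]
      obtain G where G: "countable G" "G \<subseteq> D i"
        "pairwise (\<lambda>s t. disjnt (cball (Z s) (r s)) (cball (Z t) (r t))) G"
        and "\<And>t. t \<in> D i \<Longrightarrow> \<exists>j. j \<in> G \<and> \<not> disjnt (cball (Z t) (r t)) (cball (Z j) (r j)) \<and> cball (Z t) (r t) \<subseteq> ball (Z j) (5 * r j)"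
        by blast
      then have G4: "\<exists>j\<in>G. cball (Z t) (r t) \<subseteq> ball (Z j) (5 * r j)" if "t \<in> D i" for t
        using that by blast
      have cover: "D i \<subseteq> (\<Union>j\<in>G. Q j)"
      proof
        fix t assume t: "t \<in> D i"
        then obtain j where j: "j \<in> G" "cball (Z t) (r t) \<subseteq> ball (Z j) (5 * r j)" using G4 by blast
        have "Z t \<in> cball (Z t) (r t)" using r0[of t] by simp
        then have "Z t \<in> ball (Z j) (5 * r j)" using j(2) by blast
        then have "t \<in> Q j" using t DT Tsp by (auto simp: Q_def r_def dist_commute)
        then show "t \<in> (\<Union>j\<in>G. Q j)" using j(1) by blast
      qed
      \<comment> \<open>The premeasure admits finite families only; the countable family is reached
        afterwards by a monotone limit.\<close>
      have fin: "emeasure \<mu> (\<Union>j\<in>H. Q j) \<le> ennreal (c * (5/2) powr \<gamma>) * ?W" if H: "finite H" "H \<subseteq> G" for H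
      proof -
        have inj: "inj_on (\<lambda>j. (Z j, r j)) H"
        proof (rule inj_onI, rule ccontr)
          fix x y assume xy: "x \<in> H" "y \<in> H" "(Z x, r x) = (Z y, r y)" "x \<noteq> y"
          then have "disjnt (cball (Z x) (r x)) (cball (Z y) (r y))" using pairwiseD[OF G(3), of x y] H(2) by blast
          moreover have "Z x \<in> cball (Z x) (r x)" "Z x \<in> cball (Z y) (r y)" using less_imp_le[OF r0, of x] xy by auto
          ultimately show False unfolding disjnt_def by blast
        qed
        have "emeasure \<mu> (\<Union>j\<in>H. Q j) \<le> (\<Sum>j\<in>H. emeasure \<mu> (Q j))"
          using H Qs by (intro emeasure_subadditive_finite) auto
        also have "\<dots> \<le> (\<Sum>j\<in>H. ennreal (c * (5/2) powr \<gamma>) * ennreal ((2 * r j) powr \<gamma>))"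
          using H G(2) by (intro sum_mono Qm) auto
        also have "\<dots> = ennreal (c * (5/2) powr \<gamma>) * (\<Sum>j\<in>H. ennreal ((2 * r j) powr \<gamma>))"
          by (rule sum_distrib_left[symmetric])
        also have "(\<Sum>j\<in>H. ennreal ((2 * r j) powr \<gamma>)) = (\<Sum>p\<in>(\<lambda>j. (Z j, r j)) ` H. ennreal ((2 * snd p) powr \<gamma>))"
          by (subst sum.reindex[OF inj]) simp
        also have "\<dots> \<le> ?W"
          unfolding packing_premeasure_delta_def
        proof (rule SUP_upper, intro CollectI conjI ballI impI)
          show "finite ((\<lambda>j. (Z j, r j)) ` H)" using H by simp
          show "(\<lambda>j. (Z j, r j)) ` H \<subseteq> C i \<times> {0<..\<delta>}"
          proof (intro image_subsetI)
            fix j assume "j \<in> H"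
            then have "j \<in> D i" using H G(2) by blast
            then show "(Z j, r j) \<in> C i \<times> {0<..\<delta>}" using r0 r1 by (auto simp: D_def)
          qed
          fix p q assume pq: "p \<in> (\<lambda>j. (Z j, r j)) ` H" "q \<in> (\<lambda>j. (Z j, r j)) ` H" "p \<noteq> q"
          then obtain x y where "x \<in> G" "y \<in> G" "x \<noteq> y" "p = (Z x, r x)" "q = (Z y, r y)" using H by auto
          then show "cball (fst p) (snd p) \<inter> cball (fst q) (snd q) = {}"
            using pairwiseD[OF G(3), of x y] by (simp add: disjnt_def)
        qed
        finally show ?thesis by (simp add: mult_left_mono)
      qed
      have "m \<le> emeasure \<mu> (\<Union>j\<in>G. Q j)"
      proof -
        have "(\<Union>j\<in>G. Q j) \<in> sets \<mu>" using G(1) Qs by (intro sets.countable_UN') auto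
        then show ?thesis using cover outer_measure_of_mono[OF cover, of \<mu>] by (simp add: m_def)
      qed
      also have "\<dots> \<le> ennreal (c * (5/2) powr \<gamma>) * ?W"
      proof (cases "G = {}")
        case False
        define e where "e = from_nat_into G"
        have e: "range e = G" using range_from_nat_into[OF False G(1)] by (simp add: e_def)
        define U where "U N = (\<Union>j\<in>e ` {..N}. Q j)" for N :: nat
        have "(\<Union>j\<in>G. Q j) = (\<Union>N. U N)" unfolding U_def e[symmetric] by auto
        moreover have "incseq U" unfolding U_def incseq_def by fastforce
        moreover have "range U \<subseteq> sets \<mu>" unfolding U_def using Qs by auto
        ultimately have "emeasure \<mu> (\<Union>j\<in>G. Q j) = (SUP N. emeasure \<mu> (U N))"
          using SUP_emeasure_incseq[of U \<mu>] by simp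
        also have "\<dots> \<le> ennreal (c * (5/2) powr \<gamma>) * ?W"
          unfolding U_def using e by (intro SUP_least fin) auto
        finally show ?thesis .
      qed simp
      finally show ?thesis .
    qed
    show "?W = \<infinity>"
    proof (rule ccontr)
      assume "?W \<noteq> \<infinity>"
      then obtain v where v: "v \<ge> 0" "?W = ennreal v" by (cases ?W) auto
      have "m \<noteq> \<infinity>" using bound[of 1] v by (auto simp: ennreal_mult[symmetric] top_unique)
      then obtain m' where m': "m' \<ge> 0" "m = ennreal m'" by (cases m) auto
      have "m' > 0" using i m' by (simp add: m_def)
      \<comment> \<open>With this \<open>c\<close> the bound reads m' \<le> m' * v / (2 (v + 1)),
        which is less than m'.\<close>
      define c where "c = m' / (2 * (5/2) powr \<gamma> * (v + 1))"
      have "c > 0" using \<open>m' > 0\<close> v by (simp add: c_def)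
      from bound[OF this] have "ennreal m' \<le> ennreal (c * (5/2) powr \<gamma> * v)"
        using v m' \<open>c > 0\<close> by (simp add: ennreal_mult)
      then have "m' \<le> c * (5/2) powr \<gamma> * v" using v \<open>c > 0\<close> by (subst (asm) ennreal_le_iff) auto
      also have "c * (5/2) powr \<gamma> = m' / (2 * (v + 1))" by (simp add: c_def)
      also have "m' / (2 * (v + 1)) * v = m' * (v / (2 * (v + 1)))" by simp
      also have "\<dots> < m' * 1" using v \<open>m' > 0\<close> by (intro mult_strict_left_mono) auto
      finally show False by simp
    qed
  qed
  then show "\<exists>i. packing_premeasure \<gamma> (C i) = \<infinity>" by blast
qed

section \<open>From expected ball masses to almost every path\<close>

lemma ball_mass_measurable:
  fixes Z :: "'w \<Rightarrow> 'a::euclidean_space \<Rightarrow> 'b::euclidean_space"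
  assumes Z: "(\<lambda>p. Z (fst p) (snd p)) \<in> borel_measurable (M \<Otimes>\<^sub>M borel)"
    and \<mu>: "prob_space \<mu>" "sets \<mu> = sets borel"
  shows "(\<lambda>p. emeasure \<mu> {s. dist (Z (fst p) s) (Z (fst p) (snd p)) \<le> r}) \<in> borel_measurable (M \<Otimes>\<^sub>M \<mu>)"
proof -
  interpret \<mu>: prob_space \<mu> by fact
  have sp: "space \<mu> = UNIV" using sets_eq_imp_space_eq[OF \<mu>(2)] by simp
  have Z': "(\<lambda>p. Z (fst p) (snd p)) \<in> borel_measurable (M \<Otimes>\<^sub>M \<mu>)"
    using Z measurable_cong_sets[OF sets_pair_measure_cong[OF refl \<mu>(2)] refl] by blast
  have 1: "(\<lambda>p. Z (fst (fst p)) (snd p)) \<in> borel_measurable ((M \<Otimes>\<^sub>M \<mu>) \<Otimes>\<^sub>M \<mu>)"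
  proof -
    have "(\<lambda>p. (fst (fst p), snd p)) \<in> measurable ((M \<Otimes>\<^sub>M \<mu>) \<Otimes>\<^sub>M \<mu>) (M \<Otimes>\<^sub>M \<mu>)" by measurable
    from measurable_compose[OF this Z'] show ?thesis by simp
  qed
  have 2: "(\<lambda>p. Z (fst (fst p)) (snd (fst p))) \<in> borel_measurable ((M \<Otimes>\<^sub>M \<mu>) \<Otimes>\<^sub>M \<mu>)"
    by (rule measurable_compose[OF measurable_fst Z'])
  define Q where "Q = {p \<in> space ((M \<Otimes>\<^sub>M \<mu>) \<Otimes>\<^sub>M \<mu>). dist (Z (fst (fst p)) (snd p)) (Z (fst (fst p)) (snd (fst p))) \<le> r}"
  have "Q \<in> sets ((M \<Otimes>\<^sub>M \<mu>) \<Otimes>\<^sub>M \<mu>)" unfolding Q_def using 1 2 by measurable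
  then have "(\<lambda>p. emeasure \<mu> (Pair p -` Q)) \<in> borel_measurable (M \<Otimes>\<^sub>M \<mu>)" by (rule \<mu>.measurable_emeasure_Pair)
  moreover have "Pair p -` Q = {s. dist (Z (fst p) s) (Z (fst p) (snd p)) \<le> r}" if "p \<in> space (M \<Otimes>\<^sub>M \<mu>)" for p
    using that by (auto simp: Q_def space_pair_measure sp)
  ultimately show ?thesis by (simp cong: measurable_cong)
qed

lemma section_measurable:
  assumes Z: "(\<lambda>p. Z (fst p) (snd p)) \<in> measurable (M \<Otimes>\<^sub>M N) L" and "\<omega> \<in> space M"
  shows "Z \<omega> \<in> measurable N L"
  using measurable_compose[OF measurable_Pair1'[OF assms(2)] Z] by simp

lemma AE_packing_measure_infinite:
  fixes Z :: "'w \<Rightarrow> 'a::euclidean_space \<Rightarrow> 'b::euclidean_space"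
  assumes M: "prob_space M"
    and Z: "(\<lambda>p. Z (fst p) (snd p)) \<in> borel_measurable (M \<Otimes>\<^sub>M borel)"
    and \<mu>: "\<mu> \<in> Pc A" and \<gamma>: "\<gamma> \<ge> 0"
    and lim: "AE t in \<mu>. Liminf (at_right 0) (\<lambda>r. ennreal (r powr (- \<gamma>)) * exp_ball_mass M Z \<mu> t r) = 0"
  shows "AE \<omega> in M. packing_measure \<gamma> (Z \<omega> ` A) = \<infinity>"
proof -
  interpret M: prob_space M by fact
  from \<mu> obtain K where \<mu>': "prob_space \<mu>" "sets \<mu> = sets borel" and K: "compact K" "K \<subseteq> A" "emeasure \<mu> (space \<mu> - K) = 0"
    unfolding Pc_def by auto
  interpret \<mu>: prob_space \<mu> by fact
  interpret P: pair_sigma_finite M \<mu> by unfold_locales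
  have sp: "space \<mu> = UNIV" using sets_eq_imp_space_eq[OF \<mu>'(2)] by simp
  define m where "m n \<omega> t = emeasure \<mu> {s. dist (Z \<omega> s) (Z \<omega> t) \<le> (1/2)^n}" for n \<omega> t
  define h where "h n \<omega> t = ennreal (2 powr (real n * \<gamma>)) * m n \<omega> t" for n \<omega> t
  have m_meas: "(\<lambda>p. m n (fst p) (snd p)) \<in> borel_measurable (M \<Otimes>\<^sub>M \<mu>)" for n
    unfolding m_def by (rule ball_mass_measurable[OF Z \<mu>'])
  have h_meas[measurable]: "(\<lambda>p. h n (fst p) (snd p)) \<in> borel_measurable (M \<Otimes>\<^sub>M \<mu>)" for n
    unfolding h_def using m_meas by measurable
  have h_meas1[measurable]: "(\<lambda>\<omega>. h n \<omega> t) \<in> borel_measurable M" for n t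
    using measurable_compose[OF measurable_Pair2'[of t \<mu> M] h_meas[of n]] by (simp add: sp)
  have m_meas1[measurable]: "(\<lambda>\<omega>. m n \<omega> t) \<in> borel_measurable M" for n t
    using measurable_compose[OF measurable_Pair2'[of t \<mu> M] m_meas[of n]] by (simp add: sp)
  have ebm: "exp_ball_mass M Z \<mu> t r = (\<integral>\<^sup>+\<omega>. emeasure \<mu> {s. dist (Z \<omega> s) (Z \<omega> t) \<le> r} \<partial>M)" for t r
    unfolding exp_ball_mass_def sp by (intro nn_integral_cong arg_cong2[where f=emeasure]) (auto simp: dist_commute)
  have "AE t in \<mu>. AE \<omega> in M. liminf (\<lambda>n. h n \<omega> t) = 0"
    using lim
  proof eventually_elim
    case (elim t)
    have "liminf (\<lambda>n. \<integral>\<^sup>+\<omega>. h n \<omega> t \<partial>M) = 0"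
    proof (rule liminf_zeroI)
      fix c :: real and k assume c: "c > 0"
      have "\<exists>\<^sub>F r in at_right 0. ennreal (r powr (- \<gamma>)) * exp_ball_mass M Z \<mu> t r < ennreal (c / 2 powr \<gamma>)"
        using c by (intro Liminf_zeroD[OF elim]) auto
      moreover have "\<forall>\<^sub>F r in at_right 0. 0 < r \<and> r < (1/2::real)^k"
        by (intro eventually_conj eventually_at_right_less eventually_at_right_real[THEN eventually_mono]) auto
      ultimately obtain r where r: "0 < r" "r < (1/2)^k"
        "ennreal (r powr (- \<gamma>)) * exp_ball_mass M Z \<mu> t r < ennreal (c / 2 powr \<gamma>)"
        using frequently_ex[OF frequently_eventually_frequently] by blast
      have "r \<le> 1" using r(2) power_le_one[of "1/2::real" k] by linarith
      \<comment> \<open>The radius is rounded down to 2^-(n+1), at the cost of a factor of at most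
        2^\<gamma> in the weight.\<close>
      then obtain n where n: "(1/2)^(Suc n) < r" "r \<le> (1/2)^n" using dyadic_scale[OF r(1)] by blast
      have "Suc n \<ge> k"
      proof (rule ccontr)
        assume "\<not> k \<le> Suc n"
        then have "(1/2::real)^k \<le> (1/2)^(Suc n)" by (intro power_decreasing) auto
        then show False using n(1) r(2) by linarith
      qed
      moreover have "(\<integral>\<^sup>+\<omega>. h (Suc n) \<omega> t \<partial>M) \<le> ennreal c"
      proof -
        have "(\<integral>\<^sup>+\<omega>. m (Suc n) \<omega> t \<partial>M) \<le> exp_ball_mass M Z \<mu> t r"
          unfolding ebm m_def
        proof (intro nn_integral_mono emeasure_mono)
          fix \<omega> assume "\<omega> \<in> space M"
          then have "Z \<omega> \<in> borel_measurable borel" by (rule section_measurable[OF Z])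
          then have "{s\<in>space borel. dist (Z \<omega> s) (Z \<omega> t) \<le> r} \<in> sets borel" by measurable
          then show "{s. dist (Z \<omega> s) (Z \<omega> t) \<le> r} \<in> sets \<mu>" using \<mu>'(2) by simp
        qed (use n(1) in auto)
        moreover have "2 powr (real (Suc n) * \<gamma>) \<le> 2 powr \<gamma> * r powr (- \<gamma>)"
        proof -
          have "2 powr (real (Suc n) * \<gamma>) = 2 powr \<gamma> * ((1/2)^n) powr (- \<gamma>)"
            by (simp add: powr_powr powr_minus_divide power_one_over powr_divide powr_add[symmetric] algebra_simps flip: powr_realpow)
          also have "\<dots> \<le> 2 powr \<gamma> * r powr (- \<gamma>)"
            using n r \<gamma> by (intro mult_left_mono powr_mono2') auto
          finally show ?thesis .
        qed
        ultimately have "ennreal (2 powr (real (Suc n) * \<gamma>)) * (\<integral>\<^sup>+\<omega>. m (Suc n) \<omega> t \<partial>M)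
            \<le> ennreal (2 powr \<gamma> * r powr (- \<gamma>)) * exp_ball_mass M Z \<mu> t r"
          by (intro mult_mono ennreal_leI) auto
        also have "\<dots> = ennreal (2 powr \<gamma>) * (ennreal (r powr (- \<gamma>)) * exp_ball_mass M Z \<mu> t r)"
          by (simp add: ennreal_mult mult.assoc)
        also have "\<dots> \<le> ennreal (2 powr \<gamma>) * ennreal (c / 2 powr \<gamma>)"
          using r(3) by (intro mult_left_mono) auto
        also have "\<dots> = ennreal c" using c by (simp add: ennreal_mult[symmetric])
        finally show ?thesis unfolding h_def by (simp add: nn_integral_cmult)
      qed
      ultimately show "\<exists>n\<ge>k. (\<integral>\<^sup>+\<omega>. h n \<omega> t \<partial>M) \<le> ennreal c" by blast
    qed
    moreover have "(\<integral>\<^sup>+\<omega>. liminf (\<lambda>n. h n \<omega> t) \<partial>M) \<le> liminf (\<lambda>n. \<integral>\<^sup>+\<omega>. h n \<omega> t \<partial>M)"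
      by (rule nn_integral_liminf) measurable
    ultimately have "(\<integral>\<^sup>+\<omega>. liminf (\<lambda>n. h n \<omega> t) \<partial>M) = 0" by simp
    then show ?case by (subst (asm) nn_integral_0_iff_AE) auto
  qed
  \<comment> \<open>Exchanging the two almost-everywhere quantifiers requires joint measurability of
    the lower limit.\<close>
  then have "AE \<omega> in M. AE t in \<mu>. liminf (\<lambda>n. h n \<omega> t) = 0"
  proof (subst P.AE_commute)
    have "{p \<in> space (M \<Otimes>\<^sub>M \<mu>). liminf (\<lambda>n. h n (fst p) (snd p)) = 0} \<in> sets (M \<Otimes>\<^sub>M \<mu>)" by measurable
    then show "{x \<in> space (M \<Otimes>\<^sub>M \<mu>). liminf (\<lambda>n. h n (fst x) (snd x)) = 0} \<in> sets (M \<Otimes>\<^sub>M \<mu>)" .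
  qed
  then show ?thesis
    using AE_space
  proof eventually_elim
    case (elim \<omega>)
    have Zw: "Z \<omega> \<in> borel_measurable borel" using section_measurable[OF Z elim(2)] .
    have hw[measurable]: "(\<lambda>t. h n \<omega> t) \<in> borel_measurable \<mu>" for n
      using measurable_compose[OF measurable_Pair1'[OF elim(2), of \<mu>] h_meas[of n]] by simp
    define T where "T = K \<inter> {t \<in> space \<mu>. liminf (\<lambda>n. h n \<omega> t) = 0}"
    have Kb: "K \<in> sets \<mu>" using K(1) \<mu>'(2) by (simp add: compact_imp_closed)
    have "(\<lambda>t. liminf (\<lambda>n. h n \<omega> t)) \<in> borel_measurable \<mu>" by (rule borel_measurable_liminf[OF hw])
    then have "{t \<in> space \<mu>. liminf (\<lambda>n. h n \<omega> t) = 0} \<in> sets \<mu>" by measurable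
    then have T: "T \<in> sets \<mu>" unfolding T_def using Kb by (intro sets.Int)
    have "AE t in \<mu>. t \<in> K"
      by (rule AE_I[OF _ K(3) sets.compl_sets[OF Kb]]) auto
    then have "AE t in \<mu>. t \<in> T" using elim(1) AE_space by eventually_elim (auto simp: T_def)
    then have "emeasure \<mu> T = 1" using \<mu>.emeasure_eq_1_AE[OF T] by blast
    have "packing_measure \<gamma> (Z \<omega> ` T) = \<infinity>"
    proof (rule packing_measure_infinite_of_density[OF T _ \<gamma>])
      show "0 < emeasure \<mu> T" using \<open>emeasure \<mu> T = 1\<close> by simp
      show "{s \<in> space \<mu>. dist (Z \<omega> s) y \<le> r} \<in> sets \<mu>" for y r
      proof -
        have "{s\<in>space borel. dist (Z \<omega> s) y \<le> r} \<in> sets borel" using Zw by measurable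
        then show ?thesis using \<mu>'(2) by (simp add: sp)
      qed
      fix t k and c :: real assume t: "t \<in> T" and c: "c > 0"
      have "\<exists>\<^sub>F n in sequentially. h n \<omega> t < ennreal c"
        using t c by (intro Liminf_zeroD) (auto simp: T_def)
      then obtain n where n: "n \<ge> k" "h n \<omega> t < ennreal c"
        by (auto simp: frequently_sequentially)
      have "m n \<omega> t = ennreal (2 powr - (real n * \<gamma>)) * h n \<omega> t"
        unfolding h_def mult.assoc[symmetric] by (simp add: ennreal_mult[symmetric] powr_add[symmetric])
      also have "\<dots> \<le> ennreal (2 powr - (real n * \<gamma>)) * ennreal c"
        using n(2) by (intro mult_left_mono) auto
      finally have "m n \<omega> t \<le> ennreal (c * 2 powr - (real n * \<gamma>))"
        using c by (simp add: ennreal_mult mult.commute)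
      then show "\<exists>n\<ge>k. emeasure \<mu> {s \<in> space \<mu>. dist (Z \<omega> s) (Z \<omega> t) \<le> (1/2)^n} \<le> ennreal (c * 2 powr - (real n * \<gamma>))"
        using n(1) by (auto simp: m_def sp)
    qed
    moreover have "packing_measure \<gamma> (Z \<omega> ` T) \<le> packing_measure \<gamma> (Z \<omega> ` A)"
      using K(2) by (intro packing_measure_mono) (auto simp: T_def)
    ultimately show ?case by (simp add: top_unique)
  qed
qed

lemma packing_dim_ge: "packing_measure s E = \<infinity> \<Longrightarrow> ereal s \<le> packing_dim E"
  unfolding packing_dim_def by (rule Sup_upper) auto

text \<open>Rational thresholds keep the exceptional null sets countable; for each of them one
  measure \<mu> and one exponent above the threshold suffice.\<close>

proposition AE_dimPZ_le_packing_dim: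
  fixes Z :: "'w \<Rightarrow> 'a::euclidean_space \<Rightarrow> 'b::euclidean_space"
  assumes M: "prob_space M"
    and Z: "(\<lambda>p. Z (fst p) (snd p)) \<in> borel_measurable (M \<Otimes>\<^sub>M borel)"
  shows "AE \<omega> in M. dimPZ M Z A \<le> packing_dim (Z \<omega> ` A)"
proof -
  have "AE \<omega> in M. ereal (real_of_rat q) < dimPZ M Z A \<longrightarrow> ereal (real_of_rat q) \<le> packing_dim (Z \<omega> ` A)" for q
  proof (cases "ereal (real_of_rat q) < dimPZ M Z A")
    case True
    then obtain \<mu> where \<mu>: "\<mu> \<in> Pc A" "ereal (real_of_rat q) < dimPZ_measure M Z \<mu>"
      unfolding dimPZ_def less_Sup_iff by auto
    then obtain \<gamma> where \<gamma>: "real_of_rat q < \<gamma>"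
      "AE t in \<mu>. Liminf (at_right 0) (\<lambda>r. ennreal (r powr (- \<gamma>)) * exp_ball_mass M Z \<mu> t r) = 0"
      unfolding dimPZ_measure_def less_Sup_iff by auto
    have "AE \<omega> in M. packing_measure \<gamma> (Z \<omega> ` A) = \<infinity>"
    proof (cases "\<gamma> \<ge> 0")
      case True
      then show ?thesis by (rule AE_packing_measure_infinite[OF M Z \<mu>(1) _ \<gamma>(2)])
    next
      case False
      have "A \<noteq> {}"
      proof
        assume "A = {}"
        then have "prob_space \<mu>" "emeasure \<mu> (space \<mu>) = 0" using \<mu>(1) unfolding Pc_def by auto
        then show False using prob_space.emeasure_space_1 by fastforce
      qed
      then show ?thesis using False by (intro AE_I2 packing_measure_negative_exponent) auto
    qed
    then show ?thesis
    proof eventually_elim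
      case (elim \<omega>)
      have "ereal (real_of_rat q) \<le> ereal \<gamma>" using \<gamma>(1) by simp
      also have "\<dots> \<le> packing_dim (Z \<omega> ` A)" by (rule packing_dim_ge[OF elim])
      finally show ?case by simp
    qed
  qed simp
  then have "AE \<omega> in M. \<forall>q. ereal (real_of_rat q) < dimPZ M Z A \<longrightarrow> ereal (real_of_rat q) \<le> packing_dim (Z \<omega> ` A)"
    by (simp add: AE_all_countable)
  then show ?thesis
  proof eventually_elim
    case (elim \<omega>)
    show ?case
    proof (rule ccontr)
      assume "\<not> ?case"
      then have "packing_dim (Z \<omega> ` A) < dimPZ M Z A" by simp
      from ereal_dense3[OF this] obtain q where "packing_dim (Z \<omega> ` A) < ereal (real_of_rat q)" "ereal (real_of_rat q) < dimPZ M Z A" by auto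
      then show False using elim by (meson not_le)
    qed
  qed
qed

section \<open>The upper bound\<close>

text \<open>An integral of two-point probabilities is the form in which the Gaussian estimates
  enter.\<close>

lemma exp_ball_mass_Fubini:
  fixes Z :: "'w \<Rightarrow> 'a::euclidean_space \<Rightarrow> 'b::euclidean_space"
  assumes M: "prob_space M" and Z: "(\<lambda>p. Z (fst p) (snd p)) \<in> borel_measurable (M \<Otimes>\<^sub>M borel)"
    and \<mu>: "prob_space \<mu>" "sets \<mu> = sets borel"
  shows "exp_ball_mass M Z \<mu> t r = (\<integral>\<^sup>+s. emeasure M {\<omega>\<in>space M. dist (Z \<omega> s) (Z \<omega> t) \<le> r} \<partial>\<mu>)"
proof -
  interpret M: prob_space M by fact
  interpret \<mu>: prob_space \<mu> by fact
  interpret P: pair_sigma_finite M \<mu> by unfold_locales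
  have sp: "space \<mu> = UNIV" using sets_eq_imp_space_eq[OF \<mu>(2)] by simp
  have Z': "(\<lambda>p. Z (fst p) (snd p)) \<in> borel_measurable (M \<Otimes>\<^sub>M \<mu>)"
    using Z measurable_cong_sets[OF sets_pair_measure_cong[OF refl \<mu>(2)] refl] by blast
  have "(\<lambda>\<omega>. Z \<omega> t) \<in> borel_measurable M"
    using measurable_compose[OF measurable_Pair2'[of t borel M] Z] by simp
  then have Zt: "(\<lambda>p. Z (fst p) t) \<in> borel_measurable (M \<Otimes>\<^sub>M \<mu>)"
    by (rule measurable_compose[OF measurable_fst])
  define Q where "Q = {p\<in>space (M \<Otimes>\<^sub>M \<mu>). dist (Z (fst p) (snd p)) (Z (fst p) t) \<le> r}"
  have Q: "Q \<in> sets (M \<Otimes>\<^sub>M \<mu>)" unfolding Q_def using Z' Zt by measurable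
  have "exp_ball_mass M Z \<mu> t r = (\<integral>\<^sup>+\<omega>. emeasure \<mu> (Pair \<omega> -` Q) \<partial>M)"
    unfolding exp_ball_mass_def
    by (intro nn_integral_cong arg_cong2[where f=emeasure]) (auto simp: Q_def space_pair_measure sp dist_commute)
  also have "\<dots> = emeasure (M \<Otimes>\<^sub>M \<mu>) Q" by (rule \<mu>.emeasure_pair_measure_alt[OF Q, symmetric])
  also have "\<dots> = (\<integral>\<^sup>+s. emeasure M ((\<lambda>\<omega>. (\<omega>, s)) -` Q) \<partial>\<mu>)" by (rule P.emeasure_pair_measure_alt2[OF Q])
  also have "\<dots> = (\<integral>\<^sup>+s. emeasure M {\<omega>\<in>space M. dist (Z \<omega> s) (Z \<omega> t) \<le> r} \<partial>\<mu>)"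
    by (intro nn_integral_cong arg_cong2[where f=emeasure]) (auto simp: Q_def space_pair_measure sp)
  finally show ?thesis .
qed

lemma dyadic_powr_small:
  fixes \<delta> :: real
  assumes "\<delta> > 0" "c > 0" "C \<ge> 0"
  obtains k0 where "\<And>n. n \<ge> k0 \<Longrightarrow> C * 2 powr - (real n * \<delta>) \<le> c"
proof -
  define q where "q = 2 powr - \<delta>"
  have q: "0 < q" "q < 1" using powr_less_mono[of "- \<delta>" 0 2] assms by (auto simp: q_def)
  have eq: "2 powr - (real n * \<delta>) = q ^ n" for n
    by (simp add: q_def powr_powr mult.commute flip: powr_realpow)
  have "(\<lambda>n. C * q ^ n) \<longlonglongrightarrow> C * 0" using q by (intro tendsto_intros LIMSEQ_power_zero) auto
  then have "\<forall>\<^sub>F n in sequentially. C * q ^ n < c" using assms(2) by (intro order_tendstoD(2)) auto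
  then obtain k0 where "\<And>n. n \<ge> k0 \<Longrightarrow> C * q ^ n < c" by (auto simp: eventually_sequentially)
  then show thesis using that[of k0] unfolding eq by (simp add: less_imp_le)
qed

text \<open>A Dirac mass lies in \<open>Pc A\<close>, and every negative \<gamma> satisfies the
  limit condition because ball masses are at most 1. In the upper bound this confines attention to
  exponents \<gamma> \<ge> 0.\<close>

lemma dimPZ_nonneg:
  fixes Z :: "'w \<Rightarrow> 'a::euclidean_space \<Rightarrow> 'b::metric_space"
  assumes M: "prob_space M" and A: "A \<noteq> {}"
  shows "0 \<le> dimPZ M Z A"
proof -
  interpret M: prob_space M by fact
  obtain t where t: "t \<in> A" using A by auto
  define \<mu> where "\<mu> = return borel t"
  interpret \<mu>: prob_space \<mu> unfolding \<mu>_def by (rule prob_space_return) simp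
  have "\<mu> \<in> Pc A"
    unfolding Pc_def
  proof (intro CollectI conjI exI[of _ "{t}"])
    show "sets \<mu> = sets borel" by (simp add: \<mu>_def)
    show "prob_space \<mu>" by unfold_locales
    show "emeasure \<mu> (space \<mu> - {t}) = 0" by (simp add: \<mu>_def)
  qed (use t in auto)
  then have "dimPZ_measure M Z \<mu> \<le> dimPZ M Z A" unfolding dimPZ_def by (intro Sup_upper) auto
  moreover have "ereal \<gamma> \<le> dimPZ_measure M Z \<mu>" if \<gamma>: "\<gamma> < 0" for \<gamma>
  proof -
    have le1: "exp_ball_mass M Z \<mu> s r \<le> 1" for s r
    proof -
      have "exp_ball_mass M Z \<mu> s r \<le> (\<integral>\<^sup>+ \<omega>. 1 \<partial>M)"
        unfolding exp_ball_mass_def by (intro nn_integral_mono \<mu>.emeasure_le_1)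
      then show ?thesis by (simp add: M.emeasure_space_1)
    qed
    have "Liminf (at_right 0) (\<lambda>r. ennreal (r powr (- \<gamma>)) * exp_ball_mass M Z \<mu> s r) = 0" for s
    proof (rule Liminf_at_right_zeroI)
      fix c :: real and k assume "c > 0"
      then obtain k0 where k0: "\<And>n. n \<ge> k0 \<Longrightarrow> 1 * 2 powr - (real n * (- \<gamma>)) \<le> c"
        using dyadic_powr_small[of "- \<gamma>" c 1] \<gamma> by auto
      define n where "n = max k k0"
      have "((1/2::real) ^ n) powr (- \<gamma>) = 2 powr - (real n * (- \<gamma>))"
        by (simp add: powr_powr powr_minus_divide power_one_over powr_divide flip: powr_realpow)
      then have "((1/2::real) ^ n) powr (- \<gamma>) \<le> c" using k0[of n] by (simp add: n_def)
      then have "ennreal (((1/2) ^ n) powr (- \<gamma>)) * exp_ball_mass M Z \<mu> s ((1/2) ^ n) \<le> ennreal c * 1"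
        by (intro mult_mono ennreal_leI le1) auto
      then show "\<exists>n\<ge>k. ennreal (((1/2) ^ n) powr (- \<gamma>)) * exp_ball_mass M Z \<mu> s ((1/2) ^ n) \<le> ennreal c"
        by (intro exI[of _ n]) (auto simp: n_def)
    qed
    then show ?thesis unfolding dimPZ_measure_def by (intro Sup_upper) auto
  qed
  ultimately have *: "ereal \<gamma> \<le> dimPZ M Z A" if "\<gamma> < 0" for \<gamma> using that order_trans by blast
  show ?thesis
  proof (rule ccontr)
    assume "\<not> ?thesis"
    then have "dimPZ M Z A < 0" by simp
    then obtain x where "dimPZ M Z A < ereal x" "ereal x < 0" using ereal_dense2 by blast
    then show False using *[of x] by (simp add: not_le[symmetric])
  qed
qed

lemma packing_measure_empty: "packing_measure s {} = 0"
proof -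
  have "packing_premeasure_delta s 1 ({} :: 'a::metric_space set) = 0"
    unfolding packing_premeasure_delta_def by (intro SUP_eqI) auto
  then have "packing_premeasure s ({} :: 'a set) = 0"
    unfolding packing_premeasure_def
    by (metis INF_lower greaterThan_iff le_zero_eq zero_less_one)
  then have "(\<Sum>i::nat. packing_premeasure s ({} :: 'a set)) = 0" by simp
  moreover have "packing_measure s ({} :: 'a set) \<le> (\<Sum>i::nat. packing_premeasure s ({} :: 'a set))"
    unfolding packing_measure_def by (rule INF_lower2[of "\<lambda>_. {}"]) auto
  ultimately show ?thesis by simp
qed

text \<open>Up to constants, the expected ball mass at scale n is at most 2^(2n\<epsilon>) times the
  \<nu>-mass of a cell, one factor coming from \<open>ker\<close> and one from
  \<open>AE_kernel_le_cell_mass\<close>. With the weight 2^(n\<gamma>) and the mass 2^(-j\<gamma>')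
  at a scale j that differs from n by a constant, a factor 2^(-j\<epsilon>) is left, since \<gamma>'
  exceeds \<gamma> by at least 3\<epsilon>.\<close>

lemma frostman_measure_dim:
  fixes Z :: "'w \<Rightarrow> 'a::euclidean_space \<Rightarrow> 'b::euclidean_space"
  assumes M: "prob_space M" and Z: "(\<lambda>p. Z (fst p) (snd p)) \<in> borel_measurable (M \<Otimes>\<^sub>M borel)"
    and \<omega>: "\<omega> \<in> space M" and \<gamma>: "0 \<le> \<gamma>" "\<gamma> + 3 * \<epsilon> \<le> \<gamma>'" and \<epsilon>: "\<epsilon> > 0"
    and \<mu>: "prob_space \<mu>" "sets \<mu> = sets borel" and K: "compact K" "emeasure \<mu> (space \<mu> - K) = 0" "bounded (Z \<omega> ` K)"
    and mass: "\<And>t k. t \<in> K \<Longrightarrow> \<exists>n\<ge>k. emeasure \<mu> {s. dist (Z \<omega> s) (Z \<omega> t) \<le> (1/2)^(n+3)} \<le> ennreal (2 powr - (real n * \<gamma>'))"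
    and C: "C \<ge> 0" and ker: "\<forall>\<^sub>F n in sequentially. \<forall>t\<in>K. \<forall>s\<in>K.
      measure M {\<omega>'\<in>space M. dist (Z \<omega>' s) (Z \<omega>' t) \<le> (1/2)^n} \<le> C * 2 powr (real n * \<epsilon>) * kern n (Z \<omega> t) (Z \<omega> s)"
  shows "ereal \<gamma> \<le> dimPZ_measure M Z \<mu>"
proof -
  interpret M: prob_space M by fact
  interpret \<mu>: prob_space \<mu> by fact
  have sp: "space \<mu> = UNIV" using sets_eq_imp_space_eq[OF \<mu>(2)] by simp
  have Zw0: "Z \<omega> \<in> borel_measurable borel" using section_measurable[OF Z \<omega>] .
  then have Zw: "Z \<omega> \<in> measurable \<mu> borel" using \<mu>(2) measurable_cong_sets by blast
  define \<nu> where "\<nu> = distr \<mu> borel (Z \<omega>)"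
  have \<nu>: "prob_space \<nu>" "sets \<nu> = sets borel" unfolding \<nu>_def by (auto intro: \<mu>.prob_space_distr Zw)
  have Kb: "K \<in> sets \<mu>" using K(1) \<mu>(2) by (simp add: compact_imp_closed)
  have AEK: "AE t in \<mu>. t \<in> K" by (rule AE_I[OF _ K(2) sets.compl_sets[OF Kb]]) auto
  obtain R where R: "\<And>t. t \<in> K \<Longrightarrow> norm (Z \<omega> t) \<le> R" using K(3) by (auto simp: bounded_iff)
  obtain a :: nat where "R < 2 ^ a" using real_arch_pow[of 2 R] by auto
  then have a: "\<bar>Z \<omega> t \<bullet> b\<bar> \<le> 2 ^ a" if "t \<in> K" "b \<in> Basis" for t b
    using R[OF that(1)] Basis_le_norm[OF that(2), of "Z \<omega> t"] by linarith
  have "AE y in \<nu>. \<forall>b\<in>Basis. \<bar>y \<bullet> b\<bar> \<le> 2^a"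
    unfolding \<nu>_def
  proof (subst AE_distr_iff[OF Zw])
    have "{y\<in>space borel. \<forall>b\<in>Basis. \<bar>(y::'b) \<bullet> b\<bar> \<le> 2^a} \<in> sets borel" by measurable
    then show "{y\<in>space borel. \<forall>b\<in>Basis. \<bar>(y::'b) \<bullet> b\<bar> \<le> 2^a} \<in> sets borel" .
    show "AE t in \<mu>. \<forall>b\<in>Basis. \<bar>Z \<omega> t \<bullet> b\<bar> \<le> 2^a" using AEK by eventually_elim (use a in auto)
  qed
  from AE_kernel_le_cell_mass[OF \<nu> this \<epsilon>]
  have "AE t in \<mu>. \<forall>\<^sub>F n in sequentially. (\<integral>\<^sup>+z. ennreal (kern n (Z \<omega> t) z) \<partial>\<nu>)
           \<le> ennreal (2 powr (real n * \<epsilon>)) * emeasure \<nu> {z. cell n z = cell n (Z \<omega> t)}"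
    unfolding \<nu>_def by (rule AE_distrD[OF Zw])
  with AEK have "AE t in \<mu>. Liminf (at_right 0) (\<lambda>r. ennreal (r powr (- \<gamma>)) * exp_ball_mass M Z \<mu> t r) = 0"
  proof eventually_elim
    case (elim t)
    show ?case
    proof (rule Liminf_at_right_zeroI)
      fix c :: real and k assume c: "c > 0"
      from eventually_conj[OF ker elim(2)] obtain n1 where n1:
        "\<And>n s. n \<ge> n1 \<Longrightarrow> s \<in> K \<Longrightarrow> measure M {\<omega>'\<in>space M. dist (Z \<omega>' s) (Z \<omega>' t) \<le> (1/2)^n} \<le> C * 2 powr (real n * \<epsilon>) * kern n (Z \<omega> t) (Z \<omega> s)"
        "\<And>n. n \<ge> n1 \<Longrightarrow> (\<integral>\<^sup>+z. ennreal (kern n (Z \<omega> t) z) \<partial>\<nu>)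
           \<le> ennreal (2 powr (real n * \<epsilon>)) * emeasure \<nu> {z. cell n z = cell n (Z \<omega> t)}"
        using elim(1) unfolding eventually_sequentially by blast
      \<comment> \<open>The scale shift: points in one cell of side 2^-(j+e) are at most
        \<open>DIM('b)\<close> * 2^-(j+e) apart, hence at most 2^-(j+3), as a dimension is less than
        2 to its own power. So the cell fits into the ball of small mass.\<close>
      define e where "e = 3 + DIM('b)"
      define C' where "C' = C * 2 powr (real e * (\<gamma> + 2 * \<epsilon>))"
      obtain k0 where k0: "\<And>n. n \<ge> k0 \<Longrightarrow> C' * 2 powr - (real n * \<epsilon>) \<le> c"
        using dyadic_powr_small[OF \<epsilon> c, of C'] C by (auto simp: C'_def)
      obtain j where j: "j \<ge> max k (max n1 k0)"
        "emeasure \<mu> {s. dist (Z \<omega> s) (Z \<omega> t) \<le> (1/2)^(j+3)} \<le> ennreal (2 powr - (real j * \<gamma>'))"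
        using mass[OF elim(1)] by blast
      define n where "n = j + e"
      have nn1: "n \<ge> n1" using j(1) by (simp add: n_def)
      have cellm: "{z. cell n z = i} \<in> sets borel" for i :: "'b \<Rightarrow> int" by (rule cell_vimage_measurable)
      have kernm: "(\<lambda>z. ennreal (kern n (Z \<omega> t) z)) \<in> borel_measurable borel"
        unfolding kern_eq by measurable
      have "exp_ball_mass M Z \<mu> t ((1/2)^n) = (\<integral>\<^sup>+s. emeasure M {\<omega>'\<in>space M. dist (Z \<omega>' s) (Z \<omega>' t) \<le> (1/2)^n} \<partial>\<mu>)"
        by (rule exp_ball_mass_Fubini[OF M Z \<mu>])
      also have "\<dots> \<le> (\<integral>\<^sup>+s. ennreal (C * 2 powr (real n * \<epsilon>)) * ennreal (kern n (Z \<omega> t) (Z \<omega> s)) \<partial>\<mu>)"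
      proof (rule nn_integral_mono_AE)
        show "AE s in \<mu>. emeasure M {\<omega>'\<in>space M. dist (Z \<omega>' s) (Z \<omega>' t) \<le> (1/2)^n}
            \<le> ennreal (C * 2 powr (real n * \<epsilon>)) * ennreal (kern n (Z \<omega> t) (Z \<omega> s))"
          using AEK
        proof eventually_elim
          case (elim s)
          have "emeasure M {\<omega>'\<in>space M. dist (Z \<omega>' s) (Z \<omega>' t) \<le> (1/2)^n} \<le> ennreal (C * 2 powr (real n * \<epsilon>) * kern n (Z \<omega> t) (Z \<omega> s))"
            unfolding M.emeasure_eq_measure by (intro ennreal_leI n1(1)[OF nn1 elim])
          then show ?case using C by (simp add: ennreal_mult cell_kernel_nonneg)
        qed
      qed
      also have "\<dots> = ennreal (C * 2 powr (real n * \<epsilon>)) * (\<integral>\<^sup>+z. ennreal (kern n (Z \<omega> t) z) \<partial>\<nu>)"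
        unfolding \<nu>_def using kernm Zw by (subst nn_integral_cmult) (auto simp: nn_integral_distr intro: measurable_compose[OF Zw])
      also have "\<dots> \<le> ennreal (C * 2 powr (real n * \<epsilon>)) * (ennreal (2 powr (real n * \<epsilon>)) * emeasure \<nu> {z. cell n z = cell n (Z \<omega> t)})"
        by (intro mult_left_mono n1(2)[OF nn1]) auto
      also have "emeasure \<nu> {z. cell n z = cell n (Z \<omega> t)} \<le> ennreal (2 powr - (real j * \<gamma>'))"
      proof -
        have "emeasure \<nu> {z. cell n z = cell n (Z \<omega> t)} = emeasure \<mu> (Z \<omega> -` {z. cell n z = cell n (Z \<omega> t)} \<inter> space \<mu>)"
          unfolding \<nu>_def by (rule emeasure_distr[OF Zw cellm])
        also have "\<dots> \<le> emeasure \<mu> {s. dist (Z \<omega> s) (Z \<omega> t) \<le> (1/2)^(j+3)}"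
        proof (rule emeasure_mono)
          show "Z \<omega> -` {z. cell n z = cell n (Z \<omega> t)} \<inter> space \<mu> \<subseteq> {s. dist (Z \<omega> s) (Z \<omega> t) \<le> (1/2)^(j+3)}"
          proof safe
            fix s assume "cell n (Z \<omega> s) = cell n (Z \<omega> t)"
            then have "dist (Z \<omega> s) (Z \<omega> t) \<le> real DIM('b) * (1/2)^n" by (rule cell_eq_dist)
            also have "\<dots> = (real DIM('b) * (1/2)^DIM('b)) * (1/2)^(j+3)" by (simp add: n_def e_def power_add)
            also have "\<dots> \<le> 1 * (1/2)^(j+3)"
            proof (intro mult_right_mono)
              have "real DIM('b) < 2 ^ DIM('b)" by (rule of_nat_less_two_power)
              then show "real DIM('b) * (1/2)^DIM('b) \<le> 1" by (simp add: power_one_over field_simps)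
            qed simp
            finally show "dist (Z \<omega> s) (Z \<omega> t) \<le> (1/2)^(j+3)" by simp
          qed
          have "{s\<in>space borel. dist (Z \<omega> s) (Z \<omega> t) \<le> (1/2)^(j+3)} \<in> sets borel" using Zw0 by measurable
          then show "{s. dist (Z \<omega> s) (Z \<omega> t) \<le> (1/2)^(j+3)} \<in> sets \<mu>" using \<mu>(2) by simp
        qed
        also note j(2)
        finally show ?thesis .
      qed
      also have "ennreal (C * 2 powr (real n * \<epsilon>)) * (ennreal (2 powr (real n * \<epsilon>)) * ennreal (2 powr - (real j * \<gamma>')))
          = ennreal (C * 2 powr (real n * \<epsilon>) * 2 powr (real n * \<epsilon>) * 2 powr - (real j * \<gamma>'))"
        using C by (simp add: ennreal_mult mult.assoc)
      finally have 1: "exp_ball_mass M Z \<mu> t ((1/2)^n) \<le> ennreal (C * 2 powr (real n * \<epsilon>) * 2 powr (real n * \<epsilon>) * 2 powr - (real j * \<gamma>'))"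
        by (simp add: mult_left_mono)
      have "((1/2::real)^n) powr (- \<gamma>) = 2 powr (real n * \<gamma>)"
        by (simp add: powr_powr powr_minus_divide power_one_over powr_divide flip: powr_realpow)
      then have "ennreal (((1/2)^n) powr (- \<gamma>)) * exp_ball_mass M Z \<mu> t ((1/2)^n)
          \<le> ennreal (2 powr (real n * \<gamma>)) * ennreal (C * 2 powr (real n * \<epsilon>) * 2 powr (real n * \<epsilon>) * 2 powr - (real j * \<gamma>'))"
        using 1 by (intro mult_mono) auto
      also have "\<dots> = ennreal (C * (2 powr (real n * \<gamma>) * 2 powr (real n * \<epsilon>) * 2 powr (real n * \<epsilon>) * 2 powr - (real j * \<gamma>')))"
        using C by (simp add: ennreal_mult[symmetric] mult_ac)
      also have "\<dots> \<le> ennreal c"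
      proof (rule ennreal_leI)
        have "2 powr (real n * \<gamma>) * 2 powr (real n * \<epsilon>) * 2 powr (real n * \<epsilon>) * 2 powr - (real j * \<gamma>')
            = 2 powr (real n * \<gamma> + real n * \<epsilon> + real n * \<epsilon> + - (real j * \<gamma>'))" by (simp only: powr_add)
        also have "\<dots> \<le> 2 powr (real e * (\<gamma> + 2 * \<epsilon>) + - (real j * \<epsilon>))"
        proof (rule powr_mono)
          have "real j * (\<gamma> + 3 * \<epsilon>) \<le> real j * \<gamma>'" using \<gamma>(2) by (intro mult_left_mono) auto
          then show "real n * \<gamma> + real n * \<epsilon> + real n * \<epsilon> + - (real j * \<gamma>') \<le> real e * (\<gamma> + 2 * \<epsilon>) + - (real j * \<epsilon>)"
            by (simp add: n_def algebra_simps)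
        qed simp
        also have "\<dots> = 2 powr (real e * (\<gamma> + 2 * \<epsilon>)) * 2 powr - (real j * \<epsilon>)" by (simp only: powr_add)
        finally have "C * (2 powr (real n * \<gamma>) * 2 powr (real n * \<epsilon>) * 2 powr (real n * \<epsilon>) * 2 powr - (real j * \<gamma>'))
            \<le> C * (2 powr (real e * (\<gamma> + 2 * \<epsilon>)) * 2 powr - (real j * \<epsilon>))" using C by (rule mult_left_mono)
        also have "\<dots> \<le> c" using k0[of j] j(1) by (simp add: C'_def mult.assoc)
        finally show "C * (2 powr (real n * \<gamma>) * 2 powr (real n * \<epsilon>) * 2 powr (real n * \<epsilon>) * 2 powr - (real j * \<gamma>')) \<le> c" .
      qed
      finally show "\<exists>n\<ge>k. ennreal (((1/2)^n) powr (- \<gamma>)) * exp_ball_mass M Z \<mu> t ((1/2)^n) \<le> ennreal c"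
        using j(1) by (intro exI[of _ n]) (auto simp: n_def)
    qed
  qed
  then show ?thesis unfolding dimPZ_measure_def by (intro Sup_upper) auto
qed

definition kernel_dominated :: "'w measure \<Rightarrow> ('w \<Rightarrow> 'a \<Rightarrow> 'b::euclidean_space) \<Rightarrow> 'w \<Rightarrow> 'a set \<Rightarrow> bool" where
  "kernel_dominated M Z \<omega> S \<longleftrightarrow> (\<forall>\<epsilon>>0. \<forall>R. \<exists>C\<ge>0. \<forall>\<^sub>F n in sequentially. \<forall>t\<in>S. \<forall>s\<in>S.
     norm (Z \<omega> t) \<le> R \<longrightarrow> norm (Z \<omega> s) \<le> R \<longrightarrow>
     measure M {\<omega>'\<in>space M. dist (Z \<omega>' s) (Z \<omega>' t) \<le> (1/2)^n} \<le> C * 2 powr (real n * \<epsilon>) * kern n (Z \<omega> t) (Z \<omega> s))"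

lemma kernel_dominatedD:
  assumes "kernel_dominated M Z \<omega> S" "\<epsilon> > 0"
  obtains C where "C \<ge> 0" "\<forall>\<^sub>F n in sequentially. \<forall>t\<in>S. \<forall>s\<in>S.
     norm (Z \<omega> t) \<le> R \<longrightarrow> norm (Z \<omega> s) \<le> R \<longrightarrow>
     measure M {\<omega>'\<in>space M. dist (Z \<omega>' s) (Z \<omega>' t) \<le> (1/2)^n} \<le> C * 2 powr (real n * \<epsilon>) * kern n (Z \<omega> t) (Z \<omega> s)"
  using assms unfolding kernel_dominated_def by blast

text \<open>If the inequality fails, there is room for \<gamma> < \<gamma>' < s. Infinite packing
  measure at \<open>s\<close> excludes smallness at \<gamma>', and since small sets form a
  \<sigma>-ideal, one piece \<open>B p\<close> already fails to be small; the measure is built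
  there.\<close>

proposition packing_dim_le_dimPZ:
  fixes Z :: "'w \<Rightarrow> 'a::euclidean_space \<Rightarrow> 'b::euclidean_space"
  assumes M: "prob_space M" and Z: "(\<lambda>p. Z (fst p) (snd p)) \<in> borel_measurable (M \<Otimes>\<^sub>M borel)"
    and \<omega>: "\<omega> \<in> space M" and A: "A = (\<Union>p::nat. B p)"
    and par: "\<And>p. \<exists>F (a :: (nat \<Rightarrow> nat) \<Rightarrow> 'a). closed F \<and> continuous_on F a \<and> a ` F = B p \<and> continuous_on F (\<lambda>x. Z \<omega> (a x))"
    and S: "\<And>p. B p \<subseteq> S p" and ker: "\<And>p. kernel_dominated M Z \<omega> (S p)"
  shows "packing_dim (Z \<omega> ` A) \<le> dimPZ M Z A"
proof (rule ccontr)
  assume "\<not> ?thesis"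
  then have "dimPZ M Z A < packing_dim (Z \<omega> ` A)" by simp
  then obtain s where s: "packing_measure s (Z \<omega> ` A) = \<infinity>" "dimPZ M Z A < ereal s"
    unfolding packing_dim_def less_Sup_iff by auto
  have "A \<noteq> {}"
  proof
    assume "A = {}"
    then have "packing_measure s (Z \<omega> ` A) = 0" by (simp add: packing_measure_empty)
    with s(1) show False by simp
  qed
  then have d0: "0 \<le> dimPZ M Z A" by (rule dimPZ_nonneg[OF M])
  obtain \<gamma> where \<gamma>: "dimPZ M Z A < ereal \<gamma>" "ereal \<gamma> < ereal s" using ereal_dense2[OF s(2)] by blast
  have \<gamma>0: "0 \<le> \<gamma>" using d0 \<gamma>(1) by (metis ereal_less_eq(5) less_imp_le order_trans)
  define \<gamma>' where "\<gamma>' = (\<gamma> + s) / 2"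
  have \<gamma>': "\<gamma> < \<gamma>'" "\<gamma>' < s" using \<gamma>(2) by (auto simp: \<gamma>'_def)
  define \<epsilon> where "\<epsilon> = (\<gamma>' - \<gamma>) / 3"
  have \<epsilon>: "\<epsilon> > 0" "\<gamma> + 3 * \<epsilon> \<le> \<gamma>'" using \<gamma>'(1) by (auto simp: \<epsilon>_def field_simps)
  have "\<not> small \<gamma>' (Z \<omega> ` A)"
    using s(1) \<gamma>0 \<gamma>' by (intro packing_measure_infinite_not_small) auto
  then have "\<not> small \<gamma>' (\<Union>p. Z \<omega> ` B p)" by (simp add: A image_UN)
  then obtain p where p: "\<not> small \<gamma>' (Z \<omega> ` B p)" using small_UN[of \<gamma>' "\<lambda>p. Z \<omega> ` B p"] by blast
  obtain F and a :: "(nat \<Rightarrow> nat) \<Rightarrow> 'a" where F: "closed F" "continuous_on F a" "a ` F = B p" "continuous_on F (\<lambda>x. Z \<omega> (a x))"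
    using par by blast
  have "\<not> small \<gamma>' (Z \<omega> ` a ` F)" using p F(3) by simp
  then obtain \<mu> K where \<mu>: "prob_space \<mu>" "sets \<mu> = sets borel" and K: "compact K" "K \<subseteq> a ` F"
    "emeasure \<mu> (space \<mu> - K) = 0" "bounded (Z \<omega> ` K)" and mass:
    "\<And>t k. t \<in> K \<Longrightarrow> \<exists>n\<ge>k. emeasure \<mu> {s. dist (Z \<omega> s) (Z \<omega> t) \<le> (1/2)^(n+3)} \<le> ennreal (2 powr - (real n * \<gamma>'))"
    by (rule packing_frostman[OF F(1,2,4) _ section_measurable[OF Z \<omega>]]) (rule that)
  have KB: "K \<subseteq> B p" using K(2) F(3) by simp
  then have KS: "K \<subseteq> S p" using S by blast
  obtain R where R: "\<And>t. t \<in> K \<Longrightarrow> norm (Z \<omega> t) \<le> R" using K(4) by (auto simp: bounded_iff)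
  obtain C where C: "C \<ge> 0" "\<forall>\<^sub>F n in sequentially. \<forall>t\<in>S p. \<forall>s\<in>S p. norm (Z \<omega> t) \<le> R \<longrightarrow> norm (Z \<omega> s) \<le> R \<longrightarrow>
      measure M {\<omega>'\<in>space M. dist (Z \<omega>' s) (Z \<omega>' t) \<le> (1/2)^n} \<le> C * 2 powr (real n * \<epsilon>) * kern n (Z \<omega> t) (Z \<omega> s)"
    by (rule kernel_dominatedD[OF ker[of p] \<epsilon>(1)])
  from C(2) have "\<forall>\<^sub>F n in sequentially. \<forall>t\<in>K. \<forall>s\<in>K.
      measure M {\<omega>'\<in>space M. dist (Z \<omega>' s) (Z \<omega>' t) \<le> (1/2)^n} \<le> C * 2 powr (real n * \<epsilon>) * kern n (Z \<omega> t) (Z \<omega> s)"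
    by eventually_elim (use KS R in blast)
  from frostman_measure_dim[OF M Z \<omega> \<gamma>0 \<epsilon>(2,1) \<mu> K(1,3,4) mass C(1) this]
  have "ereal \<gamma> \<le> dimPZ_measure M Z \<mu>" .
  also have "\<dots> \<le> dimPZ M Z A"
  proof -
    have "\<mu> \<in> Pc A" unfolding Pc_def using \<mu> K KB A by blast
    then show ?thesis unfolding dimPZ_def by (intro Sup_upper) auto
  qed
  finally show False using \<gamma>(1) by simp
qed

section \<open>Gaussian estimates\<close>

lemma centered_gaussian_rv_measurable: "centered_gaussian_rv M V \<Longrightarrow> V \<in> borel_measurable M"
  by (simp add: centered_gaussian_rv_def)

text \<open>The existential \<sigma> is replaced by the L2 norm, so that the estimates can be
  phrased with the canonical metric; the degenerate case stays separate.\<close>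

lemma centered_gaussian_rv_cases:
  assumes "prob_space M" "centered_gaussian_rv M V"
  obtains "sqrt (integral\<^sup>L M (\<lambda>\<omega>. (V \<omega>)\<^sup>2)) = 0" "AE \<omega> in M. V \<omega> = 0"
  | "sqrt (integral\<^sup>L M (\<lambda>\<omega>. (V \<omega>)\<^sup>2)) > 0"
    "distributed M lborel V (normal_density 0 (sqrt (integral\<^sup>L M (\<lambda>\<omega>. (V \<omega>)\<^sup>2))))"
proof -
  interpret prob_space M by fact
  from assms(2) consider "AE \<omega> in M. V \<omega> = 0" | \<sigma> where "\<sigma> > 0" "distributed M lborel V (normal_density 0 \<sigma>)"
    unfolding centered_gaussian_rv_def by auto
  then show thesis
  proof cases
    case 1
    have "integral\<^sup>L M (\<lambda>\<omega>. (V \<omega>)\<^sup>2) = integral\<^sup>L M (\<lambda>\<omega>. 0)"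
      using 1 centered_gaussian_rv_measurable[OF assms(2)]
      by (intro integral_cong_AE) (auto elim: eventually_mono)
    then show thesis using that(1) 1 by simp
  next
    case 2
    have "integral\<^sup>L M (\<lambda>\<omega>. (V \<omega>)\<^sup>2) = \<sigma>\<^sup>2"
      using normal_distributed_variance[OF 2] normal_distributed_expectation[OF 2] by simp
    then show thesis using that(2) 2 by simp
  qed
qed

lemma centered_gaussian_rv_square_integrable:
  assumes "prob_space M" "centered_gaussian_rv M V"
  shows "integrable M (\<lambda>\<omega>. (V \<omega>)\<^sup>2)"
  using assms
proof (cases rule: centered_gaussian_rv_cases)
  case 1
  have "integrable M (\<lambda>\<omega>. (V \<omega>)\<^sup>2) \<longleftrightarrow> integrable M (\<lambda>\<omega>. 0 :: real)"
    using 1 centered_gaussian_rv_measurable[OF assms(2)]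
    by (intro integrable_cong_AE) (auto elim: eventually_mono)
  then show ?thesis by simp
next
  case 2
  then show ?thesis
    using distributed_integrable[OF 2(2), of "\<lambda>x. x\<^sup>2"] integrable_normal_moment[OF 2(1), of 0 2] by simp
qed

text \<open>Beyond L\<sigma>, half of the exponent x^2 / (2 \<sigma>^2) is at least L^2 / 4. The
  other half belongs to the Gaussian density with standard deviation
  \<open>sqrt 2 * \<sigma>\<close>, whose normalization accounts for the factor
  \<open>sqrt 2\<close>.\<close>

lemma centered_gaussian_rv_tail:
  assumes "prob_space M" "centered_gaussian_rv M V" "L \<ge> 0"
  shows "measure M {\<omega>\<in>space M. \<bar>V \<omega>\<bar> > L * sqrt (integral\<^sup>L M (\<lambda>\<omega>. (V \<omega>)\<^sup>2))} \<le> sqrt 2 * exp (- (L\<^sup>2) / 4)"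
proof -
  interpret prob_space M by fact
  define \<sigma> where "\<sigma> = sqrt (integral\<^sup>L M (\<lambda>\<omega>. (V \<omega>)\<^sup>2))"
  note [measurable] = centered_gaussian_rv_measurable[OF assms(2)]
  have "measure M {\<omega>\<in>space M. \<bar>V \<omega>\<bar> > L * \<sigma>} \<le> sqrt 2 * exp (- (L\<^sup>2) / 4)"
    using assms(1,2)
  proof (cases rule: centered_gaussian_rv_cases)
    case 1
    have "prob {\<omega>\<in>space M. \<bar>V \<omega>\<bar> > L * \<sigma>} = 0"
      using 1(2) by (intro prob_eq_0_AE) (auto simp: \<sigma>_def 1(1) elim: eventually_mono)
    then show ?thesis by simp
  next
    case 2
    then have \<sigma>: "\<sigma> > 0" and D: "distributed M lborel V (normal_density 0 \<sigma>)" by (auto simp: \<sigma>_def)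
    define c where "c = sqrt 2 * exp (- (L\<^sup>2) / 4)"
    have le: "normal_density 0 \<sigma> x \<le> c * normal_density 0 (sqrt 2 * \<sigma>) x" if "\<bar>x\<bar> > L * \<sigma>" for x
    proof -
      from that have "(L * \<sigma>)\<^sup>2 \<le> x\<^sup>2" using \<sigma> assms(3) by (metis abs_ge_zero less_imp_le mult_nonneg_nonneg power2_abs power_mono)
      then have "L\<^sup>2 \<le> x\<^sup>2 / \<sigma>\<^sup>2" using \<sigma> by (simp add: field_simps power_mult_distrib)
      then have "exp (- x\<^sup>2 / (2 * \<sigma>\<^sup>2)) \<le> exp (- (L\<^sup>2) / 4) * exp (- x\<^sup>2 / (4 * \<sigma>\<^sup>2))"
        by (simp flip: exp_add)
      then have "normal_density 0 \<sigma> x \<le> 1 / sqrt (2 * pi * \<sigma>\<^sup>2) * (exp (- (L\<^sup>2) / 4) * exp (- x\<^sup>2 / (4 * \<sigma>\<^sup>2)))"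
        unfolding normal_density_def by (intro mult_left_mono) auto
      also have "1 / sqrt (2 * pi * \<sigma>\<^sup>2) = sqrt 2 / sqrt (2 * pi * (sqrt 2 * \<sigma>)\<^sup>2)"
      proof -
        have "2 * pi * (sqrt 2 * \<sigma>)\<^sup>2 = 2 * (2 * pi * \<sigma>\<^sup>2)" by (simp add: power_mult_distrib)
        then have "sqrt (2 * pi * (sqrt 2 * \<sigma>)\<^sup>2) = sqrt 2 * sqrt (2 * pi * \<sigma>\<^sup>2)" by (simp only: real_sqrt_mult)
        then show ?thesis by simp
      qed
      also have "sqrt 2 / sqrt (2 * pi * (sqrt 2 * \<sigma>)\<^sup>2) * (exp (- (L\<^sup>2) / 4) * exp (- x\<^sup>2 / (4 * \<sigma>\<^sup>2)))
          = c * normal_density 0 (sqrt 2 * \<sigma>) x"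
        by (simp add: normal_density_def c_def power_mult_distrib)
      finally show ?thesis .
    qed
    have "emeasure M {\<omega>\<in>space M. \<bar>V \<omega>\<bar> > L * \<sigma>} = emeasure M (V -` {x. \<bar>x\<bar> > L * \<sigma>} \<inter> space M)"
      by (intro arg_cong[where f="emeasure M"]) auto
    also have "\<dots> = (\<integral>\<^sup>+x. ennreal (normal_density 0 \<sigma> x) * indicator {x. \<bar>x\<bar> > L * \<sigma>} x \<partial>lborel)"
      by (rule distributed_emeasure[OF D]) measurable
    also have "\<dots> \<le> (\<integral>\<^sup>+x. ennreal (c * normal_density 0 (sqrt 2 * \<sigma>) x) \<partial>lborel)"
      using le by (intro nn_integral_mono) (auto simp: indicator_def intro!: ennreal_leI split: if_splits)
    also have "\<dots> = ennreal (\<integral>x. c * normal_density 0 (sqrt 2 * \<sigma>) x \<partial>lborel)"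
      using \<sigma> by (intro nn_integral_eq_integral) (auto simp: c_def)
    also have "\<dots> = ennreal c" using \<sigma> by simp
    finally show ?thesis unfolding c_def emeasure_eq_measure by (simp add: ennreal_le_iff)
  qed
  then show ?thesis by (simp add: \<sigma>_def)
qed

text \<open>The density is at most 1 / (2 \<sigma>), because 2 pi \<ge> 4, and the interval has
  length 2r whatever the shift.\<close>

lemma centered_gaussian_rv_small_ball:
  assumes "prob_space M" "centered_gaussian_rv M V" "r \<ge> 0" and pos: "sqrt (integral\<^sup>L M (\<lambda>\<omega>. (V \<omega>)\<^sup>2)) > 0"
  shows "measure M {\<omega>\<in>space M. \<bar>V \<omega> + a\<bar> \<le> r} \<le> r / sqrt (integral\<^sup>L M (\<lambda>\<omega>. (V \<omega>)\<^sup>2))"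
proof -
  interpret prob_space M by fact
  define \<sigma> where "\<sigma> = sqrt (integral\<^sup>L M (\<lambda>\<omega>. (V \<omega>)\<^sup>2))"
  have \<sigma>: "\<sigma> > 0" using pos by (simp add: \<sigma>_def)
  have D: "distributed M lborel V (normal_density 0 \<sigma>)"
    using assms(1,2) pos unfolding \<sigma>_def by (cases rule: centered_gaussian_rv_cases) auto
  have le: "normal_density 0 \<sigma> x \<le> 1 / (2 * \<sigma>)" for x
  proof -
    have "2 * \<sigma> = sqrt (4 * \<sigma>\<^sup>2)" using \<sigma> by (simp add: real_sqrt_mult)
    also have "\<dots> \<le> sqrt (2 * pi * \<sigma>\<^sup>2)" using pi_gt3 by (intro real_sqrt_le_mono mult_right_mono) auto
    finally have "1 / sqrt (2 * pi * \<sigma>\<^sup>2) \<le> 1 / (2 * \<sigma>)" using \<sigma> by (intro divide_left_mono) auto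
    moreover have "exp (- x\<^sup>2 / (2 * \<sigma>\<^sup>2)) \<le> 1" by simp
    ultimately have "1 / sqrt (2 * pi * \<sigma>\<^sup>2) * exp (- x\<^sup>2 / (2 * \<sigma>\<^sup>2)) \<le> 1 / (2 * \<sigma>) * 1"
      using \<sigma> by (intro mult_mono) auto
    then show ?thesis by (simp add: normal_density_def)
  qed
  have "emeasure M {\<omega>\<in>space M. \<bar>V \<omega> + a\<bar> \<le> r} = emeasure M (V -` {- a - r .. - a + r} \<inter> space M)"
    by (intro arg_cong[where f="emeasure M"]) auto
  also have "\<dots> = (\<integral>\<^sup>+x. ennreal (normal_density 0 \<sigma> x) * indicator {- a - r .. - a + r} x \<partial>lborel)"
    by (rule distributed_emeasure[OF D]) simp
  also have "\<dots> \<le> (\<integral>\<^sup>+x. ennreal (1 / (2 * \<sigma>)) * indicator {- a - r .. - a + r} x \<partial>lborel)"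
    using le by (intro nn_integral_mono mult_right_mono ennreal_leI) auto
  also have "\<dots> = ennreal (1 / (2 * \<sigma>)) * ennreal (2 * r)"
    using assms(3) by (subst nn_integral_cmult_indicator) auto
  also have "\<dots> = ennreal (r / \<sigma>)" using \<sigma> assms(3) by (simp add: ennreal_mult[symmetric])
  finally show ?thesis unfolding \<sigma>_def[symmetric] emeasure_eq_measure
    using \<sigma> assms(3) by (simp add: ennreal_le_iff)
qed

text \<open>Here \<open>u\<close> is an increment of a fixed sample path with drift and \<open>a\<close> the increment of the drift.
  Either \<open>u\<close> is comparable to \<open>r\<close> or to \<open>L\<close> standard deviations, or the drift dominates and the event
  is a large deviation.\<close>

lemma gaussian_shifted_small_ball:
  assumes M: "prob_space M" and V: "centered_gaussian_rv M V"
    and C: "C \<ge> 1" and L: "L \<ge> 1" and r: "r > 0"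
    and u: "\<bar>u - a\<bar> \<le> 2 * L * sqrt (integral\<^sup>L M (\<lambda>\<omega>. (V \<omega>)\<^sup>2)) + C * r"
  shows "measure M {\<omega>\<in>space M. \<bar>V \<omega> + a\<bar> \<le> r} * \<bar>u\<bar> \<le> 8 * C * L * r + sqrt 2 * exp (- (L\<^sup>2) / 4) * \<bar>u\<bar>"
proof -
  interpret prob_space M by fact
  note [measurable] = centered_gaussian_rv_measurable[OF V]
  define \<sigma> where "\<sigma> = sqrt (integral\<^sup>L M (\<lambda>\<omega>. (V \<omega>)\<^sup>2))"
  define p where "p = measure M {\<omega>\<in>space M. \<bar>V \<omega> + a\<bar> \<le> r}"
  have p: "0 \<le> p" "p \<le> 1" by (auto simp: p_def)
  have \<sigma>0: "\<sigma> \<ge> 0" by (simp add: \<sigma>_def)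
  have CLr: "C * r \<le> C * L * r" using C L r by (simp add: mult_right_mono mult_left_mono)
  have Lr: "L * r \<le> C * L * r" using C L r by (simp add: mult_right_mono mult_left_mono)
  have CLr0: "0 \<le> C * L * r" using C L r by simp
  \<comment> \<open>In the third case the thresholds make C r and 2 L \<sigma> each less than |u| /
    4. So |a| \<ge> |u| / 2, and the event requires |V| > 2 L \<sigma>.\<close>
  consider "\<bar>u\<bar> \<le> 4 * C * r" | "\<bar>u\<bar> > 4 * C * r" "8 * L * \<sigma> \<ge> \<bar>u\<bar>" | "\<bar>u\<bar> > 4 * C * r" "8 * L * \<sigma> < \<bar>u\<bar>" by linarith
  then have "p * \<bar>u\<bar> \<le> 8 * C * L * r + sqrt 2 * exp (- (L\<^sup>2) / 4) * \<bar>u\<bar>"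
  proof cases
    case 1
    have "p * \<bar>u\<bar> \<le> 1 * \<bar>u\<bar>" using p by (intro mult_right_mono) auto
    also have "\<dots> \<le> 8 * C * L * r" using 1 CLr CLr0 by linarith
    finally show ?thesis by (simp add: add_increasing2)
  next
    case 2
    have Cr: "0 < 4 * C * r" using C r by simp
    have "\<sigma> > 0"
    proof (rule ccontr)
      assume "\<not> \<sigma> > 0"
      then have "\<sigma> = 0" using \<sigma>0 by simp
      then show False using 2 Cr by simp
    qed
    then have "p \<le> r / \<sigma>" unfolding p_def \<sigma>_def using r by (intro centered_gaussian_rv_small_ball[OF M V]) auto
    then have "p * \<bar>u\<bar> \<le> r / \<sigma> * (8 * L * \<sigma>)" using 2 r \<open>\<sigma> > 0\<close> by (intro mult_mono) auto
    also have "\<dots> = 8 * (L * r)" using \<open>\<sigma> > 0\<close> by simp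
    also have "\<dots> \<le> 8 * (C * L * r)" using Lr by simp
    finally show ?thesis by (simp add: add_increasing2 mult.assoc)
  next
    case 3
    have Cr: "r \<le> C * r" using C r by simp
    have "\<bar>u - a\<bar> \<le> 2 * L * \<sigma> + C * r" using u by (simp add: \<sigma>_def)
    then have a: "\<bar>a\<bar> \<ge> \<bar>u\<bar> / 2" using 3 by linarith
    have "p \<le> measure M {\<omega>\<in>space M. \<bar>V \<omega>\<bar> > L * \<sigma>}"
      unfolding p_def
    proof (rule finite_measure_mono)
      show "{\<omega>\<in>space M. \<bar>V \<omega> + a\<bar> \<le> r} \<subseteq> {\<omega>\<in>space M. \<bar>V \<omega>\<bar> > L * \<sigma>}"
      proof safe
        fix \<omega> assume "\<bar>V \<omega> + a\<bar> \<le> r"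
        then have "\<bar>V \<omega>\<bar> \<ge> \<bar>u\<bar> / 2 - r" using a by linarith
        then have "\<bar>V \<omega>\<bar> > 2 * (L * \<sigma>)" using 3 Cr by linarith
        moreover have "L * \<sigma> \<ge> 0" using L \<sigma>0 by simp
        ultimately show "L * \<sigma> < \<bar>V \<omega>\<bar>" by linarith
      qed
    qed measurable
    also have "\<dots> \<le> sqrt 2 * exp (- (L\<^sup>2) / 4)"
      unfolding \<sigma>_def using L by (intro centered_gaussian_rv_tail[OF M V]) auto
    finally have "p * \<bar>u\<bar> \<le> sqrt 2 * exp (- (L\<^sup>2) / 4) * \<bar>u\<bar>" by (rule mult_right_mono) simp
    then show ?thesis using CLr0 by linarith
  qed
  then show ?thesis by (simp add: p_def)
qed

text \<open>At L = 2^(n\<epsilon>) the tail is exponentially small in 2^(2n\<epsilon>); the single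
  term x^d / d! of the exponential series, with 2 \<epsilon> d \<ge> 1, is enough to beat
  2^n.\<close>

lemma gaussian_tail_le_dyadic:
  fixes \<epsilon> :: real
  assumes "\<epsilon> > 0"
  obtains C where "C \<ge> 0" "\<And>n. sqrt 2 * exp (- ((2 powr (real n * \<epsilon>))\<^sup>2) / 4) \<le> C * (1/2)^n"
proof -
  obtain d :: nat where d: "1 / (2 * \<epsilon>) \<le> real d" using real_arch_simple by blast
  then have d': "1 \<le> 2 * \<epsilon> * real d" using assms by (simp add: field_simps)
  show thesis
  proof (rule that[of "sqrt 2 * fact d * 4 ^ d"])
    fix n
    define x where "x = (2 powr (real n * \<epsilon>))\<^sup>2 / 4"
    have x: "x > 0" by (simp add: x_def)
    have "x ^ d \<le> fact d * exp x" using x by (intro power_le_fact_exp) simp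
    then have "exp (- x) * x ^ d \<le> fact d" by (simp add: exp_minus field_simps)
    moreover have "2 ^ n / 4 ^ d \<le> x ^ d"
    proof -
      have "(2::real) ^ n = 2 powr (real n * 1)" by (simp add: powr_realpow)
      also have "\<dots> \<le> 2 powr (real n * (2 * \<epsilon> * real d))" using d' by (intro powr_mono mult_left_mono) auto
      also have "\<dots> = ((2 powr (real n * \<epsilon>))\<^sup>2) ^ d"
        by (simp add: powr_powr mult.commute mult.left_commute flip: powr_realpow power_mult)
      finally show ?thesis by (simp add: x_def power_divide divide_right_mono)
    qed
    then have "exp (- x) * (2 ^ n / 4 ^ d) \<le> exp (- x) * x ^ d" by (intro mult_left_mono) auto
    ultimately have "exp (- x) * (2 ^ n / 4 ^ d) \<le> fact d" by linarith
    then have "exp (- x) \<le> fact d * 4 ^ d * (1/2)^n" by (simp add: field_simps power_one_over)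
    then have "sqrt 2 * exp (- x) \<le> sqrt 2 * (fact d * 4 ^ d * (1/2)^n)" by (intro mult_left_mono) auto
    then show "sqrt 2 * exp (- ((2 powr (real n * \<epsilon>))\<^sup>2) / 4) \<le> sqrt 2 * fact d * 4 ^ d * (1/2)^n"
      by (simp add: x_def mult.assoc)
  qed simp
qed

lemma centered_gaussian_field_point:
  assumes "centered_gaussian_field M Y"
  shows "centered_gaussian_rv M (\<lambda>\<omega>. Y \<omega> t)"
  using assms[unfolded centered_gaussian_field_def, rule_format, of "{t}" "\<lambda>_. 1"] by simp

lemma centered_gaussian_field_diff:
  assumes "centered_gaussian_field M Y"
  shows "centered_gaussian_rv M (\<lambda>\<omega>. Y \<omega> t - Y \<omega> s)"
proof (cases "t = s")
  case True
  then show ?thesis by (simp add: centered_gaussian_rv_def)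
next
  case False
  then show ?thesis
    using assms[unfolded centered_gaussian_field_def, rule_format, of "{t, s}" "\<lambda>x. if x = t then 1 else - 1"] by simp
qed

section \<open>Uniform modulus of continuity\<close>

text \<open>One point of \<open>B\<close> is picked in every cell that meets \<open>B\<close>: the
  net has to lie inside \<open>B\<close>, where the modulus of the canonical metric is known. The
  shift by \<open>DIM('a)\<close> in \<open>m\<close> compensates for the diameter of a
  cell.\<close>

lemma bounded_finite_net:
  fixes B :: "'a::euclidean_space set"
  assumes "bounded B"
  obtains a :: nat and D where "\<And>k. finite (D k)" "\<And>k. D k \<subseteq> B" "\<And>k. card (D k) \<le> 2 ^ ((a + k) * DIM('a))"
    "\<And>k t. t \<in> B \<Longrightarrow> \<exists>t'\<in>D k. dist t t' \<le> (1/2)^k"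
proof -
  obtain R where R: "\<And>y. y \<in> B \<Longrightarrow> norm y \<le> R" using assms bounded_iff by blast
  obtain a0 :: nat where "R < 2 ^ a0" using real_arch_pow[of 2 R] by auto
  then have a0: "\<bar>y \<bullet> b\<bar> \<le> 2 ^ a0" if "y \<in> B" "b \<in> Basis" for y b
    using R[OF that(1)] Basis_le_norm[OF that(2), of y] by linarith
  define m where "m k = k + DIM('a)" for k
  define D where "D k = (\<lambda>i. SOME t. t \<in> B \<and> cell (m k) t = i) ` (cell (m k) ` B)" for k
  have sub: "cell (m k) ` B \<subseteq> cell_box (a0 + m k)" for k using a0 by (auto intro!: cell_in_cell_box)
  have fin: "finite (cell (m k) ` B)" for k using finite_subset[OF sub finite_cell_box] .
  have some: "(SOME t. t \<in> B \<and> cell n t = cell n y) \<in> B \<and> cell n (SOME t. t \<in> B \<and> cell n t = cell n y) = cell n y"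
    if "y \<in> B" for y n
    by (rule someI[of "\<lambda>t. t \<in> B \<and> cell n t = cell n y" y]) (use that in auto)
  show thesis
  proof (rule that[of D "a0 + DIM('a) + 2"])
    fix k
    show "finite (D k)" unfolding D_def using fin by simp
    show "D k \<subseteq> B" unfolding D_def using some by auto
    have "card (D k) \<le> card (cell_box (a0 + m k) :: ('a \<Rightarrow> int) set)"
      unfolding D_def using card_image_le[OF fin] card_mono[OF finite_cell_box sub] order_trans by blast
    also have "\<dots> = nat (2 * 2 ^ (a0 + m k) + 1) ^ DIM('a)"
      unfolding cell_box_def by (subst card_PiE) (auto simp: prod_constant algebra_simps)
    also have "\<dots> \<le> (2 ^ (a0 + m k + 2)) ^ DIM('a)"
    proof (intro power_mono)
      have "(2::int) * 2 ^ (a0 + m k) + 1 \<le> 2 ^ (a0 + m k + 2)"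
      proof -
        have "(2::int) ^ (a0 + m k + 2) = 4 * 2 ^ (a0 + m k)" by simp
        moreover have "(1::int) \<le> 2 ^ (a0 + m k)" by simp
        ultimately show ?thesis by linarith
      qed
      then show "nat (2 * 2 ^ (a0 + m k) + 1) \<le> 2 ^ (a0 + m k + 2)"
        by (simp add: nat_le_iff)
    qed simp
    also have "\<dots> = 2 ^ ((a0 + m k + 2) * DIM('a))" by (rule power_mult[symmetric])
    also have "a0 + m k + 2 = a0 + DIM('a) + 2 + k" by (simp add: m_def)
    finally show "card (D k) \<le> 2 ^ ((a0 + DIM('a) + 2 + k) * DIM('a))" .
    fix t assume t: "t \<in> B"
    define t' where "t' = (SOME x. x \<in> B \<and> cell (m k) x = cell (m k) t)"
    have "t' \<in> D k" unfolding D_def t'_def using t by auto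
    moreover have "dist t t' \<le> (1/2)^k"
    proof -
      have "dist t t' \<le> real DIM('a) * (1/2)^(m k)"
        using some[OF t, of "m k"] by (intro cell_eq_dist) (simp add: t'_def)
      also have "\<dots> = (real DIM('a) * (1/2)^DIM('a)) * (1/2)^k" by (simp add: m_def power_add)
      also have "\<dots> \<le> 1 * (1/2)^k"
      proof (intro mult_right_mono)
        have "real DIM('a) < 2 ^ DIM('a)" by (rule of_nat_less_two_power)
        then show "real DIM('a) * (1/2)^DIM('a) \<le> 1" by (simp add: power_one_over field_simps)
      qed simp
      finally show ?thesis by simp
    qed
    ultimately show "\<exists>t'\<in>D k. dist t t' \<le> (1/2)^k" by blast
  qed
qed

text \<open>Expanding (x/2 - (\<beta>+1))^2 \<ge> 0 gives \<beta> x - x^2/4 \<le> (\<beta>+1)^2 - x,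
  and exp (-x) \<le> 1/x turns this into a geometric bound at x = 2^(n\<epsilon>).\<close>

lemma summable_superexponential:
  fixes \<epsilon> \<alpha> \<beta> :: real
  assumes "\<epsilon> > 0"
  shows "summable (\<lambda>n. exp (\<alpha> + \<beta> * 2 powr (real n * \<epsilon>)) * (sqrt 2 * exp (- ((2 powr (real n * \<epsilon>))\<^sup>2) / 4)))"
proof (rule summable_comparison_test')
  define q where "q = 2 powr - \<epsilon>"
  have q: "0 < q" "q < 1" using powr_less_mono[of "- \<epsilon>" 0 2] assms by (auto simp: q_def)
  show "summable (\<lambda>n. sqrt 2 * exp (\<alpha> + (\<beta> + 1)\<^sup>2) * q ^ n)" using q by (intro summable_mult summable_geometric) auto
  fix n :: nat assume "0 \<le> n"
  define x where "x = 2 powr (real n * \<epsilon>)"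
  have x: "x > 0" by (simp add: x_def)
  have "(x / 2 - (\<beta> + 1))\<^sup>2 \<ge> 0" by simp
  then have "\<alpha> + \<beta> * x + - (x\<^sup>2) / 4 \<le> \<alpha> + (\<beta> + 1)\<^sup>2 + - x"
    by (simp add: power2_eq_square algebra_simps)
  then have "exp (\<alpha> + \<beta> * x) * exp (- (x\<^sup>2) / 4) \<le> exp (\<alpha> + (\<beta> + 1)\<^sup>2) * exp (- x)"
    by (simp only: exp_add[symmetric] exp_le_cancel_iff)
  also have "exp (- x) \<le> 1 / x"
  proof -
    have "x \<le> exp x" using exp_ge_add_one_self[of x] by linarith
    then have "1 / exp x \<le> 1 / x" using x by (intro divide_left_mono) auto
    then show ?thesis by (simp add: exp_minus divide_inverse)
  qed
  also have "1 / x = q ^ n"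
    by (simp add: x_def q_def powr_minus_divide power_one_over powr_powr mult.commute power_divide flip: powr_realpow)
  finally have "exp (\<alpha> + \<beta> * x) * exp (- (x\<^sup>2) / 4) \<le> exp (\<alpha> + (\<beta> + 1)\<^sup>2) * q ^ n" by simp
  then have "sqrt 2 * (exp (\<alpha> + \<beta> * x) * exp (- (x\<^sup>2) / 4)) \<le> sqrt 2 * (exp (\<alpha> + (\<beta> + 1)\<^sup>2) * q ^ n)"
    by (intro mult_left_mono) auto
  then show "norm (exp (\<alpha> + \<beta> * 2 powr (real n * \<epsilon>)) * (sqrt 2 * exp (- ((2 powr (real n * \<epsilon>))\<^sup>2) / 4)))
      \<le> sqrt 2 * exp (\<alpha> + (\<beta> + 1)\<^sup>2) * q ^ n"
    by (simp add: x_def abs_mult mult_ac)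
qed

text \<open>Squaring and (a + b + c)^2 \<le> 3 (a^2 + b^2 + c^2) take the place of Minkowski's
  inequality; the constant 2 exceeds sqrt 3.\<close>

lemma gaussian_increment_quasi_triangle:
  assumes M: "prob_space M" and G: "centered_gaussian_field M Y"
  defines "\<rho> \<equiv> \<lambda>t s. sqrt (integral\<^sup>L M (\<lambda>\<omega>. (Y \<omega> t - Y \<omega> s)\<^sup>2))"
  shows "\<rho> t' s' \<le> 2 * (\<rho> t s + \<rho> t t' + \<rho> s s')"
proof -
  have int: "integrable M (\<lambda>\<omega>. (Y \<omega> t - Y \<omega> s)\<^sup>2)" for t s
    by (rule centered_gaussian_rv_square_integrable[OF M centered_gaussian_field_diff[OF G]])
  define e where "e t s = integral\<^sup>L M (\<lambda>\<omega>. (Y \<omega> t - Y \<omega> s)\<^sup>2)" for t s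
  have e0: "e t s \<ge> 0" for t s unfolding e_def by simp
  have sq: "(\<rho> t s)\<^sup>2 = e t s" for t s using e0[of t s] by (simp add: \<rho>_def e_def)
  have \<rho>0: "\<rho> t s \<ge> 0" for t s using e0[of t s] by (simp add: \<rho>_def e_def)
  have ineq: "(a + b + c)\<^sup>2 \<le> 3 * (a\<^sup>2 + b\<^sup>2 + c\<^sup>2)" for a b c :: real
  proof -
    have "0 \<le> (a - b)\<^sup>2 + (b - c)\<^sup>2 + (a - c)\<^sup>2" by simp
    then show ?thesis by (simp add: power2_eq_square algebra_simps)
  qed
  have "e t' s' \<le> integral\<^sup>L M (\<lambda>\<omega>. 3 * ((Y \<omega> t - Y \<omega> s)\<^sup>2 + (Y \<omega> t - Y \<omega> t')\<^sup>2 + (Y \<omega> s - Y \<omega> s')\<^sup>2))"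
    unfolding e_def
  proof (intro integral_mono int integrable_mult_right Bochner_Integration.integrable_add)
    fix \<omega>
    show "(Y \<omega> t' - Y \<omega> s')\<^sup>2 \<le> 3 * ((Y \<omega> t - Y \<omega> s)\<^sup>2 + (Y \<omega> t - Y \<omega> t')\<^sup>2 + (Y \<omega> s - Y \<omega> s')\<^sup>2)"
      using ineq[of "Y \<omega> t - Y \<omega> s" "Y \<omega> t' - Y \<omega> t" "Y \<omega> s - Y \<omega> s'"] by (simp add: power2_commute)
  qed
  also have "\<dots> = 3 * (e t s + e t t' + e s s')"
    unfolding e_def by (simp add: int)
  finally have "(\<rho> t' s')\<^sup>2 \<le> 3 * ((\<rho> t s)\<^sup>2 + (\<rho> t t')\<^sup>2 + (\<rho> s s')\<^sup>2)" by (simp add: sq)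
  also have "\<dots> \<le> (2 * (\<rho> t s + \<rho> t t' + \<rho> s s'))\<^sup>2"
    using mult_nonneg_nonneg[OF \<rho>0 \<rho>0, of t s t t'] mult_nonneg_nonneg[OF \<rho>0 \<rho>0, of t s s s']
      mult_nonneg_nonneg[OF \<rho>0 \<rho>0, of t t' s s']
      zero_le_power2[of "\<rho> t s"] zero_le_power2[of "\<rho> t t'"] zero_le_power2[of "\<rho> s s'"]
    unfolding power2_eq_square by (simp add: algebra_simps)
  finally show ?thesis using \<rho>0 by (meson add_nonneg_nonneg mult_nonneg_nonneg power2_le_imp_le zero_le_numeral)
qed

text \<open>Chaining with nets of mesh about 2^-p(n), where p(n) is 2^(n\<epsilon>) rounded up. By
  regularity, increments at this mesh have standard deviation at most c 4^-n, and the union bound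
  over pairs of net points costs exp (\<alpha> + \<beta> 2^(n\<epsilon>)), which the tail beats.
  Almost surely, from some level on, each increment between points of neighbouring nets is at most
  2^(n\<epsilon>) standard deviations, and c 2^(n\<epsilon>) 4^-n \<le> c 2^-n is summable along a
  chain.\<close>

lemma gaussian_modulus:
  fixes Y :: "'w \<Rightarrow> 'a::euclidean_space \<Rightarrow> real"
  assumes M: "prob_space M" and G: "centered_gaussian_field M Y"
    and cont: "\<And>\<omega>. \<omega> \<in> space M \<Longrightarrow> continuous_on UNIV (Y \<omega>)"
    and B: "bounded B" and \<epsilon>: "0 < \<epsilon>" "\<epsilon> \<le> 1"
  defines "\<rho> \<equiv> \<lambda>t s. sqrt (integral\<^sup>L M (\<lambda>\<omega>. (Y \<omega> t - Y \<omega> s)\<^sup>2))"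
  assumes reg: "\<And>N::nat. \<exists>c>0. \<forall>m\<ge>1. \<forall>t\<in>B. \<forall>s\<in>B. dist t s \<le> (1/2)^m \<longrightarrow> \<rho> t s \<le> c / real m ^ N"
  obtains C where "C \<ge> 1" "AE \<omega> in M. \<forall>\<^sub>F n in sequentially. \<forall>t\<in>B. \<forall>s\<in>B.
    \<bar>Y \<omega> t - Y \<omega> s\<bar> \<le> 2 * 2 powr (real n * \<epsilon>) * \<rho> t s + C * (1/2)^n"
proof -
  interpret prob_space M by fact
  have \<rho>0: "\<rho> t s \<ge> 0" for t s by (simp add: \<rho>_def)
  have meas[measurable]: "(\<lambda>\<omega>. Y \<omega> t) \<in> borel_measurable M" for t
    by (rule centered_gaussian_rv_measurable[OF centered_gaussian_field_point[OF G]])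
  define x where "x n = 2 powr (real n * \<epsilon>)" for n
  define p where "p n = nat \<lceil>x n\<rceil>" for n
  have x1: "x n \<ge> 1" for n unfolding x_def using \<epsilon> by (simp add: ge_one_powr_ge_zero)
  have x_mono: "x n \<le> x (Suc n)" for n unfolding x_def using \<epsilon> by (intro powr_mono) (auto simp: mult_right_mono)
  have x_Suc: "x (Suc n) \<le> 2 * x n" for n
  proof -
    have "x (Suc n) = 2 powr \<epsilon> * x n" by (simp add: x_def algebra_simps flip: powr_add)
    also have "\<dots> \<le> 2 * x n" using \<epsilon> x1[of n] powr_mono[of \<epsilon> 1 2] by (intro mult_right_mono) auto
    finally show ?thesis .
  qed
  have x_le: "x n \<le> 2 ^ n" for n
  proof -
    have "x n \<le> 2 powr (real n * 1)" unfolding x_def using \<epsilon> by (intro powr_mono mult_left_mono) auto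
    then show ?thesis by (simp add: powr_realpow)
  qed
  have p_ge: "x n \<le> real (p n)" for n using x1[of n] unfolding p_def by linarith
  have p_le: "real (p n) \<le> x n + 1" for n using x1[of n] unfolding p_def by linarith
  have p1: "p n \<ge> 1" for n using p_ge[of n] x1[of n] by simp
  have p_mono: "p n \<le> p (Suc n)" for n unfolding p_def using x_mono[of n] by (intro nat_mono ceiling_mono)
  \<comment> \<open>The choice N \<epsilon> \<ge> 2 makes the N-th power of 2^(n\<epsilon>) at least
    4^n.\<close>
  obtain N :: nat where N: "2 / \<epsilon> \<le> real N" using real_arch_simple by blast
  then have N': "2 \<le> \<epsilon> * real N" using \<epsilon> by (simp add: field_simps)
  obtain c where c: "c > 0" and reg': "\<And>m t s. m \<ge> 1 \<Longrightarrow> t \<in> B \<Longrightarrow> s \<in> B \<Longrightarrow> dist t s \<le> (1/2)^m \<Longrightarrow> \<rho> t s \<le> c / real m ^ N"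
    using reg[of N] by blast
  have \<rho>_small: "\<rho> t s \<le> c * (1/4)^n" if "t \<in> B" "s \<in> B" "dist t s \<le> (1/2)^(p n)" for t s n
  proof -
    have "\<rho> t s \<le> c / real (p n) ^ N" using reg'[OF p1 that] .
    also have "\<dots> \<le> c / 4 ^ n"
    proof (intro divide_left_mono)
      have "(4::real) ^ n = 2 ^ (2 * n)" by (simp add: power_mult)
      also have "\<dots> = 2 powr real (2 * n)" by (rule powr_realpow[symmetric]) simp
      also have "\<dots> = 2 powr (real n * 2)" by (simp add: mult.commute)
      also have "\<dots> \<le> 2 powr (real n * (\<epsilon> * real N))" using N' by (intro powr_mono mult_left_mono) auto
      also have "\<dots> = x n ^ N" by (simp add: x_def powr_powr mult.assoc flip: powr_realpow)
      also have "\<dots> \<le> real (p n) ^ N" using p_ge[of n] x1[of n] by (intro power_mono) auto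
      finally show "(4::real) ^ n \<le> real (p n) ^ N" .
    qed (use c p1[of n] in auto)
    finally show ?thesis by (simp add: power_one_over)
  qed
  obtain a D0 where D0: "\<And>k. finite (D0 k)" "\<And>k. D0 k \<subseteq> B" "\<And>k. card (D0 k) \<le> 2 ^ ((a + k) * DIM('a))"
    "\<And>k t. t \<in> B \<Longrightarrow> \<exists>t'\<in>D0 k. dist t t' \<le> (1/2)^k"
    by (rule bounded_finite_net[OF B]) (rule that)
  \<comment> \<open>One level finer than \<open>p n\<close>, so that the approximations of a point
    at consecutive levels are still within 2^-p(n) of each other.\<close>
  define D where "D n = D0 (p n + 1)" for n
  define DD where "DD n = D n \<union> D (Suc n)" for n
  have finDD: "finite (DD n)" for n by (simp add: DD_def D_def D0(1))
  define d where "d = real DIM('a)"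
  define \<beta> where "\<beta> = 4 * d * ln 2"
  define \<alpha> where "\<alpha> = (2 + 2 * (real a + 2) * d) * ln 2"
  have cardDD: "(real (card (DD n)))\<^sup>2 \<le> exp (\<alpha> + \<beta> * x n)" for n
  proof -
    have "card (DD n) \<le> card (D n) + card (D (Suc n))" unfolding DD_def by (rule card_Un_le)
    also have "\<dots> \<le> 2 ^ ((a + (p n + 1)) * DIM('a)) + 2 ^ ((a + (p (Suc n) + 1)) * DIM('a))"
      unfolding D_def by (intro add_mono D0(3))
    also have "\<dots> \<le> 2 ^ ((a + (p (Suc n) + 1)) * DIM('a)) + 2 ^ ((a + (p (Suc n) + 1)) * DIM('a))"
      using p_mono[of n] by (intro add_mono power_increasing mult_right_mono) auto
    also have "\<dots> = 2 ^ Suc ((a + (p (Suc n) + 1)) * DIM('a))" by simp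
    finally have "real (card (DD n)) \<le> real (2 ^ Suc ((a + (p (Suc n) + 1)) * DIM('a)))" by (rule of_nat_mono)
    also have "\<dots> = 2 powr real (Suc ((a + (p (Suc n) + 1)) * DIM('a)))"
      by (simp only: of_nat_power of_nat_numeral powr_realpow zero_less_numeral)
    also have "real (Suc ((a + (p (Suc n) + 1)) * DIM('a))) = 1 + (real a + real (p (Suc n)) + 1) * d"
      by (simp add: d_def algebra_simps)
    also have "2 powr (1 + (real a + real (p (Suc n)) + 1) * d) \<le> 2 powr (1 + (real a + (2 * x n + 1) + 1) * d)"
      using p_le[of "Suc n"] x_Suc[of n] by (intro powr_mono add_left_mono mult_right_mono) (auto simp: d_def)
    finally have "(real (card (DD n)))\<^sup>2 \<le> (2 powr (1 + (real a + (2 * x n + 1) + 1) * d))\<^sup>2"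
      by (intro power_mono) auto
    also have "\<dots> = exp (\<alpha> + \<beta> * x n)"
      by (simp add: power2_eq_square powr_def \<alpha>_def \<beta>_def algebra_simps flip: exp_add)
    finally show ?thesis .
  qed
  define ev where "ev n u v = {\<omega>\<in>space M. \<bar>Y \<omega> u - Y \<omega> v\<bar> > x n * \<rho> u v}" for n u v
  have evm: "ev n u v \<in> sets M" for n u v unfolding ev_def by measurable
  have evp: "prob (ev n u v) \<le> sqrt 2 * exp (- ((x n)\<^sup>2) / 4)" for n u v
    unfolding ev_def \<rho>_def using x1[of n]
    by (intro centered_gaussian_rv_tail[OF M centered_gaussian_field_diff[OF G]]) simp
  define E where "E n = (\<Union>w\<in>DD n \<times> DD n. ev n (fst w) (snd w))" for n
  have Em: "E n \<in> sets M" for n unfolding E_def using finDD[of n] evm by (intro sets.finite_UN) auto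
  have Ep: "prob (E n) \<le> exp (\<alpha> + \<beta> * x n) * (sqrt 2 * exp (- ((x n)\<^sup>2) / 4))" for n
  proof -
    have "prob (E n) \<le> (\<Sum>w\<in>DD n \<times> DD n. prob (ev n (fst w) (snd w)))"
      unfolding E_def using finDD[of n] evm by (intro finite_measure_subadditive_finite) auto
    also have "\<dots> \<le> (\<Sum>w\<in>DD n \<times> DD n. sqrt 2 * exp (- ((x n)\<^sup>2) / 4))" by (intro sum_mono evp)
    also have "\<dots> = (real (card (DD n)))\<^sup>2 * (sqrt 2 * exp (- ((x n)\<^sup>2) / 4))"
      by (simp add: card_cartesian_product power2_eq_square)
    also have "\<dots> \<le> exp (\<alpha> + \<beta> * x n) * (sqrt 2 * exp (- ((x n)\<^sup>2) / 4))"
      by (intro mult_right_mono cardDD) auto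
    finally show ?thesis .
  qed
  have "summable (\<lambda>n. prob (E n))"
    by (rule summable_comparison_test'[OF summable_superexponential[OF \<epsilon>(1), of \<alpha> \<beta>, folded x_def]]) (use Ep in auto)
  then have AE1: "AE \<omega> in M. \<forall>\<^sub>F n in sequentially. \<omega> \<in> space M - E n"
    using Em by (intro borel_cantelli_AE1) (auto simp: emeasure_eq_measure)
  \<comment> \<open>The estimate yields 8c: 4c from the quasi-triangle inequality and 2c from each
    of two chains. The rest also secures C \<ge> 1.\<close>
  define C where "C = 12 * c + 1"
  have "\<forall>n t. \<exists>t'. t \<in> B \<longrightarrow> t' \<in> D n \<and> dist t t' \<le> (1/2)^(p n + 1)" unfolding D_def using D0(4) by blast
  then obtain \<pi> where \<pi>: "\<And>n t. t \<in> B \<Longrightarrow> \<pi> n t \<in> D n" "\<And>n t. t \<in> B \<Longrightarrow> dist t (\<pi> n t) \<le> (1/2)^(p n + 1)" by metis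
  have DB: "D n \<subseteq> B" for n unfolding D_def by (rule D0(2))
  have \<pi>B: "\<pi> n t \<in> B" if "t \<in> B" for n t using \<pi>(1)[OF that] DB by blast
  have \<pi>1: "\<rho> t (\<pi> n t) \<le> c * (1/4)^n" if t: "t \<in> B" for n t
  proof (rule \<rho>_small[OF t \<pi>B[OF t]])
    have "(1/2::real)^(p n + 1) \<le> (1/2)^(p n)" by simp
    then show "dist t (\<pi> n t) \<le> (1/2)^(p n)" using \<pi>(2)[OF t, of n] by linarith
  qed
  have \<pi>2: "\<rho> (\<pi> n t) (\<pi> (Suc n) t) \<le> c * (1/4)^n" if t: "t \<in> B" for n t
  proof (rule \<rho>_small[OF \<pi>B[OF t] \<pi>B[OF t]])
    have "(1/2::real)^(p (Suc n) + 1) \<le> (1/2)^(p n + 1)" using p_mono[of n] by (intro power_decreasing) auto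
    then have "dist (\<pi> n t) (\<pi> (Suc n) t) \<le> (1/2)^(p n + 1) + (1/2)^(p n + 1)"
      using \<pi>(2)[OF t, of n] \<pi>(2)[OF t, of "Suc n"] dist_triangle3[of "\<pi> n t" "\<pi> (Suc n) t" t] by linarith
    then show "dist (\<pi> n t) (\<pi> (Suc n) t) \<le> (1/2)^(p n)" by simp
  qed
  have \<pi>lim: "(\<lambda>n. \<pi> n t) \<longlonglongrightarrow> t" if t: "t \<in> B" for t
  proof -
    define q where "q = 2 powr - \<epsilon>"
    have q: "0 < q" "q < 1" using powr_less_mono[of "- \<epsilon>" 0 2] \<epsilon> by (auto simp: q_def)
    have "dist (\<pi> n t) t \<le> q ^ n" for n
    proof -
      have "dist (\<pi> n t) t \<le> (1/2)^(p n + 1)" using \<pi>(2)[OF t, of n] by (simp add: dist_commute)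
      also have "\<dots> \<le> (1/2)^(p n)" by simp
      also have "\<dots> \<le> 1 / real (p n)"
      proof -
        have "real (p n) \<le> 2 ^ p n" using of_nat_less_two_power[of "p n"] by (simp add: less_imp_le)
        then show ?thesis using p1[of n] by (simp add: power_one_over) (intro divide_left_mono, auto)
      qed
      also have "\<dots> \<le> 1 / x n" using p_ge[of n] x1[of n] by (intro divide_left_mono) auto
      also have "\<dots> = q ^ n"
        by (simp add: x_def q_def powr_minus_divide power_one_over powr_powr mult.commute power_divide flip: powr_realpow)
      finally show ?thesis .
    qed
    note le = this
    have "(\<lambda>n. dist (\<pi> n t) t) \<longlonglongrightarrow> 0"
    proof (rule tendsto_sandwich[OF _ _ tendsto_const])
      show "\<forall>\<^sub>F n in sequentially. 0 \<le> dist (\<pi> n t) t" by simp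
      show "\<forall>\<^sub>F n in sequentially. dist (\<pi> n t) t \<le> q ^ n" using le by (intro always_eventually allI)
      show "(\<lambda>n. q ^ n) \<longlonglongrightarrow> 0" using q by (intro LIMSEQ_power_zero) auto
    qed
    then show ?thesis by (rule tendsto_dist_iff[THEN iffD2])
  qed
  have "AE \<omega> in M. \<forall>\<^sub>F n in sequentially. \<forall>t\<in>B. \<forall>s\<in>B.
    \<bar>Y \<omega> t - Y \<omega> s\<bar> \<le> 2 * 2 powr (real n * \<epsilon>) * \<rho> t s + C * (1/2)^n"
    using AE1 AE_space
  proof eventually_elim
    case (elim \<omega>)
    then obtain n0 where n0: "\<And>n. n \<ge> n0 \<Longrightarrow> \<omega> \<notin> E n" by (auto simp: eventually_sequentially)
    have ctl: "\<bar>Y \<omega> u - Y \<omega> v\<bar> \<le> x n * \<rho> u v" if "n \<ge> n0" "u \<in> DD n" "v \<in> DD n" for n u v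
      using n0[OF that(1)] that(2,3) elim(2) unfolding E_def ev_def by force
    have xn: "x n * (c * (1/4)^n) \<le> c * (1/2)^n" for n
    proof -
      have "x n * (c * (1/4)^n) \<le> 2 ^ n * (c * (1/4)^n)" using x_le[of n] c by (intro mult_right_mono) auto
      also have "\<dots> = c * (1/2)^n" by (simp add: power_one_over field_simps flip: power_mult_distrib)
      finally show ?thesis .
    qed
    have st: "\<bar>Y \<omega> (\<pi> (Suc n) t) - Y \<omega> (\<pi> n t)\<bar> \<le> c * (1/2)^n" if t: "t \<in> B" and n: "n \<ge> n0" for t n
    proof -
      have "\<bar>Y \<omega> (\<pi> n t) - Y \<omega> (\<pi> (Suc n) t)\<bar> \<le> x n * \<rho> (\<pi> n t) (\<pi> (Suc n) t)"
        using \<pi>(1)[OF t] by (intro ctl[OF n]) (auto simp: DD_def)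
      also have "\<dots> \<le> x n * (c * (1/4)^n)" using \<pi>2[OF t, of n] x1[of n] by (intro mult_left_mono) auto
      also note xn
      finally show ?thesis by (simp add: abs_minus_commute)
    qed
    have tele: "\<bar>Y \<omega> (\<pi> (n + k) t) - Y \<omega> (\<pi> n t)\<bar> \<le> 2 * c * (1/2)^n - 2 * c * (1/2)^(n+k)"
      if t: "t \<in> B" and n: "n \<ge> n0" for t n k
    proof (induction k)
      case (Suc k)
      have "\<bar>Y \<omega> (\<pi> (Suc (n + k)) t) - Y \<omega> (\<pi> (n + k) t)\<bar> \<le> c * (1/2)^(n + k)" using n by (intro st[OF t]) simp
      then show ?case using Suc by simp
    qed simp
    have chain: "\<bar>Y \<omega> t - Y \<omega> (\<pi> n t)\<bar> \<le> 2 * c * (1/2)^n" if t: "t \<in> B" and n: "n \<ge> n0" for t n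
    proof -
      \<comment> \<open>Continuity of the path carries the bound from the nets to \<open>t\<close>
        itself.\<close>
      have "(\<lambda>k. Y \<omega> (\<pi> k t)) \<longlonglongrightarrow> Y \<omega> t"
        using continuous_on_tendsto_compose[OF cont[OF elim(2)] \<pi>lim[OF t]] by simp
      then have "(\<lambda>k. \<bar>Y \<omega> (\<pi> k t) - Y \<omega> (\<pi> n t)\<bar>) \<longlonglongrightarrow> \<bar>Y \<omega> t - Y \<omega> (\<pi> n t)\<bar>"
        by (intro tendsto_intros)
      then show ?thesis
      proof (rule LIMSEQ_le_const2, intro exI[of _ n] allI impI)
        fix k assume "k \<ge> n"
        then have "\<bar>Y \<omega> (\<pi> k t) - Y \<omega> (\<pi> n t)\<bar> \<le> 2 * c * (1/2)^n - 2 * c * (1/2)^k"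
          using tele[OF t n, of "k - n"] by simp
        moreover have "0 \<le> 2 * c * (1/2)^k" using c by simp
        ultimately show "\<bar>Y \<omega> (\<pi> k t) - Y \<omega> (\<pi> n t)\<bar> \<le> 2 * c * (1/2)^n" by linarith
      qed
    qed
    show ?case unfolding eventually_sequentially
    proof (intro exI[of _ n0] allI impI ballI)
      fix n t s assume n: "n0 \<le> n" and t: "t \<in> B" and s: "s \<in> B"
      have "\<bar>Y \<omega> (\<pi> n t) - Y \<omega> (\<pi> n s)\<bar> \<le> x n * \<rho> (\<pi> n t) (\<pi> n s)"
        using \<pi>(1)[OF t] \<pi>(1)[OF s] by (intro ctl[OF n]) (auto simp: DD_def)
      also have "\<dots> \<le> x n * (2 * (\<rho> t s + c * (1/4)^n + c * (1/4)^n))"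
      proof (intro mult_left_mono)
        have "\<rho> (\<pi> n t) (\<pi> n s) \<le> 2 * (\<rho> t s + \<rho> t (\<pi> n t) + \<rho> s (\<pi> n s))"
          unfolding \<rho>_def by (rule gaussian_increment_quasi_triangle[OF M G])
        also have "\<dots> \<le> 2 * (\<rho> t s + c * (1/4)^n + c * (1/4)^n)"
          by (intro mult_left_mono add_mono order_refl \<pi>1 t s) simp
        finally show "\<rho> (\<pi> n t) (\<pi> n s) \<le> 2 * (\<rho> t s + c * (1/4)^n + c * (1/4)^n)" .
      qed (use x1[of n] in linarith)
      also have "\<dots> = 2 * x n * \<rho> t s + 4 * (x n * (c * (1/4)^n))" by (simp add: algebra_simps)
      also have "\<dots> \<le> 2 * x n * \<rho> t s + 4 * (c * (1/2)^n)" using xn[of n] by simp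
      finally have "\<bar>Y \<omega> (\<pi> n t) - Y \<omega> (\<pi> n s)\<bar> \<le> 2 * x n * \<rho> t s + 4 * (c * (1/2)^n)" .
      then have "\<bar>Y \<omega> t - Y \<omega> s\<bar> \<le> 2 * x n * \<rho> t s + 8 * (c * (1/2)^n)"
        using chain[OF t n] chain[OF s n] by linarith
      also have "8 * (c * (1/2)^n) \<le> C * (1/2)^n"
        unfolding C_def using c by (simp add: algebra_simps)
      finally show "\<bar>Y \<omega> t - Y \<omega> s\<bar> \<le> 2 * 2 powr (real n * \<epsilon>) * \<rho> t s + C * (1/2)^n" by (simp add: x_def)
    qed
  qed
  moreover have "C \<ge> 1" using c by (simp add: C_def)
  ultimately show thesis using that by blast
qed

section \<open>Gaussian fields with drift\<close>

text \<open>The argument is replaced by the first point of a dense sequence within 1/(k+1) of it,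
  which leaves a countable case distinction; continuity of the paths takes the limit.\<close>

lemma caratheodory_joint_measurable:
  fixes X :: "'w \<Rightarrow> 'a::{metric_space, second_countable_topology} \<Rightarrow> 'b::metric_space"
  assumes X: "\<And>t. (\<lambda>\<omega>. X \<omega> t) \<in> borel_measurable M"
    and cont: "\<And>\<omega>. \<omega> \<in> space M \<Longrightarrow> continuous_on UNIV (X \<omega>)"
  shows "(\<lambda>p. X (fst p) (snd p)) \<in> borel_measurable (M \<Otimes>\<^sub>M borel)"
proof -
  obtain D :: "'a set" where D: "countable D" "\<And>U. open U \<Longrightarrow> U \<noteq> {} \<Longrightarrow> \<exists>d\<in>D. d \<in> U"
    using countable_dense_exists by blast
  define d where "d = from_nat_into D"
  have ex: "\<exists>j. dist (d j) t < 1 / real (Suc k)" for t k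
  proof -
    obtain u where "u \<in> D" "u \<in> ball t (1 / real (Suc k))" using D(2)[of "ball t (1 / real (Suc k))"] by auto
    then show ?thesis using from_nat_into_surj[OF D(1), of u] by (auto simp: d_def dist_commute)
  qed
  define g where "g k t = (LEAST j. dist (d j) t < 1 / real (Suc k))" for k t
  have g: "dist (d (g k t)) t < 1 / real (Suc k)" for k t unfolding g_def by (rule LeastI_ex[OF ex])
  have gm: "g k \<in> measurable borel (count_space UNIV)" for k unfolding g_def by measurable
  have lim: "(\<lambda>k. d (g k t)) \<longlonglongrightarrow> t" for t
  proof -
    have "(\<lambda>k. dist (d (g k t)) t) \<longlonglongrightarrow> 0"
    proof (rule tendsto_sandwich[OF _ _ tendsto_const])
      show "\<forall>\<^sub>F k in sequentially. 0 \<le> dist (d (g k t)) t" by simp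
      show "\<forall>\<^sub>F k in sequentially. dist (d (g k t)) t \<le> 1 / real (Suc k)"
        using g by (intro always_eventually allI less_imp_le)
      show "(\<lambda>k. 1 / real (Suc k)) \<longlonglongrightarrow> 0" using LIMSEQ_inverse_real_of_nat by (simp add: inverse_eq_divide)
    qed
    then show ?thesis by (rule tendsto_dist_iff[THEN iffD2])
  qed
  show ?thesis
  proof (rule borel_measurable_LIMSEQ_metric)
    fix k
    show "(\<lambda>p. X (fst p) (d (g k (snd p)))) \<in> borel_measurable (M \<Otimes>\<^sub>M borel)"
    proof (rule measurable_compose_countable[of "\<lambda>j p. X (fst p) (d j)"])
      show "(\<lambda>p. X (fst p) (d j)) \<in> borel_measurable (M \<Otimes>\<^sub>M borel)" for j
        by (rule measurable_compose[OF measurable_fst X])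
      show "(\<lambda>p. g k (snd p)) \<in> measurable (M \<Otimes>\<^sub>M borel) (count_space UNIV)"
        by (rule measurable_compose[OF measurable_snd gm])
    qed
  next
    fix p assume "p \<in> space (M \<Otimes>\<^sub>M (borel :: 'a measure))"
    then have "fst p \<in> space M" by (auto simp: space_pair_measure)
    then show "(\<lambda>k. X (fst p) (d (g k (snd p)))) \<longlonglongrightarrow> X (fst p) (snd p)"
      using continuous_on_tendsto_compose[OF cont lim[of "snd p"]] by simp
  qed
qed

text \<open>The pieces in the definition of regularity are arbitrary sets. Extending the modulus to
  their closures, by continuity of the paths and Fatou, allows \<open>A\<close> to be cut into
  Suslin pieces. Approximating points have distance x < 3/2 * 2^-m, and (4/3)^m * 3/2 * 2^-m = 3/2 *
  (2/3)^m \<le> 1 gives ln (1/x) \<ge> m ln (4/3), hence the constant.\<close>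

lemma log_modulus_closure:
  fixes Y :: "'w \<Rightarrow> 'a::real_normed_vector \<Rightarrow> real"
  assumes M: "prob_space M" and G: "centered_gaussian_field M Y"
    and cont: "\<And>\<omega>. \<omega> \<in> space M \<Longrightarrow> continuous_on UNIV (Y \<omega>)" and c: "c > 0"
  defines "\<rho> \<equiv> \<lambda>t s. sqrt (integral\<^sup>L M (\<lambda>\<omega>. (Y \<omega> t - Y \<omega> s)\<^sup>2))"
  assumes reg: "\<And>t s. t \<in> S \<Longrightarrow> s \<in> S \<Longrightarrow> 0 < norm (t - s) \<Longrightarrow> norm (t - s) < 1 \<Longrightarrow> \<rho> t s \<le> c / (ln (1 / norm (t - s))) ^ N"
    and ts: "t \<in> closure S" "s \<in> closure S" "dist t s \<le> (1/2)^m" "m \<ge> 1"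
  shows "\<rho> t s \<le> c / ln (4/3) ^ N / real m ^ N"
proof -
  interpret prob_space M by fact
  have meas: "(\<lambda>\<omega>. Y \<omega> t) \<in> borel_measurable M" for t
    by (rule centered_gaussian_rv_measurable[OF centered_gaussian_field_point[OF G]])
  have int: "integrable M (\<lambda>\<omega>. (Y \<omega> t - Y \<omega> s)\<^sup>2)" for t s
    by (rule centered_gaussian_rv_square_integrable[OF M centered_gaussian_field_diff[OF G]])
  define e where "e t s = integral\<^sup>L M (\<lambda>\<omega>. (Y \<omega> t - Y \<omega> s)\<^sup>2)" for t s
  have e0: "e t s \<ge> 0" for t s unfolding e_def by simp
  have nn: "(\<integral>\<^sup>+\<omega>. ennreal ((Y \<omega> t - Y \<omega> s)\<^sup>2) \<partial>M) = ennreal (e t s)" for t s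
    unfolding e_def by (rule nn_integral_eq_integral[OF int]) simp
  have \<rho>e: "\<rho> t s = sqrt (e t s)" for t s by (simp add: \<rho>_def e_def)
  define b where "b = c / ln (4/3) ^ N / real m ^ N"
  have b0: "b \<ge> 0" using c by (simp add: b_def)
  obtain T where T: "\<And>p. T p \<in> S" "T \<longlonglongrightarrow> t" using ts(1) closure_sequential by metis
  obtain U where U: "\<And>p. U p \<in> S" "U \<longlonglongrightarrow> s" using ts(2) closure_sequential by metis
  have "(\<lambda>p. dist (T p) (U p)) \<longlonglongrightarrow> dist t s" by (intro tendsto_intros T U)
  moreover have "dist t s < 3/2 * (1/2)^m" using ts(3) zero_less_power[of "1/2::real" m] by linarith
  ultimately have "\<forall>\<^sub>F p in sequentially. dist (T p) (U p) < 3/2 * (1/2)^m" by (rule order_tendstoD(2))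
  then have ev: "\<forall>\<^sub>F p in sequentially. e (T p) (U p) \<le> b\<^sup>2"
  proof eventually_elim
    case (elim p)
    have "\<rho> (T p) (U p) \<le> b"
    proof (cases "T p = U p")
      case True
      then show ?thesis using b0 by (simp add: \<rho>_def)
    next
      case False
      define x where "x = norm (T p - U p)"
      have x: "0 < x" "x < 3/2 * (1/2)^m" using False elim by (auto simp: x_def dist_norm)
      have m2: "(1/2::real)^m \<le> (1/2)^1" using ts(4) by (intro power_decreasing) auto
      have "x < 1" using x(2) m2 by simp
      have "real m * ln (4/3) \<le> ln (1 / x)"
      proof -
        have "(4/3::real)^m \<le> 1 / x"
        proof -
          have "(4/3::real)^m * x \<le> (4/3)^m * (3/2 * (1/2)^m)" using x(2) by (intro mult_left_mono) auto
          also have "\<dots> = 3/2 * (2/3)^m" by (simp flip: power_mult_distrib)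
          also have "\<dots> \<le> 3/2 * (2/3)^1" using ts(4) by (intro mult_left_mono power_decreasing) auto
          finally show ?thesis using x(1) by (simp add: pos_le_divide_eq)
        qed
        then have "ln ((4/3::real)^m) \<le> ln (1 / x)" using x(1) by (subst ln_le_cancel_iff) auto
        then show ?thesis by (simp add: ln_realpow)
      qed
      moreover have "0 < real m * ln (4/3)" using ts(4) by simp
      ultimately have "(real m * ln (4/3)) ^ N \<le> (ln (1 / x)) ^ N" by (intro power_mono) auto
      then have "c / (ln (1 / x)) ^ N \<le> c / (real m * ln (4/3)) ^ N"
        using c \<open>0 < real m * ln (4/3)\<close> by (intro divide_left_mono mult_pos_pos) (auto intro: less_le_trans[OF zero_less_power])
      also have "\<dots> = b" by (simp add: b_def power_mult_distrib)
      finally show ?thesis using reg[OF T(1) U(1), of p p] x(1) \<open>x < 1\<close> by (simp add: x_def)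
    qed
    then have "(\<rho> (T p) (U p))\<^sup>2 \<le> b\<^sup>2" by (intro power_mono) (auto simp: \<rho>_def)
    then show ?case using e0 by (simp add: \<rho>e)
  qed
  have "ennreal (e t s) = (\<integral>\<^sup>+\<omega>. ennreal ((Y \<omega> t - Y \<omega> s)\<^sup>2) \<partial>M)" by (simp add: nn)
  also have "\<dots> = (\<integral>\<^sup>+\<omega>. liminf (\<lambda>p. ennreal ((Y \<omega> (T p) - Y \<omega> (U p))\<^sup>2)) \<partial>M)"
  proof (rule nn_integral_cong)
    fix \<omega> assume \<omega>: "\<omega> \<in> space M"
    have "(\<lambda>p. Y \<omega> (T p)) \<longlonglongrightarrow> Y \<omega> t" "(\<lambda>p. Y \<omega> (U p)) \<longlonglongrightarrow> Y \<omega> s"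
      using continuous_on_tendsto_compose[OF cont[OF \<omega>] T(2)] continuous_on_tendsto_compose[OF cont[OF \<omega>] U(2)] by auto
    then have "(\<lambda>p. ennreal ((Y \<omega> (T p) - Y \<omega> (U p))\<^sup>2)) \<longlonglongrightarrow> ennreal ((Y \<omega> t - Y \<omega> s)\<^sup>2)"
      by (intro tendsto_ennrealI tendsto_intros)
    then show "ennreal ((Y \<omega> t - Y \<omega> s)\<^sup>2) = liminf (\<lambda>p. ennreal ((Y \<omega> (T p) - Y \<omega> (U p))\<^sup>2))"
      by (intro lim_imp_Liminf[symmetric]) auto
  qed
  also have "\<dots> \<le> liminf (\<lambda>p. \<integral>\<^sup>+\<omega>. ennreal ((Y \<omega> (T p) - Y \<omega> (U p))\<^sup>2) \<partial>M)"
    using meas by (intro nn_integral_liminf) measurable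
  also have "\<dots> = liminf (\<lambda>p. ennreal (e (T p) (U p)))" by (simp add: nn)
  also have "\<dots> \<le> liminf (\<lambda>p. ennreal (b\<^sup>2))"
    by (rule Liminf_mono) (use ev in \<open>auto elim: eventually_mono intro: ennreal_leI\<close>)
  also have "\<dots> = ennreal (b\<^sup>2)" by (simp add: Liminf_const)
  finally have "e t s \<le> b\<^sup>2" by (simp add: ennreal_le_iff)
  then have "sqrt (e t s) \<le> sqrt (b\<^sup>2)" by (rule real_sqrt_le_mono)
  then show ?thesis using b0 by (simp add: \<rho>e b_def)
qed

section \<open>The kernel in coordinates and the Gaussian kernel bounds\<close>

lemma kern_vec:
  fixes y z :: "real ^ 'd"
  shows "kern n y z = (\<Prod>i\<in>UNIV. 3 / (1 + real_of_int \<bar>\<lfloor>2^n * y $ i\<rfloor> - \<lfloor>2^n * z $ i\<rfloor>\<bar>))"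
proof -
  have B: "(Basis :: (real ^ 'd) set) = range (\<lambda>i. axis i 1)" by (auto simp: Basis_vec_def)
  have inj: "inj (\<lambda>i. axis i (1::real) :: real ^ 'd)" by (auto simp: inj_on_def axis_eq_axis)
  show ?thesis unfolding kern_eq B by (subst prod.reindex[OF inj]) (simp add: inner_axis)
qed

lemma kern_Pair:
  fixes t s :: "'a::euclidean_space" and y z :: "'b::euclidean_space"
  shows "kern n (t, y) (s, z) = kern n t s * kern n y z"
proof -
  have disj: "(\<lambda>u::'a. (u, 0::'b)) ` Basis \<inter> (\<lambda>v. (0, v)) ` Basis = {}" by auto
  show ?thesis
    unfolding kern_eq Basis_prod_def
    by (subst prod.union_disjoint[OF _ _ disj]) (auto simp: prod.reindex inj_on_def)
qed

lemma kern_ge_1: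
  fixes t s :: "'a::euclidean_space"
  assumes "dist t s \<le> (1/2)^n"
  shows "1 \<le> kern n t s"
proof -
  have "1 \<le> 3 / (1 + real_of_int \<bar>\<lfloor>2^n * (t \<bullet> b)\<rfloor> - \<lfloor>2^n * (s \<bullet> b)\<rfloor>\<bar>)" if "b \<in> Basis" for b
  proof (rule kern_factor)
    have "\<bar>t \<bullet> b - s \<bullet> b\<bar> \<le> norm (t - s)" using Basis_le_norm[OF that, of "t - s"] by (simp add: inner_diff_left)
    then show "1 * \<bar>t \<bullet> b - s \<bullet> b\<bar> \<le> (1/2)^n" using assms by (simp add: dist_norm)
  qed auto
  then show ?thesis unfolding kern_eq by (intro prod_ge_1) auto
qed

lemma gaussian_kernel_bound:
  fixes X :: "'w \<Rightarrow> 't \<Rightarrow> real ^ 'd" and f :: "'t \<Rightarrow> real ^ 'd"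
  assumes M: "prob_space M" and G: "\<And>i. centered_gaussian_field M (\<lambda>\<omega> t. X \<omega> t $ i)"
    and ind: "prob_space.indep_vars M (\<lambda>_. Pi\<^sub>M UNIV (\<lambda>_. borel)) (\<lambda>i \<omega>. (\<lambda>t. X \<omega> t $ i)) UNIV"
    and C: "C \<ge> 1" and C1: "C1 \<ge> 0" "sqrt 2 * exp (- ((2 powr (real n * \<epsilon>))\<^sup>2) / 4) \<le> C1 * (1/2)^n"
    and \<epsilon>: "\<epsilon> > 0" and R: "norm y \<le> R" "norm z \<le> R"
    and yz: "\<And>i. \<bar>(y - z) $ i - (f t - f s) $ i\<bar> \<le> 2 * 2 powr (real n * \<epsilon>) * canon_metric M X i t s + C * (1/2)^n"
  shows "measure M {\<omega>\<in>space M. dist (X \<omega> s + f s) (X \<omega> t + f t) \<le> (1/2)^n}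
    \<le> ((8 * C + C1 * (2 * R)) * 2 powr (real n * \<epsilon>)) ^ CARD('d) * kern n y z"
proof -
  interpret prob_space M by fact
  define L where "L = 2 powr (real n * \<epsilon>)"
  have L: "L \<ge> 1" unfolding L_def using \<epsilon> by (simp add: ge_one_powr_ge_zero)
  \<comment> \<open>\<open>8 * C\<close> covers the small-ball part; the tail part is at most C1
    2^-n times |u| \<le> 2R.\<close>
  define C3 where "C3 = 8 * C + C1 * (2 * R)"
  have R0: "R \<ge> 0" using R(1) norm_ge_zero[of y] by linarith
  have C3: "C3 \<ge> 1" using C C1(1) R0 by (simp add: C3_def add_increasing2)
  define V where "V i \<omega> = X \<omega> t $ i - X \<omega> s $ i" for i \<omega>
  define a where "a i = (f t - f s) $ i" for i
  have V: "centered_gaussian_rv M (V i)" for i unfolding V_def by (rule centered_gaussian_field_diff[OF G])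
  have Vm: "V i \<in> borel_measurable M" for i by (rule centered_gaussian_rv_measurable[OF V])
  define p where "p i = measure M {\<omega>\<in>space M. \<bar>V i \<omega> + a i\<bar> \<le> (1/2)^n}" for i
  have p_le: "p i \<le> C3 * L * (3 / (1 + real_of_int \<bar>\<lfloor>2^n * y $ i\<rfloor> - \<lfloor>2^n * z $ i\<rfloor>\<bar>))" for i
  proof -
    define u where "u = y $ i - z $ i"
    have "\<bar>u\<bar> \<le> norm y + norm z"
      using component_le_norm_cart[of y i] component_le_norm_cart[of z i] by (simp add: u_def)
    then have u: "\<bar>u\<bar> \<le> 2 * R" using R by linarith
    have "p i * \<bar>u\<bar> \<le> 8 * C * L * (1/2)^n + sqrt 2 * exp (- (L\<^sup>2) / 4) * \<bar>u\<bar>"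
      unfolding p_def
    proof (rule gaussian_shifted_small_ball[OF M V C L])
      show "\<bar>u - a i\<bar> \<le> 2 * L * sqrt (integral\<^sup>L M (\<lambda>\<omega>. (V i \<omega>)\<^sup>2)) + C * (1/2)^n"
        using yz[of i] by (simp add: u_def a_def L_def V_def canon_metric_def)
    qed simp
    also have "sqrt 2 * exp (- (L\<^sup>2) / 4) * \<bar>u\<bar> \<le> C1 * (1/2)^n * (2 * R)"
      unfolding L_def by (rule mult_mono[OF C1(2) u]) (use C1(1) in auto)
    also have "C1 * (1/2)^n * (2 * R) \<le> C1 * (1/2)^n * (2 * R) * L"
      using mult_left_mono[OF L, of "C1 * (1/2)^n * (2 * R)"] C1(1) R0 by simp
    also have "8 * C * L * (1/2)^n + C1 * (1/2)^n * (2 * R) * L = C3 * L * (1/2)^n"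
      by (simp add: C3_def algebra_simps)
    finally have pu: "p i * \<bar>u\<bar> \<le> C3 * L * (1/2)^n" by simp
    have C3L: "C3 * L \<ge> 1" using C3 L mult_mono[of 1 C3 1 L] by simp
    have "p i / (C3 * L) \<le> 3 / (1 + real_of_int \<bar>\<lfloor>2^n * y $ i\<rfloor> - \<lfloor>2^n * z $ i\<rfloor>\<bar>)"
    proof (rule kern_factor)
      show "0 \<le> p i / (C3 * L)" using C3L by (simp add: p_def)
      have "p i \<le> 1" by (simp add: p_def)
      then show "p i / (C3 * L) \<le> 1" using C3L by (subst pos_divide_le_eq) auto
      show "p i / (C3 * L) * \<bar>y $ i - z $ i\<bar> \<le> (1/2)^n"
        using pu C3L by (simp add: u_def pos_divide_le_eq mult.commute)
    qed
    then show ?thesis using C3L by (simp add: pos_divide_le_eq mult.commute)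
  qed
  have "measure M {\<omega>\<in>space M. dist (X \<omega> s + f s) (X \<omega> t + f t) \<le> (1/2)^n}
      \<le> measure M (\<Inter>i\<in>UNIV. V i -` {v. \<bar>v + a i\<bar> \<le> (1/2)^n} \<inter> space M)"
  proof (rule finite_measure_mono)
    show "{\<omega>\<in>space M. dist (X \<omega> s + f s) (X \<omega> t + f t) \<le> (1/2)^n} \<subseteq> (\<Inter>i\<in>UNIV. V i -` {v. \<bar>v + a i\<bar> \<le> (1/2)^n} \<inter> space M)"
    proof (intro subsetI INT_I IntI vimageI2 CollectI)
      fix \<omega> i assume \<omega>: "\<omega> \<in> {\<omega>\<in>space M. dist (X \<omega> s + f s) (X \<omega> t + f t) \<le> (1/2)^n}"
      then show "\<omega> \<in> space M" by simp
      have "V i \<omega> + a i = ((X \<omega> t + f t) - (X \<omega> s + f s)) $ i" by (simp add: V_def a_def)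
      then have "\<bar>V i \<omega> + a i\<bar> \<le> norm ((X \<omega> t + f t) - (X \<omega> s + f s))" using component_le_norm_cart by metis
      then show "\<bar>V i \<omega> + a i\<bar> \<le> (1/2)^n" using \<omega> by (simp add: dist_norm norm_minus_commute)
    qed
    have "V i -` {v. \<bar>v + a i\<bar> \<le> (1/2)^n} \<inter> space M \<in> sets M" for i
      by (rule measurable_sets[OF Vm]) measurable
    then show "(\<Inter>i\<in>UNIV. V i -` {v. \<bar>v + a i\<bar> \<le> (1/2)^n} \<inter> space M) \<in> sets M" by (intro sets.finite_INT) auto
  qed
  also have "\<dots> = (\<Prod>i\<in>UNIV. prob (V i -` {v. \<bar>v + a i\<bar> \<le> (1/2)^n} \<inter> space M))"
  proof (rule indep_varsD_finite[where M'="\<lambda>_. borel"])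
    \<comment> \<open>An increment is a measurable function of one coordinate process, and these
      processes are independent.\<close>
    have "indep_vars (\<lambda>_. borel) (\<lambda>i \<omega>. (\<lambda>g. g t - g s) (\<lambda>t. X \<omega> t $ i)) UNIV"
      by (rule indep_vars_compose2[OF ind]) measurable
    then show "indep_vars (\<lambda>_. borel) V UNIV" unfolding V_def by simp
  qed auto
  also have "\<dots> = (\<Prod>i\<in>UNIV. p i)"
    unfolding p_def by (intro prod.cong arg_cong[where f=prob]) auto
  also have "\<dots> \<le> (\<Prod>i\<in>(UNIV::'d set). C3 * L * (3 / (1 + real_of_int \<bar>\<lfloor>2^n * y $ i\<rfloor> - \<lfloor>2^n * z $ i\<rfloor>\<bar>)))"
    by (intro prod_mono conjI p_le) (simp add: p_def)
  also have "\<dots> = (C3 * L) ^ CARD('d) * kern n y z"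
    unfolding kern_vec by (subst prod.distrib) (simp only: prod_constant)
  finally show ?thesis by (simp add: C3_def L_def)
qed

text \<open>The almost sure modulus is taken for the countably many exponents \<open>e q\<close>. An
  arbitrary \<epsilon> is served by some \<open>q\<close> with
  \<open>e q * real CARD('d) \<le> \<epsilon>\<close>, since the loss is raised to the power
  \<open>CARD('d)\<close>.\<close>

lemma gaussian_drift_kernel:
  fixes X :: "'w \<Rightarrow> 't::euclidean_space \<Rightarrow> real ^ 'd" and f :: "'t \<Rightarrow> real ^ 'd"
  assumes M: "prob_space M" and G: "\<And>i. centered_gaussian_field M (\<lambda>\<omega> t. X \<omega> t $ i)"
    and ind: "prob_space.indep_vars M (\<lambda>_. Pi\<^sub>M UNIV (\<lambda>_. borel)) (\<lambda>i \<omega>. (\<lambda>t. X \<omega> t $ i)) UNIV"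
    and cont: "\<And>\<omega>. \<omega> \<in> space M \<Longrightarrow> continuous_on UNIV (X \<omega>)"
    and S: "bounded S"
    and reg: "\<And>(N::nat) i. \<exists>c>0. \<forall>m\<ge>1. \<forall>t\<in>S. \<forall>s\<in>S. dist t s \<le> (1/2)^m \<longrightarrow> canon_metric M X i t s \<le> c / real m ^ N"
  shows "AE \<omega> in M. kernel_dominated M (\<lambda>\<omega> t. X \<omega> t + f t) \<omega> S"
proof -
  define e where "e q = 1 / real (Suc q)" for q
  have e: "0 < e q" "e q \<le> 1" for q by (auto simp: e_def)
  have "\<exists>C\<ge>1. AE \<omega> in M. \<forall>\<^sub>F n in sequentially. \<forall>t\<in>S. \<forall>s\<in>S.
    \<bar>X \<omega> t $ i - X \<omega> s $ i\<bar> \<le> 2 * 2 powr (real n * e q) * canon_metric M X i t s + C * (1/2)^n" for q i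
  proof -
    have c: "continuous_on UNIV (\<lambda>t. X \<omega> t $ i)" if "\<omega> \<in> space M" for \<omega>
      using cont[OF that] by (intro continuous_intros)
    show ?thesis
      unfolding canon_metric_def
    proof (rule gaussian_modulus[OF M G[of i] c S e(1)[of q] e(2)[of q] reg[where i=i, unfolded canon_metric_def]])
      fix C :: real
      assume "1 \<le> C" "AE \<omega> in M. \<forall>\<^sub>F n in sequentially. \<forall>t\<in>S. \<forall>s\<in>S.
        \<bar>X \<omega> t $ i - X \<omega> s $ i\<bar> \<le> 2 * 2 powr (real n * e q) * sqrt (\<integral>\<omega>. (X \<omega> t $ i - X \<omega> s $ i)\<^sup>2 \<partial>M) + C * (1/2)^n"
      then show "\<exists>C\<ge>1. AE \<omega> in M. \<forall>\<^sub>F n in sequentially. \<forall>t\<in>S. \<forall>s\<in>S.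
        \<bar>X \<omega> t $ i - X \<omega> s $ i\<bar> \<le> 2 * 2 powr (real n * e q) * sqrt (\<integral>\<omega>. (X \<omega> t $ i - X \<omega> s $ i)\<^sup>2 \<partial>M) + C * (1/2)^n"
        by (intro exI[of _ C] conjI)
    qed
  qed
  note ex = this
  define good where "good q i C \<longleftrightarrow> C \<ge> 1 \<and> (AE \<omega> in M. \<forall>\<^sub>F n in sequentially. \<forall>t\<in>S. \<forall>s\<in>S.
    \<bar>X \<omega> t $ i - X \<omega> s $ i\<bar> \<le> 2 * 2 powr (real n * e q) * canon_metric M X i t s + C * (1/2)^n)" for q i C
  have "\<exists>C. good q i C" for q i using ex[of i q] unfolding good_def .
  then obtain C0 where "\<And>q i. good q i (C0 q i)" by metis
  then have C0: "C0 q i \<ge> 1" and AE0: "AE \<omega> in M. \<forall>\<^sub>F n in sequentially. \<forall>t\<in>S. \<forall>s\<in>S.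
    \<bar>X \<omega> t $ i - X \<omega> s $ i\<bar> \<le> 2 * 2 powr (real n * e q) * canon_metric M X i t s + C0 q i * (1/2)^n" for q i
    unfolding good_def by simp_all
  have "AE \<omega> in M. \<forall>q. \<forall>i\<in>UNIV. \<forall>\<^sub>F n in sequentially. \<forall>t\<in>S. \<forall>s\<in>S.
    \<bar>X \<omega> t $ i - X \<omega> s $ i\<bar> \<le> 2 * 2 powr (real n * e q) * canon_metric M X i t s + C0 q i * (1/2)^n"
    unfolding AE_all_countable using AE0 by (intro allI AE_finite_allI) auto
  then show ?thesis
  proof eventually_elim
    case (elim \<omega>)
    show ?case
      unfolding kernel_dominated_def
    proof (intro allI impI)
      fix \<epsilon> R :: real assume \<epsilon>: "\<epsilon> > 0"
      obtain q where q: "e q < \<epsilon> / real CARD('d)"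
        using nat_approx_posE[of "\<epsilon> / real CARD('d)"] \<epsilon> unfolding e_def by auto
      then have q': "e q * real CARD('d) \<le> \<epsilon>" by (simp add: field_simps)
      define C where "C = (\<Sum>i\<in>UNIV. C0 q i)"
      have CC: "C0 q i \<le> C" for i
        unfolding C_def using C0[of q] by (intro member_le_sum) (auto intro: order_trans[OF zero_le_one])
      have C1: "C \<ge> 1" using CC C0 order_trans by blast
      obtain D where D: "D \<ge> 0" "\<And>n. sqrt 2 * exp (- ((2 powr (real n * e q))\<^sup>2) / 4) \<le> D * (1/2)^n"
        using gaussian_tail_le_dyadic[OF e(1)] by blast
      \<comment> \<open>\<open>R\<close> is arbitrary and may be negative; the maximum keeps
        \<open>K\<close> nonnegative.\<close>
      define R' where "R' = max R 0"
      define K where "K = 8 * C + D * (2 * R')"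
      have K0: "K \<ge> 0" using C1 D(1) by (simp add: K_def R'_def)
      have "\<forall>\<^sub>F n in sequentially. \<forall>i\<in>UNIV. \<forall>t\<in>S. \<forall>s\<in>S.
          \<bar>X \<omega> t $ i - X \<omega> s $ i\<bar> \<le> 2 * 2 powr (real n * e q) * canon_metric M X i t s + C0 q i * (1/2)^n"
        using elim by (intro eventually_ball_finite) auto
      then have "\<forall>\<^sub>F n in sequentially. \<forall>t\<in>S. \<forall>s\<in>S.
        norm (X \<omega> t + f t) \<le> R \<longrightarrow> norm (X \<omega> s + f s) \<le> R \<longrightarrow>
        measure M {\<omega>'\<in>space M. dist (X \<omega>' s + f s) (X \<omega>' t + f t) \<le> (1/2)^n}
        \<le> K ^ CARD('d) * 2 powr (real n * \<epsilon>) * kern n (X \<omega> t + f t) (X \<omega> s + f s)"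
      proof eventually_elim
        case (elim n)
        show ?case
        proof (intro ballI impI)
          fix t s assume ts: "t \<in> S" "s \<in> S" and nR: "norm (X \<omega> t + f t) \<le> R" "norm (X \<omega> s + f s) \<le> R"
          have "measure M {\<omega>'\<in>space M. dist (X \<omega>' s + f s) (X \<omega>' t + f t) \<le> (1/2)^n}
            \<le> (K * 2 powr (real n * e q)) ^ CARD('d) * kern n (X \<omega> t + f t) (X \<omega> s + f s)"
            unfolding K_def
          proof (rule gaussian_kernel_bound[OF M G ind C1 D(1) D(2) e(1)])
            show "norm (X \<omega> t + f t) \<le> R'" "norm (X \<omega> s + f s) \<le> R'" using nR by (auto simp: R'_def)
            fix i
            have "\<bar>(X \<omega> t + f t - (X \<omega> s + f s)) $ i - (f t - f s) $ i\<bar> = \<bar>X \<omega> t $ i - X \<omega> s $ i\<bar>" by simp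
            also have "\<dots> \<le> 2 * 2 powr (real n * e q) * canon_metric M X i t s + C0 q i * (1/2)^n" using elim ts by blast
            also have "\<dots> \<le> 2 * 2 powr (real n * e q) * canon_metric M X i t s + C * (1/2)^n"
              using CC by (intro add_left_mono mult_right_mono) auto
            finally show "\<bar>(X \<omega> t + f t - (X \<omega> s + f s)) $ i - (f t - f s) $ i\<bar>
              \<le> 2 * 2 powr (real n * e q) * canon_metric M X i t s + C * (1/2)^n" .
          qed
          also have "(K * 2 powr (real n * e q)) ^ CARD('d) \<le> K ^ CARD('d) * 2 powr (real n * \<epsilon>)"
          proof -
            have "(2 powr (real n * e q)) ^ CARD('d) = 2 powr (real n * (e q * real CARD('d)))"
              by (simp add: powr_powr mult.assoc flip: powr_realpow)
            also have "\<dots> \<le> 2 powr (real n * \<epsilon>)" using q' by (intro powr_mono mult_left_mono) auto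
            finally show ?thesis using K0 by (simp add: power_mult_distrib mult_left_mono)
          qed
          finally show "measure M {\<omega>'\<in>space M. dist (X \<omega>' s + f s) (X \<omega>' t + f t) \<le> (1/2)^n}
            \<le> K ^ CARD('d) * 2 powr (real n * \<epsilon>) * kern n (X \<omega> t + f t) (X \<omega> s + f s)"
            by (simp add: mult_right_mono cell_kernel_nonneg)
        qed
      qed
      then show "\<exists>C\<ge>0. \<forall>\<^sub>F n in sequentially. \<forall>t\<in>S. \<forall>s\<in>S.
        norm (X \<omega> t + f t) \<le> R \<longrightarrow> norm (X \<omega> s + f s) \<le> R \<longrightarrow>
        measure M {\<omega>'\<in>space M. dist (X \<omega>' s + f s) (X \<omega>' t + f t) \<le> (1/2)^n}
        \<le> C * 2 powr (real n * \<epsilon>) * kern n (X \<omega> t + f t) (X \<omega> s + f s)"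
        using K0 by (intro exI[of _ "K ^ CARD('d)"]) auto
    qed
  qed
qed

text \<open>Either |t - s| exceeds 2^-n and the event is empty, or the position factor of the kernel
  on pairs is at least 1, and dropping the position from the distance only enlarges the
  event.\<close>

lemma graph_kernel_bound:
  fixes Y :: "'w \<Rightarrow> 't::euclidean_space \<Rightarrow> 'b::euclidean_space"
  assumes M: "prob_space M" and Y: "\<And>t. (\<lambda>\<omega>. Y \<omega> t) \<in> borel_measurable M" and C: "C \<ge> 0"
    and ker: "measure M {\<omega>'\<in>space M. dist (Y \<omega>' s) (Y \<omega>' t) \<le> (1/2)^n} \<le> C * kern n (Y \<omega> t) (Y \<omega> s)"
  shows "measure M {\<omega>'\<in>space M. dist (s, Y \<omega>' s) (t, Y \<omega>' t) \<le> (1/2)^n} \<le> C * kern n (t, Y \<omega> t) (s, Y \<omega> s)"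
proof (cases "dist s t \<le> (1/2)^n")
  case True
  interpret prob_space M by fact
  have "measure M {\<omega>'\<in>space M. dist (s, Y \<omega>' s) (t, Y \<omega>' t) \<le> (1/2)^n} \<le> measure M {\<omega>'\<in>space M. dist (Y \<omega>' s) (Y \<omega>' t) \<le> (1/2)^n}"
  proof (rule finite_measure_mono)
    show "{\<omega>'\<in>space M. dist (s, Y \<omega>' s) (t, Y \<omega>' t) \<le> (1/2)^n} \<subseteq> {\<omega>'\<in>space M. dist (Y \<omega>' s) (Y \<omega>' t) \<le> (1/2)^n}"
    proof (intro Collect_mono impI conjI; elim conjE)
      fix \<omega>' assume "dist (s, Y \<omega>' s) (t, Y \<omega>' t) \<le> (1/2)^n"
      then show "dist (Y \<omega>' s) (Y \<omega>' t) \<le> (1/2)^n"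
        using dist_snd_le[of "(s, Y \<omega>' s)" "(t, Y \<omega>' t)"] by simp
    qed
    show "{\<omega>'\<in>space M. dist (Y \<omega>' s) (Y \<omega>' t) \<le> (1/2)^n} \<in> sets M" using Y[of s] Y[of t] by measurable
  qed
  also note ker
  also have "C * kern n (Y \<omega> t) (Y \<omega> s) \<le> C * (kern n t s * kern n (Y \<omega> t) (Y \<omega> s))"
    using kern_ge_1[of t s n] True C cell_kernel_nonneg[of "cell n (Y \<omega> t)" "cell n (Y \<omega> s)"]
    by (intro mult_left_mono) (auto simp: dist_commute mult_le_cancel_right1 not_le)
  finally show ?thesis by (simp add: kern_Pair)
next
  case False
  have "dist s t \<le> dist (s, y) (t, z)" for y z :: 'b using dist_fst_le[of "(s, y)" "(t, z)"] by simp
  then have "{\<omega>'\<in>space M. dist (s, Y \<omega>' s) (t, Y \<omega>' t) \<le> (1/2)^n} = {}" using False order_trans by blast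
  then have "measure M {\<omega>'\<in>space M. dist (s, Y \<omega>' s) (t, Y \<omega>' t) \<le> (1/2)^n} = 0" by (simp only: measure_empty)
  also have "0 \<le> C * kern n (t, Y \<omega> t) (s, Y \<omega> s)" using C cell_kernel_nonneg by (rule mult_nonneg_nonneg)
  finally show ?thesis .
qed

lemma kernel_dominated_graph:
  fixes Y :: "'w \<Rightarrow> 't::euclidean_space \<Rightarrow> 'b::euclidean_space"
  assumes M: "prob_space M" and Y: "\<And>t. (\<lambda>\<omega>. Y \<omega> t) \<in> borel_measurable M"
    and ker: "kernel_dominated M Y \<omega> S"
  shows "kernel_dominated M (\<lambda>\<omega> t. (t, Y \<omega> t)) \<omega> S"
  unfolding kernel_dominated_def
proof (intro allI impI)
  fix \<epsilon> R :: real assume "\<epsilon> > 0"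
  with ker obtain C where C: "C \<ge> 0" "\<forall>\<^sub>F n in sequentially. \<forall>t\<in>S. \<forall>s\<in>S.
    norm (Y \<omega> t) \<le> R \<longrightarrow> norm (Y \<omega> s) \<le> R \<longrightarrow>
    measure M {\<omega>'\<in>space M. dist (Y \<omega>' s) (Y \<omega>' t) \<le> (1/2)^n} \<le> C * 2 powr (real n * \<epsilon>) * kern n (Y \<omega> t) (Y \<omega> s)"
    by (rule kernel_dominatedD)
  from C(2) have "\<forall>\<^sub>F n in sequentially. \<forall>t\<in>S. \<forall>s\<in>S.
    norm (t, Y \<omega> t) \<le> R \<longrightarrow> norm (s, Y \<omega> s) \<le> R \<longrightarrow>
    measure M {\<omega>'\<in>space M. dist (s, Y \<omega>' s) (t, Y \<omega>' t) \<le> (1/2)^n}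
      \<le> C * 2 powr (real n * \<epsilon>) * kern n (t, Y \<omega> t) (s, Y \<omega> s)"
  proof eventually_elim
    case (elim n)
    show ?case
    proof (intro ballI impI graph_kernel_bound[OF M Y])
      fix t s assume ts: "t \<in> S" "s \<in> S" "norm (t, Y \<omega> t) \<le> R" "norm (s, Y \<omega> s) \<le> R"
      have "norm (Y \<omega> t) \<le> R" "norm (Y \<omega> s) \<le> R"
        using ts(3,4) norm_snd_le[where x=t and y="Y \<omega> t"] norm_snd_le[where x=s and y="Y \<omega> s"] by linarith+
      then show "measure M {\<omega>'\<in>space M. dist (Y \<omega>' s) (Y \<omega>' t) \<le> (1/2)^n}
        \<le> C * 2 powr (real n * \<epsilon>) * kern n (Y \<omega> t) (Y \<omega> s)"
        using elim ts(1,2) by blast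
    qed (use C(1) in auto)
  qed
  with C(1) show "\<exists>C\<ge>0. \<forall>\<^sub>F n in sequentially. \<forall>t\<in>S. \<forall>s\<in>S.
    norm (t, Y \<omega> t) \<le> R \<longrightarrow> norm (s, Y \<omega> s) \<le> R \<longrightarrow>
    measure M {\<omega>'\<in>space M. dist (s, Y \<omega>' s) (t, Y \<omega>' t) \<le> (1/2)^n}
      \<le> C * 2 powr (real n * \<epsilon>) * kern n (t, Y \<omega> t) (s, Y \<omega> s)" by blast
qed

theorem mainTheorem1:
  fixes M :: "'w measure"
    and X :: "'w \<Rightarrow> real^'n \<Rightarrow> real^'d"
    and f :: "real^'n \<Rightarrow> real^'d"
    and A :: "(real^'n) set"
  assumes "prob_space M"
    and "\<And>i. centered_gaussian_field M (\<lambda>\<omega> t. X \<omega> t $ i)"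
    and "prob_space.indep_vars M (\<lambda>_. Pi\<^sub>M UNIV (\<lambda>_. borel)) (\<lambda>i \<omega>. (\<lambda>t. X \<omega> t $ i)) UNIV"
    and "\<forall>\<omega>\<in>space M. continuous_on UNIV (X \<omega>)"
    and "f \<in> borel_measurable borel"
    and "analytic_set A"
    and "regular_on M X A"
  shows "(AE \<omega> in M. packing_dim ((\<lambda>t. X \<omega> t + f t) ` A)
                       = dimPZ M (\<lambda>\<omega> t. X \<omega> t + f t) A)
       \<and> (AE \<omega> in M. packing_dim ((\<lambda>t. (t, X \<omega> t + f t)) ` A)
                       = dimPZ M (\<lambda>\<omega> t. (t, X \<omega> t + f t)) A)"
proof -
  note M = assms(1) and G = assms(2) and ind = assms(3) and f = assms(5)
  have cont: "continuous_on UNIV (X \<omega>)" if "\<omega> \<in> space M" for \<omega> using assms(4) that by blast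
  have conti: "continuous_on UNIV (\<lambda>t. X \<omega> t $ i)" if "\<omega> \<in> space M" for \<omega> i
    using cont[OF that] by (intro continuous_intros)
  from assms(7) obtain Ak :: "nat \<Rightarrow> (real^'n) set" where Ak: "A = (\<Union>k. Ak k)" and
    reg: "\<forall>k (N::nat). \<exists>c>0. \<forall>t\<in>Ak k. \<forall>s\<in>Ak k. \<forall>i. 0 < norm (t - s) \<and> norm (t - s) < 1 \<longrightarrow>
            canon_metric M X i t s \<le> c / (ln (1 / norm (t - s))) ^ N"
    unfolding regular_on_def by blast
  \<comment> \<open>Closures make the pieces closed and balls make them bounded; intersected with
    \<open>A\<close> they are Suslin, and each \<open>Ak k\<close> is exhausted as \<open>j\<close>
    grows.\<close>
  define S where "S p = (case prod_decode p of (k, j) \<Rightarrow> closure (Ak k) \<inter> cball 0 (real j))" for p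
  define B where "B p = A \<inter> S p" for p
  have AB: "A = (\<Union>p. B p)"
  proof (intro set_eqI iffI)
    fix t assume t: "t \<in> A"
    then obtain k where k: "t \<in> Ak k" using Ak by auto
    obtain j where "norm t \<le> real j" using real_arch_simple by blast
    then have "t \<in> B (prod_encode (k, j))" using t k closure_subset by (auto simp: B_def S_def)
    then show "t \<in> (\<Union>p. B p)" by blast
  qed (auto simp: B_def)
  have BS: "B p \<subseteq> S p" for p by (simp add: B_def)
  have Sb: "bounded (S p)" for p
    by (auto simp: S_def split: prod.splits intro: bounded_subset[OF bounded_cball])
  have Sc: "closed (S p)" for p by (auto simp: S_def split: prod.splits)
  have regS: "\<exists>c>0. \<forall>m\<ge>1. \<forall>t\<in>S p. \<forall>s\<in>S p. dist t s \<le> (1/2)^m \<longrightarrow> canon_metric M X i t s \<le> c / real m ^ N" for p i and N :: nat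
  proof -
    obtain k j where kj: "prod_decode p = (k, j)" by fastforce
    obtain c where c: "c > 0" "\<And>t s. t \<in> Ak k \<Longrightarrow> s \<in> Ak k \<Longrightarrow> 0 < norm (t - s) \<Longrightarrow> norm (t - s) < 1 \<Longrightarrow>
            canon_metric M X i t s \<le> c / (ln (1 / norm (t - s))) ^ N"
      using reg by blast
    have "canon_metric M X i t s \<le> c / ln (4/3) ^ N / real m ^ N"
      if "m \<ge> 1" "t \<in> S p" "s \<in> S p" "dist t s \<le> (1/2)^m" for m t s
      unfolding canon_metric_def
    proof (rule log_modulus_closure[OF M G conti c(1) c(2)[unfolded canon_metric_def]])
      show "t \<in> closure (Ak k)" "s \<in> closure (Ak k)" using that by (auto simp: S_def kj)
    qed (use that in auto)
    moreover have "c / ln (4/3) ^ N > 0" using c(1) by simp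
    ultimately show ?thesis by blast
  qed
  have ker: "AE \<omega> in M. \<forall>p. kernel_dominated M (\<lambda>\<omega> t. X \<omega> t + f t) \<omega> (S p)"
    unfolding AE_all_countable using gaussian_drift_kernel[OF M G ind cont Sb regS] by blast
  have Xm: "(\<lambda>\<omega>. X \<omega> t) \<in> borel_measurable M" for t
  proof (subst borel_measurable_euclidean_space, intro ballI)
    fix b :: "real^'d" assume "b \<in> Basis"
    then obtain i where "b = axis i 1" by (auto simp: Basis_vec_def)
    then show "(\<lambda>\<omega>. X \<omega> t \<bullet> b) \<in> borel_measurable M"
      using centered_gaussian_rv_measurable[OF centered_gaussian_field_point[OF G]] by (simp add: inner_axis)
  qed
  have Ym: "(\<lambda>\<omega>. X \<omega> t + f t) \<in> borel_measurable M" for t using Xm by measurable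
  have Z1: "(\<lambda>p. X (fst p) (snd p) + f (snd p)) \<in> borel_measurable (M \<Otimes>\<^sub>M borel)"
    using caratheodory_joint_measurable[OF Xm cont] measurable_compose[OF measurable_snd f] by (rule borel_measurable_add)
  have Z2: "(\<lambda>p. (snd p, X (fst p) (snd p) + f (snd p))) \<in> borel_measurable (M \<Otimes>\<^sub>M borel)"
    using measurable_snd Z1 by (rule borel_measurable_Pair)
  have par: "\<exists>F (a :: (nat \<Rightarrow> nat) \<Rightarrow> real^'n). closed F \<and> continuous_on F a \<and> a ` F = B p \<and>
      continuous_on F (\<lambda>x. X \<omega> (a x) + f (a x))" if "\<omega> \<in> space M" for \<omega> p
  proof -
    have "suslin (B p)" unfolding B_def
      by (intro suslin_Int analytic_imp_suslin[OF assms(6)] closed_suslin Sc)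
    then obtain F and a :: "(nat \<Rightarrow> nat) \<Rightarrow> real^'n" where F: "closed F" "continuous_on F a" "a ` F = B p" "continuous_on F (\<lambda>x. f (a x))"
      by (rule suslin_parametrization[OF _ f])
    \<comment> \<open>The parametrization depends on \<open>f\<close> and \<open>B p\<close> alone;
      every path is continuous and stays so after composition with \<open>a\<close>.\<close>
    then show ?thesis
      by (intro exI[of _ F] exI[of _ a] conjI continuous_on_add continuous_on_compose2[OF cont[OF that]]) auto
  qed
  show ?thesis
  proof
    show "AE \<omega> in M. packing_dim ((\<lambda>t. X \<omega> t + f t) ` A) = dimPZ M (\<lambda>\<omega> t. X \<omega> t + f t) A"
      using ker AE_space AE_dimPZ_le_packing_dim[OF M Z1, of A]
    proof eventually_elim
      case (elim \<omega>)
      have "packing_dim ((\<lambda>t. X \<omega> t + f t) ` A) \<le> dimPZ M (\<lambda>\<omega> t. X \<omega> t + f t) A"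
        by (rule packing_dim_le_dimPZ[OF M Z1 elim(2) AB par[OF elim(2)] BS elim(1)[rule_format]])
      with elim(3) show ?case by (rule antisym[rotated])
    qed
    show "AE \<omega> in M. packing_dim ((\<lambda>t. (t, X \<omega> t + f t)) ` A) = dimPZ M (\<lambda>\<omega> t. (t, X \<omega> t + f t)) A"
      using ker AE_space AE_dimPZ_le_packing_dim[OF M Z2, of A]
    proof eventually_elim
      case (elim \<omega>)
      have "packing_dim ((\<lambda>t. (t, X \<omega> t + f t)) ` A) \<le> dimPZ M (\<lambda>\<omega> t. (t, X \<omega> t + f t)) A"
      proof (rule packing_dim_le_dimPZ[OF M Z2 elim(2) AB _ BS])
        show "kernel_dominated M (\<lambda>\<omega> t. (t, X \<omega> t + f t)) \<omega> (S p)" for p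
          using elim(1) by (intro kernel_dominated_graph[OF M Ym]) simp
        fix p
        from par[OF elim(2), of p] obtain F and a :: "(nat \<Rightarrow> nat) \<Rightarrow> real^'n"
          where "closed F" "continuous_on F a" "a ` F = B p" "continuous_on F (\<lambda>x. X \<omega> (a x) + f (a x))" by blast
        then show "\<exists>F (a :: (nat \<Rightarrow> nat) \<Rightarrow> real^'n). closed F \<and> continuous_on F a \<and> a ` F = B p \<and>
            continuous_on F (\<lambda>x. (a x, X \<omega> (a x) + f (a x)))"
          by (intro exI[of _ F] exI[of _ a] conjI continuous_on_Pair) auto
      qed
      with elim(3) show ?case by (rule antisym[rotated])
    qed
  qed
qed

end
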